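(* Let $n\in\mathbb N$, $n\geq 2$, and let $p>n$ be real. There exists a constant $C_{p,n}''>0$ depending only on $p$ and $n$ such that for every bounded and convex domain $\Omega$ of $\mathbb R^n$ and every integer $k\geq 1$ the variational Steklov eigenvalues $\sigma_{p,k}$ of the $p$-Laplacian on $\Omega$ satisfy $$\sigma_{p,k}\leq C_{p,n}''\left(\frac{k}{|\partial\Omega|}\right)^{\frac{p-1}{n-1}}.$$
   Context: A domain is an open connected set. $|\partial\Omega|$ denotes the $(n-1)$-dimensional Hausdorff measure of $\partial\Omega$. The Steklov problem for the $p$-Laplacian on a bounded Lipschitz domain $\Omega$ is $\Delta_p u={\rm div}(|\nabla u|^{p-2}\nabla u)=0$ in $\Omega$, $|\nabla u|^{p-2}\frac{\partial u}{\partial\nu}=\sigma|u|^{p-2}u$ on $\partial\Omega$, where $\frac{\partial u}{\partial \nu}$ is the outer normal derivative, understood in the weak sense: $\int_\Omega|\nabla u|^{p-2}\nabla u\cdot\nabla\phi\,dx=\sigma\int_{\partial\Omega}|u|^{p-2}u\phi\,d\sigma(x)$ for all $\phi\in W^{1,p}(\Omega)$, with $d\sigma(x)$ the $(n-1)$-dimensional measure element on $\partial\Omega$. Its variational eigenvalues are defined, for integers $k\ge 1$, by $$\sigma_{p,k}:=\inf_{F\in\Gamma_k}\sup_{u\in F}\mathcal R_p(u),\qquad \mathcal R_p(u):=\frac{\int_{\Omega}|\nabla u|^p\,dx}{\int_{\partial\Omega}|u|^p\,d\sigma(x)},$$ where $\mathcal R_p(u)=+\infty$ if the denominator vanishes.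 Here $\Gamma_k$ is the family of all sets $F\subset W^{1,p}(\Omega)\setminus\{0\}$ such that $F$ is symmetric ($F=-F$), $F\cap\{u:\|u\|_{L^p(\partial\Omega)}=1\}$ is compact, and $\gamma(F)\geq k$, where $\gamma(F)$ is the Krasnoselskii genus $$\gamma(F):=\min\{\ell\in\mathbb N:\text{ there exists } f:F\to\mathbb R^\ell\setminus\{0\}\text{ continuous and odd}\}$$ (with $\gamma(F)=+\infty$ if no such $\ell$ exists), and $\mathbb N$ is the set of positive integers. *)

theory Defs
  imports "HOL-Analysis.Analysis"
begin

section \<open>Hausdorff measure\<close>

text \<open>
  The constant \<open>unit_ball_vol s / 2 ^ s\<close> normalises the \<open>n\<close>-dimensional Hausdorff measure on
  \<open>n\<close>-dimensional Euclidean space to Lebesgue measure. Empty covering sets are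
  singled out because of the convention \<open>0 ^ 0 = 1\<close>.
\<close>

definition hausdorff_weight :: "nat \<Rightarrow> 'a::euclidean_space set \<Rightarrow> ennreal" where
  "hausdorff_weight s A =
     (if A = {} then 0 else ennreal (unit_ball_vol (real s) * (diameter A / 2) ^ s))"

definition hausdorff_content :: "nat \<Rightarrow> real \<Rightarrow> 'a::euclidean_space set \<Rightarrow> ennreal" where
  "hausdorff_content s \<delta> A =
     (INF C \<in> {C :: nat \<Rightarrow> 'a set. A \<subseteq> (\<Union>j. C j) \<and> (\<forall>j. bounded (C j) \<and> diameter (C j) \<le> \<delta>)}.
        \<Sum>j. hausdorff_weight s (C j))"

definition hausdorff_outer_measure :: "nat \<Rightarrow> 'a::euclidean_space set \<Rightarrow> ennreal" where
  "hausdorff_outer_measure s A = (SUP \<delta> \<in> {0<..}. hausdorff_content s \<delta> A)"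

text \<open>
  The outer measure is a metric outer measure, hence countably additive on the Borel sets, so
  that \<open>measure_of\<close> does not take its degenerate value here.
\<close>

definition hausdorff_measure :: "nat \<Rightarrow> 'a::euclidean_space measure" where
  "hausdorff_measure s = measure_of UNIV (sets borel) (hausdorff_outer_measure s)"

definition boundary_measure :: "'a::euclidean_space set \<Rightarrow> 'a measure" where
  "boundary_measure \<Omega> = restrict_space (hausdorff_measure (DIM('a) - 1)) (frontier \<Omega>)"


section \<open>Sobolev functions\<close>

text \<open>
  Elements of \<open>L\<^sup>p\<close> and \<open>W\<^sup>1\<^sup>,\<^sup>p\<close> are represented by functions instead of classes of functions
  modulo equality almost everywhere; the values outside the domain are irrelevant.
\<close>

definition Lp :: "real \<Rightarrow> 'a measure \<Rightarrow> ('a \<Rightarrow> 'b::euclidean_space) set" where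
  "Lp p M = {f \<in> borel_measurable M. integrable M (\<lambda>x. norm (f x) powr p)}"

definition Lp_norm :: "real \<Rightarrow> 'a measure \<Rightarrow> ('a \<Rightarrow> 'b::euclidean_space) \<Rightarrow> real" where
  "Lp_norm p M f = (\<integral>x. norm (f x) powr p \<partial>M) powr (1 / p)"

definition C1_with_gradient :: "('a::euclidean_space \<Rightarrow> real) \<Rightarrow> ('a \<Rightarrow> 'a) \<Rightarrow> bool" where
  "C1_with_gradient \<phi> \<psi> \<longleftrightarrow> (\<forall>x. GDERIV \<phi> x :> \<psi> x) \<and> continuous_on UNIV \<psi>"

definition compactly_supported_in :: "'a::euclidean_space set \<Rightarrow> ('a \<Rightarrow> real) \<Rightarrow> bool" where
  "compactly_supported_in \<Omega> \<phi> \<longleftrightarrow> (\<exists>K. compact K \<and> K \<subseteq> \<Omega> \<and> (\<forall>x. x \<notin> K \<longrightarrow> \<phi> x = 0))"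

definition locally_integrable_on ::
    "'a::euclidean_space set \<Rightarrow> ('a \<Rightarrow> 'b::euclidean_space) \<Rightarrow> bool" where
  "locally_integrable_on \<Omega> f \<longleftrightarrow> (\<forall>K. compact K \<and> K \<subseteq> \<Omega> \<longrightarrow> integrable (lebesgue_on K) f)"

text \<open>
  For first-order weak derivatives, testing with compactly supported \<open>C\<^sup>1\<close> functions is the same
  as testing with compactly supported smooth ones. The integral identity is vector-valued: it
  collects the identities for all partial derivatives.
\<close>

definition has_weak_gradient ::
    "'a::euclidean_space set \<Rightarrow> ('a \<Rightarrow> real) \<Rightarrow> ('a \<Rightarrow> 'a) \<Rightarrow> bool" where
  "has_weak_gradient \<Omega> u G \<longleftrightarrow>
     locally_integrable_on \<Omega> u \<and> locally_integrable_on \<Omega> G \<and>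
     (\<forall>\<phi> \<psi>. C1_with_gradient \<phi> \<psi> \<and> compactly_supported_in \<Omega> \<phi> \<longrightarrow>
        (\<integral>x. u x *\<^sub>R \<psi> x \<partial>lebesgue_on \<Omega>) = - (\<integral>x. \<phi> x *\<^sub>R G x \<partial>lebesgue_on \<Omega>))"

text \<open>The weak gradient is unique up to null sets; a representative is chosen.\<close>

definition weak_gradient :: "'a::euclidean_space set \<Rightarrow> ('a \<Rightarrow> real) \<Rightarrow> 'a \<Rightarrow> 'a" where
  "weak_gradient \<Omega> u = (SOME G. has_weak_gradient \<Omega> u G)"

definition sobolev :: "real \<Rightarrow> 'a::euclidean_space set \<Rightarrow> ('a \<Rightarrow> real) set" where
  "sobolev p \<Omega> =
     {u \<in> Lp p (lebesgue_on \<Omega>). \<exists>G \<in> Lp p (lebesgue_on \<Omega>). has_weak_gradient \<Omega> u G}"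

definition sobolev_norm :: "real \<Rightarrow> 'a::euclidean_space set \<Rightarrow> ('a \<Rightarrow> real) \<Rightarrow> real" where
  "sobolev_norm p \<Omega> u =
     ((\<integral>x. \<bar>u x\<bar> powr p \<partial>lebesgue_on \<Omega>)
       + (\<integral>x. norm (weak_gradient \<Omega> u x) powr p \<partial>lebesgue_on \<Omega>)) powr (1 / p)"

text \<open>
  The norm topology, pulled back from classes of functions to functions. It is not Hausdorff:
  functions that agree almost everywhere on the domain are topologically indistinguishable.
\<close>

definition sobolev_open :: "real \<Rightarrow> 'a::euclidean_space set \<Rightarrow> ('a \<Rightarrow> real) set \<Rightarrow> bool" where
  "sobolev_open p \<Omega> U \<longleftrightarrow> U \<subseteq> sobolev p \<Omega> \<and>
     (\<forall>u\<in>U. \<exists>e>0. \<forall>v\<in>sobolev p \<Omega>. sobolev_norm p \<Omega> (\<lambda>x. v x - u x) < e \<longrightarrow> v \<in> U)"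

definition sobolev_topology :: "real \<Rightarrow> 'a::euclidean_space set \<Rightarrow> ('a \<Rightarrow> real) topology" where
  "sobolev_topology p \<Omega> = topology (sobolev_open p \<Omega>)"

lemma istopology_sobolev_open: "istopology (sobolev_open p \<Omega>)"
  unfolding istopology_def
proof (intro conjI allI impI)
  fix S T assume S: "sobolev_open p \<Omega> S" and T: "sobolev_open p \<Omega> T"
  have "\<exists>e>0. \<forall>v\<in>sobolev p \<Omega>. sobolev_norm p \<Omega> (\<lambda>x. v x - u x) < e \<longrightarrow> v \<in> S \<inter> T"
    if u: "u \<in> S \<inter> T" for u
  proof -
    obtain d where "d > 0" "\<forall>v\<in>sobolev p \<Omega>. sobolev_norm p \<Omega> (\<lambda>x. v x - u x) < d \<longrightarrow> v \<in> S"
      using S u unfolding sobolev_open_def by blast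
    moreover obtain e where "e > 0" "\<forall>v\<in>sobolev p \<Omega>. sobolev_norm p \<Omega> (\<lambda>x. v x - u x) < e \<longrightarrow> v \<in> T"
      using T u unfolding sobolev_open_def by blast
    ultimately show ?thesis by (intro exI[of _ "min d e"]) auto
  qed
  then show "sobolev_open p \<Omega> (S \<inter> T)"
    using S unfolding sobolev_open_def by blast
next
  fix K assume K: "\<forall>U\<in>K. sobolev_open p \<Omega> U"
  have "\<exists>e>0. \<forall>v\<in>sobolev p \<Omega>. sobolev_norm p \<Omega> (\<lambda>x. v x - u x) < e \<longrightarrow> v \<in> \<Union>K"
    if u: "u \<in> \<Union>K" for u
  proof -
    obtain U where "U \<in> K" "u \<in> U" using u by blast
    moreover from this obtain e where "e > 0"
        "\<forall>v\<in>sobolev p \<Omega>. sobolev_norm p \<Omega> (\<lambda>x. v x - u x) < e \<longrightarrow> v \<in> U"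
      using K unfolding sobolev_open_def by blast
    ultimately show ?thesis by (intro exI[of _ e]) auto
  qed
  moreover have "\<Union>K \<subseteq> sobolev p \<Omega>"
    using K unfolding sobolev_open_def by (intro Union_least) blast
  ultimately show "sobolev_open p \<Omega> (\<Union>K)"
    unfolding sobolev_open_def by (intro conjI ballI)
qed

lemma openin_sobolev_topology: "openin (sobolev_topology p \<Omega>) U \<longleftrightarrow> sobolev_open p \<Omega> U"
  by (simp add: sobolev_topology_def istopology_sobolev_open)


section \<open>Boundary traces\<close>

text \<open>
  The trace operator is the extension by continuity, from functions that are \<open>C\<^sup>1\<close> up to the
  boundary to \<open>W\<^sup>1\<^sup>,\<^sup>p\<close>, of the restriction to the boundary. On a bounded Lipschitz domain every
  Sobolev function has a trace in this sense, unique up to null sets of the boundary measure.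
\<close>

definition has_trace ::
    "real \<Rightarrow> 'a::euclidean_space set \<Rightarrow> ('a \<Rightarrow> real) \<Rightarrow> ('a \<Rightarrow> real) \<Rightarrow> bool" where
  "has_trace p \<Omega> u g \<longleftrightarrow>
     u \<in> sobolev p \<Omega> \<and> g \<in> Lp p (boundary_measure \<Omega>) \<and>
     (\<exists>\<phi> :: nat \<Rightarrow> 'a \<Rightarrow> real.
        (\<forall>m. (\<exists>\<psi>. C1_with_gradient (\<phi> m) \<psi>) \<and>
             \<phi> m \<in> sobolev p \<Omega> \<and> \<phi> m \<in> Lp p (boundary_measure \<Omega>)) \<and>
        (\<lambda>m. sobolev_norm p \<Omega> (\<lambda>x. \<phi> m x - u x)) \<longlonglongrightarrow> 0 \<and>
        (\<lambda>m. Lp_norm p (boundary_measure \<Omega>) (\<lambda>x. \<phi> m x - g x)) \<longlonglongrightarrow> 0)"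

definition trace_on_boundary ::
    "real \<Rightarrow> 'a::euclidean_space set \<Rightarrow> ('a \<Rightarrow> real) \<Rightarrow> 'a \<Rightarrow> real" where
  "trace_on_boundary p \<Omega> u = (SOME g. has_trace p \<Omega> u g)"


section \<open>Variational Steklov eigenvalues\<close>

text \<open>
  The dimension \<open>l\<close> ranges over the positive integers, and the infimum of the empty set
  is \<open>\<infinity>\<close>. Continuous maps from a set of functions to a Hausdorff
  space do not distinguish functions that agree almost everywhere.
\<close>

definition krasnoselskii_genus ::
    "real \<Rightarrow> 'a::euclidean_space set \<Rightarrow> ('a \<Rightarrow> real) set \<Rightarrow> enat" where
  "krasnoselskii_genus p \<Omega> F =
     Inf (enat ` {l. l \<ge> 1 \<and>
       (\<exists>f :: ('a \<Rightarrow> real) \<Rightarrow> (nat \<Rightarrow> real).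
          continuous_map (subtopology (sobolev_topology p \<Omega>) F)
            (subtopology (Euclidean_space l) (- {\<lambda>i. 0})) f \<and>
          (\<forall>u\<in>F. f (\<lambda>x. - u x) = (\<lambda>i. - f u i)))})"

text \<open>
  The sets are required to be nonempty, so that the suprema below are not taken over the empty
  set (with the above definition the empty set has genus 1).
\<close>

definition steklov_admissible ::
    "real \<Rightarrow> 'a::euclidean_space set \<Rightarrow> nat \<Rightarrow> ('a \<Rightarrow> real) set set" where
  "steklov_admissible p \<Omega> k =
     {F. F \<noteq> {} \<and> F \<subseteq> sobolev p \<Omega> \<and>
         (\<forall>u\<in>F. \<not> (AE x in lebesgue_on \<Omega>. u x = 0)) \<and>
         (\<forall>u\<in>F. (\<lambda>x. - u x) \<in> F) \<and>
         compactin (sobolev_topology p \<Omega>)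
           {u \<in> F. Lp_norm p (boundary_measure \<Omega>) (trace_on_boundary p \<Omega> u) = 1} \<and>
         krasnoselskii_genus p \<Omega> F \<ge> enat k}"

definition steklov_quotient :: "real \<Rightarrow> 'a::euclidean_space set \<Rightarrow> ('a \<Rightarrow> real) \<Rightarrow> ennreal" where
  "steklov_quotient p \<Omega> u =
     (let num = \<integral>x. norm (weak_gradient \<Omega> u x) powr p \<partial>lebesgue_on \<Omega>;
          den = \<integral>x. \<bar>trace_on_boundary p \<Omega> u x\<bar> powr p \<partial>boundary_measure \<Omega>
      in if den = 0 then \<infinity> else ennreal (num / den))"

definition steklov_eigenvalue :: "real \<Rightarrow> 'a::euclidean_space set \<Rightarrow> nat \<Rightarrow> ennreal" where
  "steklov_eigenvalue p \<Omega> k =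
     (INF F \<in> steklov_admissible p \<Omega> k. SUP u \<in> F. steklov_quotient p \<Omega> u)"

end

theory Submission
  imports Defs "HOL-Library.Z2"
begin

text \<open>
  The eigenvalue is tested with \<open>k\<close> bumps of a common radius \<open>2 r\<close> that are centred at boundary
  points, where \<open>r ^ (n - 1)\<close> is a small multiple of \<open>|\<partial>\<Omega>| / k\<close>. Two properties of convex domains
  make this work.

  First, a ball of radius \<open>R\<close> contains boundary of area at most \<open>C * R ^ (n - 1)\<close>, because the
  nearest-point projection to the closure of \<open>\<Omega>\<close> is 1-Lipschitz and maps the surface of a cube around
  the ball onto that piece of boundary (\<open>hausdorff_frontier_ball_le\<close>). Hence fewer than \<open>k\<close> balls of
  radius \<open>4 r\<close> do not cover the boundary, and \<open>k\<close> boundary points with disjoint bumps exist.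

  Second, the volume of \<open>\<Omega>\<close> in the ball of radius \<open>2 r\<close> about a boundary point is at most \<open>C * r\<close> times
  the boundary area in the concentric ball of radius \<open>r\<close>: points of \<open>\<Omega>\<close> close to the centre reach the
  boundary if they are moved by at most \<open>r / 2\<close> along an outer normal (\<open>volume_le_hausdorff_frontier\<close>).
  Volume and boundary area become small together, so this holds even if \<open>\<Omega>\<close> is much thinner than \<open>r\<close>.
  The quotient of each bump is therefore at most \<open>C * r powr (1 - p)\<close>, which is the asserted power
  of \<open>k / |\<partial>\<Omega>|\<close>.

  Since the supports are disjoint, all nonzero linear combinations of the bumps obey the same bound.
  They form a set of genus at least \<open>k\<close> by the theorem of Borsuk and Ulam (\<open>Borsuk_Ulam\<close>), which is
  derived from Ky Fan's count of alternating simplices modulo 2.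

  Gradients and traces are given by weak notions and a choice of representatives; for \<open>C\<^sup>1\<close> functions
  they have to be identified with the classical ones. For gradients this is integration by parts and the
  fundamental lemma of the calculus of variations (\<open>weak_gradient_C1\<close>). For traces it is Morrey's
  inequality: as \<open>p > n\<close>, convergence in \<open>W\<^sup>1\<^sup>,\<^sup>p\<close> implies pointwise convergence up to the boundary
  (\<open>trace_C1_unique\<close>). Finally, the Hausdorff outer measure satisfies Caratheodory's criterion for
  closed sets, so that its values on Borel sets are the values of a measure
  (\<open>emeasure_hausdorff_measure\<close>).
\<close>

section \<open>Chains modulo 2 and the Borsuk--Ulam theorem\<close>

text \<open>These rules would turn sums modulo 2 into case distinctions.\<close>

declare add_bit_eq_xor [simp del] mult_bit_eq_and [simp del]

text \<open>
  A list of points is an ordered simplex, possibly degenerate, and its faces arise by deleting one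
  position. The empty list is the face of every vertex, so boundaries are augmented.
\<close>

primrec faces :: "'v list \<Rightarrow> 'v list list" where
  "faces [] = []"
| "faces (v # s) = s # map ((#) v) (faces s)"

text \<open>
  The standard triangulation of the prism between the images of a simplex under \<open>g\<close> and \<open>h\<close>.
\<close>

primrec prism :: "('v \<Rightarrow> 'w) \<Rightarrow> ('v \<Rightarrow> 'w) \<Rightarrow> 'v list \<Rightarrow> 'w list list" where
  "prism g h [] = []"
| "prism g h (x # s) = (g x # h x # map h s) # map ((#) (g x)) (prism g h s)"

text \<open>
  A chain modulo 2 is a list of simplices, of which only the sums of \<open>bit\<close>-valued cochains matter.
  The boundary operator is therefore represented by its dual.
\<close>

definition coboundary :: "('v list \<Rightarrow> bit) \<Rightarrow> 'v list \<Rightarrow> bit" where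
  "coboundary \<phi> s = (\<Sum>t\<leftarrow>faces s. \<phi> t)"

lemma faces_map: "faces (map g s) = map (map g) (faces s)"
  by (induction s) auto

lemma bit_cancel: "(a::bit) + (a + b) = b" "(a::bit) + a = 0"
  by (cases a; simp)+

text \<open>
  The chain homotopy identity \<open>\<partial>P + P\<partial> = h - g\<close>, in which signs disappear modulo 2.
\<close>

lemma prism_homotopy:
  "(\<Sum>\<tau>\<leftarrow>prism g h s. coboundary \<phi> \<tau>)
     = \<phi> (map g s) + \<phi> (map h s) + coboundary (\<lambda>t. \<Sum>\<tau>\<leftarrow>prism g h t. \<phi> \<tau>) s"
proof (induction s arbitrary: \<phi>)
  case Nil
  then show ?case by (simp add: coboundary_def)
next
  case (Cons x s)
  have "(\<Sum>\<tau>\<leftarrow>prism g h (x # s). coboundary \<phi> \<tau>)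
     = \<phi> (h x # map h s) + (\<phi> (g x # map h s) + (\<Sum>t\<leftarrow>faces s. \<phi> (g x # h x # map h t)))
      + ((\<Sum>\<tau>\<leftarrow>prism g h s. \<phi> \<tau>) + (\<Sum>\<tau>\<leftarrow>prism g h s. coboundary (\<lambda>t. \<phi> (g x # t)) \<tau>))"
    by (simp add: coboundary_def faces_map comp_def sum_list_addf algebra_simps)
  also have "\<dots> = \<phi> (map g (x # s)) + \<phi> (map h (x # s)) 
      + coboundary (\<lambda>t. \<Sum>\<tau>\<leftarrow>prism g h t. \<phi> \<tau>) (x # s)"
    by (simp add: Cons.IH)
      (simp add: coboundary_def comp_def sum_list_addf bit_cancel ac_simps)
  finally show ?case .
qed

primrec alternating :: "bool \<Rightarrow> (bool \<times> nat) list \<Rightarrow> bool" where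
  "alternating b [] = True"
| "alternating b (x # xs) = (fst x = b \<and> alternating (\<not> b) xs)"

definition alt_count :: "bool \<Rightarrow> (bool \<times> nat) list \<Rightarrow> bit" where
  "alt_count b L = of_bool (alternating b (sort_key snd L))"

text \<open>
  A nonempty alternating list has exactly one facet that alternates starting with \<open>b\<close>: drop the last
  entry if the list itself starts with \<open>b\<close>, and the first entry otherwise. Lists that do not alternate
  have an even number of alternating facets.
\<close>

lemma coboundary_alternating:
  "coboundary (\<lambda>t. of_bool (alternating b t)) L = of_bool (alternating b L) + of_bool (alternating (\<not> b) L)"
proof (induction L arbitrary: b)
  case Nil
  then show ?case by (simp add: coboundary_def)
next
  case (Cons x L)
  have "coboundary (\<lambda>t. of_bool (alternating b t)) (x # L)
     = of_bool (alternating b L) + (if fst x = b then coboundary (\<lambda>t. of_bool (alternating (\<not> b) t)) L else 0)"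
    by (simp add: coboundary_def comp_def)
  then show ?case
    by (auto simp: Cons.IH bit_cancel)
qed

lemma set_faces: "t \<in> set (faces s) \<Longrightarrow> set t \<subseteq> set s"
  by (induction s arbitrary: t) (auto, blast)

text \<open>
  Sorting commutes with taking faces. This makes the count of alternating simplices independent of
  the order in which the vertices of a simplex are listed.
\<close>

lemma mset_faces_insort:
  assumes "sorted (map f s)"
  shows "mset (faces (insort_key f x s)) = add_mset s (mset (map (insort_key f x) (faces s)))"
  using assms
proof (induction s)
  case Nil
  then show ?case by simp
next
  case (Cons y s)
  show ?case
  proof (cases "f x \<le> f y")
    case True
    have "\<forall>t\<in>set (faces (y # s)). insort_key f x t = x # t"
    proof
      fix t assume "t \<in> set (faces (y # s))"
      then have "set t \<subseteq> set (y # s)" by (rule set_faces)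
      then show "insort_key f x t = x # t"
        using True Cons.prems by (intro insort_is_Cons) force
    qed
    then have "map (insort_key f x) (faces (y # s)) = map ((#) x) (faces (y # s))"
      by (intro map_cong) auto
    moreover have "insort_key f x (y # s) = x # y # s" using True by simp
    ultimately show ?thesis by (simp only: faces.simps(2)[of x] mset.simps)
  next
    case False
    then have "mset (faces (insort_key f x (y # s)))
       = add_mset (insort_key f x s) (image_mset ((#) y) (mset (faces (insort_key f x s))))"
      by simp
    also have "\<dots> = add_mset (y # s) (mset (map (insort_key f x) (faces (y # s))))"
      using Cons False by (simp add: image_mset.compositionality comp_def)
    finally show ?thesis .
  qed
qed

lemma mset_faces_sort: "mset (faces (sort_key f s)) = mset (map (sort_key f) (faces s))"
proof (induction s)
  case Nil
  then show ?case by simp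
next
  case (Cons x s)
  have "mset (faces (sort_key f (x # s))) 
      = add_mset (sort_key f s) (image_mset (insort_key f x) (mset (faces (sort_key f s))))"
    by (simp add: mset_faces_insort)
  also have "\<dots> = mset (map (sort_key f) (faces (x # s)))"
    by (simp add: Cons image_mset.compositionality comp_def)
  finally show ?case .
qed

lemma coboundary_alt_count: "coboundary (alt_count b) L = alt_count b L + alt_count (\<not> b) L"
proof -
  have "coboundary (alt_count b) L = (\<Sum>t\<in>#mset (map (sort_key snd) (faces L)). of_bool (alternating b t))"
    by (simp add: coboundary_def alt_count_def comp_def sum_mset_sum_list[symmetric] image_mset.compositionality)
  also have "\<dots> = coboundary (\<lambda>t. of_bool (alternating b t)) (sort_key snd L)"
    unfolding mset_faces_sort[symmetric]
    by (simp add: coboundary_def sum_mset_sum_list[symmetric])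
  finally show ?thesis
    by (simp add: coboundary_alternating alt_count_def)
qed

lemma alternating_flip: "alternating b (map (apfst Not) L) = alternating (\<not> b) L"
  by (induction L arbitrary: b) auto

lemma sort_key_map: "(\<And>x. f (g x) = f x) \<Longrightarrow> sort_key f (map g L) = map g (sort_key f L)"
proof (induction L)
  case (Cons a L)
  have "insort_key f (g a) (map g M) = map g (insort_key f a M)" for M
    by (induction M) (auto simp: Cons.prems)
  then show ?case using Cons by simp
qed simp

lemma alt_count_flip: "alt_count b (map (apfst Not) L) = alt_count (\<not> b) L"
  unfolding alt_count_def by (subst sort_key_map) (auto simp: alternating_flip)

text \<open>
  In a sorted list equal indices would be adjacent, and alternation would give them opposite signs.
\<close>

lemma alternating_sorted_distinct:
  assumes "sorted (map snd L)" and "alternating b L"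
    and "\<And>x y. x \<in> set L \<Longrightarrow> y \<in> set L \<Longrightarrow> snd x = snd y \<Longrightarrow> fst x = fst y"
  shows "distinct (map snd L)"
  using assms
proof (induction L arbitrary: b)
  case Nil
  then show ?case by simp
next
  case (Cons x L)
  then have IH: "distinct (map snd L)"
    by (metis alternating.simps(2) list.set_intros(2) list.simps(9) sorted_simps(2))
  have "snd x \<notin> set (map snd L)"
  proof
    assume *: "snd x \<in> set (map snd L)"
    then obtain y M where L: "L = y # M" by (cases L) auto
    have "snd x = snd y"
      using * Cons.prems(1) unfolding L by (auto simp: order_antisym)
    then have "fst x = fst y" using Cons.prems(3) L by simp
    then show False using Cons.prems(2) L by auto
  qed
  then show ?case using IH by simp
qed

lemma alt_count_length:
  assumes "alt_count b L = 1" "\<And>x. x \<in> set L \<Longrightarrow> snd x < l"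
    and "\<And>x y. x \<in> set L \<Longrightarrow> y \<in> set L \<Longrightarrow> snd x = snd y \<Longrightarrow> fst x = fst y"
  shows "length L \<le> l"
proof -
  let ?M = "sort_key snd L"
  have "distinct (map snd ?M)"
  proof (rule alternating_sorted_distinct)
    show "alternating b ?M" using assms(1) by (simp add: alt_count_def split: if_splits)
    show "fst x = fst y" if "x \<in> set ?M" "y \<in> set ?M" "snd x = snd y" for x y
      using that assms(3)[of x y] by simp
  qed simp
  then have "length L = card (set (map snd ?M))"
    using distinct_card[of "map snd ?M"] by simp
  also have "\<dots> \<le> card {..<l}"
    using assms(2) by (intro card_mono) auto
  finally show ?thesis by simp
qed

definition antipode :: "(nat \<Rightarrow> real) \<Rightarrow> nat \<Rightarrow> real" where
  "antipode x = (\<lambda>i. - x i)"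

text \<open>
  Level \<open>j\<close> of \<open>N\<close> of the straight motion of \<open>x\<close> to the unit vector \<open>e\<^sub>d\<close>.
\<close>

definition towards_axis :: "nat \<Rightarrow> nat \<Rightarrow> nat \<Rightarrow> (nat \<Rightarrow> real) \<Rightarrow> nat \<Rightarrow> real" where
  "towards_axis N d j x = (\<lambda>i. (1 - real j / real N) * x i + real j / real N * of_bool (i = d))"

text \<open>
  The upper hemisphere of the \<open>d\<close>-dimensional cross-polytope sphere is the cone with apex \<open>e\<^sub>d\<close> over the
  sphere one dimension lower, which is a hemisphere together with its antipode. The cone is built from \<open>N\<close>
  layers of prisms instead of single simplices, so that all simplices become small as \<open>N\<close> grows.
\<close>

primrec hemisphere :: "nat \<Rightarrow> nat \<Rightarrow> (nat \<Rightarrow> real) list list" where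
  "hemisphere N 0 = [[\<lambda>i. of_bool (i = 0)]]"
| "hemisphere N (Suc d) =
     concat (map (\<lambda>j. concat (map (prism (towards_axis N (Suc d) j) (towards_axis N (Suc d) (Suc j)))
       (hemisphere N d @ map (map antipode) (hemisphere N d)))) [0..<N])"

abbreviation sphere_chain :: "nat \<Rightarrow> nat \<Rightarrow> (nat \<Rightarrow> real) list list" where
  "sphere_chain N d \<equiv> hemisphere N d @ map (map antipode) (hemisphere N d)"

definition cross_sphere :: "nat \<Rightarrow> (nat \<Rightarrow> real) set" where
  "cross_sphere d = {x. (\<forall>i>d. x i = 0) \<and> (\<Sum>i\<le>d. \<bar>x i\<bar>) = 1}"

lemma antipode_antipode [simp]: "antipode (antipode x) = x"
  by (simp add: antipode_def)

lemma antipode_cross_sphere [simp]: "antipode x \<in> cross_sphere d \<longleftrightarrow> x \<in> cross_sphere d"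
  by (simp add: antipode_def cross_sphere_def)

lemma prism_elements:
  "\<tau> \<in> set (prism g h s) \<Longrightarrow> length \<tau> = Suc (length s) \<and> set \<tau> \<subseteq> g ` set s \<union> h ` set s"
  by (induction s arbitrary: \<tau>) fastforce+

lemma cross_sphere_le_1: "x \<in> cross_sphere d \<Longrightarrow> \<bar>x i\<bar> \<le> 1"
proof (cases "i \<le> d")
  case True
  assume "x \<in> cross_sphere d"
  then have "(\<Sum>i\<le>d. \<bar>x i\<bar>) = 1" by (simp add: cross_sphere_def)
  moreover have "\<bar>x i\<bar> \<le> (\<Sum>i\<le>d. \<bar>x i\<bar>)"
    using True by (intro member_le_sum) auto
  ultimately show ?thesis by simp
qed (auto simp: cross_sphere_def)

lemma towards_axis_in:
  assumes x: "x \<in> cross_sphere d" and j: "j \<le> N"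
  shows "towards_axis N (Suc d) j x \<in> cross_sphere (Suc d)"
proof -
  define t where "t = real j / real N"
  have t: "0 \<le> t" "t \<le> 1" using j by (auto simp: t_def divide_le_eq)
  have "(\<Sum>i\<le>d. \<bar>towards_axis N (Suc d) j x i\<bar>) = (\<Sum>i\<le>d. (1 - t) * \<bar>x i\<bar>)"
    using t by (intro sum.cong) (auto simp: towards_axis_def t_def[symmetric] abs_mult)
  also have "\<dots> = 1 - t"
    using x by (simp add: sum_distrib_left[symmetric] cross_sphere_def)
  finally have "(\<Sum>i\<le>Suc d. \<bar>towards_axis N (Suc d) j x i\<bar>) = 1"
    using x t by (simp add: towards_axis_def t_def[symmetric] cross_sphere_def)
  then show ?thesis
    using x by (auto simp: cross_sphere_def towards_axis_def)
qed

text \<open>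
  Moving towards the apex does not increase distances within a level, and consecutive levels are at
  distance at most \<open>2 / N\<close>. Each dimension therefore adds \<open>2 / N\<close> to the mesh.
\<close>

lemma hemisphere_props:
  assumes "s \<in> set (hemisphere N d)"
  shows "length s = Suc d \<and> set s \<subseteq> cross_sphere d \<and>
    (\<forall>x\<in>set s. \<forall>y\<in>set s. \<forall>i. \<bar>x i - y i\<bar> \<le> 2 * real d / real N)"
  using assms
proof (induction d arbitrary: s)
  case 0
  then show ?case by (auto simp: cross_sphere_def)
next
  case (Suc d)
  obtain j \<sigma> where j: "j < N" and \<sigma>: "\<sigma> \<in> set (sphere_chain N d)"
    and s: "s \<in> set (prism (towards_axis N (Suc d) j) (towards_axis N (Suc d) (Suc j)) \<sigma>)"
  proof -
    define z where "z = sphere_chain N d"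
    show thesis
      using Suc.prems that unfolding hemisphere.simps z_def[symmetric] by auto
  qed
  let ?g = "\<lambda>j. towards_axis N (Suc d) j"
  have \<sigma>_props: "length \<sigma> = Suc d" "set \<sigma> \<subseteq> cross_sphere d"
      "\<And>x y i. x \<in> set \<sigma> \<Longrightarrow> y \<in> set \<sigma> \<Longrightarrow> \<bar>x i - y i\<bar> \<le> 2 * real d / real N"
  proof -
    have "\<exists>\<sigma>'\<in>set (hemisphere N d). \<sigma> = \<sigma>' \<or> \<sigma> = map antipode \<sigma>'"
      using \<sigma> by auto
    then obtain \<sigma>' where \<sigma>': "\<sigma>' \<in> set (hemisphere N d)" "\<sigma> = \<sigma>' \<or> \<sigma> = map antipode \<sigma>'"
      by blast
    note IH = Suc.IH[OF \<sigma>'(1)]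
    show "length \<sigma> = Suc d" "set \<sigma> \<subseteq> cross_sphere d" using IH \<sigma>'(2) by (auto, blast+)
    have "\<bar>antipode x i - antipode y i\<bar> = \<bar>x i - y i\<bar>" for x y i
      by (simp add: antipode_def)
    then show "\<bar>x i - y i\<bar> \<le> 2 * real d / real N" if "x \<in> set \<sigma>" "y \<in> set \<sigma>" for x y i
      using IH \<sigma>'(2) that by auto
  qed
  have N: "real N > 0" using j by simp
  have len: "length s = Suc (Suc d)" and sub: "set s \<subseteq> ?g j ` set \<sigma> \<union> ?g (Suc j) ` set \<sigma>"
    using prism_elements[OF s] \<sigma>_props by auto
  have in_sphere: "set s \<subseteq> cross_sphere (Suc d)"
    using sub \<sigma>_props(2) j towards_axis_in[of _ d j N] towards_axis_in[of _ d "Suc j" N] by fastforce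
  have level: "\<bar>?g j' x i - ?g j' y i\<bar> \<le> 2 * real d / real N"
    if "x \<in> set \<sigma>" "y \<in> set \<sigma>" "j' \<le> N" for x y i j'
  proof -
    have "\<bar>?g j' x i - ?g j' y i\<bar> = (1 - real j' / real N) * \<bar>x i - y i\<bar>"
      using that N by (simp add: towards_axis_def abs_mult flip: right_diff_distrib)
    also have "\<dots> \<le> 1 * \<bar>x i - y i\<bar>"
      by (intro mult_right_mono) auto
    also have "\<dots> \<le> 2 * real d / real N" using \<sigma>_props(3)[OF that(1,2)] by simp
    finally show ?thesis .
  qed
  have step: "\<bar>?g j x i - ?g (Suc j) x i\<bar> \<le> 2 / real N" if "x \<in> set \<sigma>" for x i
  proof -
    have "?g j x i - ?g (Suc j) x i = (x i - of_bool (i = Suc d)) / real N"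
      using N by (simp add: towards_axis_def field_simps)
    moreover have "\<bar>x i\<bar> \<le> 1" using cross_sphere_le_1 \<sigma>_props that by blast
    then have "\<bar>x i - of_bool (i = Suc d)\<bar> \<le> 2" by (auto simp: of_bool_def)
    ultimately show ?thesis using N by (simp add: divide_le_cancel abs_divide)
  qed
  have cross: "\<bar>?g j x i - ?g (Suc j) y i\<bar> \<le> 2 * real (Suc d) / real N"
    if "x \<in> set \<sigma>" "y \<in> set \<sigma>" for x y i
    using level[OF that, of j i] step[OF that(2), of i] j by (simp add: add_divide_distrib algebra_simps)
  have weaken: "2 * real d / real N \<le> 2 * real (Suc d) / real N"
    using N by (simp add: divide_le_cancel)
  have "\<bar>x i - y i\<bar> \<le> 2 * real (Suc d) / real N" if xy: "x \<in> set s" "y \<in> set s" for x y i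
  proof -
    obtain x' a where x': "x' \<in> set \<sigma>" "a \<in> {j, Suc j}" "x = ?g a x'" using sub xy by blast
    obtain y' b where y': "y' \<in> set \<sigma>" "b \<in> {j, Suc j}" "y = ?g b y'" using sub xy by blast
    show ?thesis
    proof (cases "a = b")
      case True
      then show ?thesis using level[OF x'(1) y'(1), of a i] x' y' j weaken by auto
    next
      case False
      then show ?thesis
        using cross[OF x'(1) y'(1), of i] cross[OF y'(1) x'(1), of i] x' y'
        by (auto simp: abs_minus_commute)
    qed
  qed
  then show ?case using len in_sphere by blast
qed

lemma bit_telescope: "(\<Sum>j\<leftarrow>[0..<N]. a j + a (Suc j)) = (a 0 + a N :: bit)"
  by (induction N) (auto simp: bit_cancel ac_simps)

lemma sum_list_concat: "sum_list (map f (concat xss)) = (\<Sum>xs\<leftarrow>xss. sum_list (map f xs))"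
  by (induction xss) auto

lemma sphere_chain_sum:
  "(\<Sum>s\<leftarrow>sphere_chain N d. \<phi> s) = (\<Sum>s\<leftarrow>hemisphere N d. \<phi> s + \<phi> (map antipode s) :: bit)"
  by (simp add: sum_list_addf comp_def)

lemma coboundary_map: "coboundary \<phi> (map g s) = coboundary (\<lambda>t. \<phi> (map g t)) s"
  by (simp add: coboundary_def faces_map comp_def)

text \<open>
  The prism identities of the layers telescope to the two ends of the cone. Level \<open>0\<close> is the sphere
  itself; at level \<open>N\<close> every simplex collapses to the same degenerate one, and their number is even since
  simplices come in antipodal pairs.
\<close>

lemma hemisphere_boundary:
  assumes N: "N > 0"
  shows "(\<Sum>s\<leftarrow>hemisphere N d. coboundary \<phi> s) =
    (case d of 0 \<Rightarrow> \<phi> [] | Suc e \<Rightarrow> \<Sum>s\<leftarrow>sphere_chain N e. \<phi> s)"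
proof (induction d arbitrary: \<phi>)
  case 0
  then show ?case by (simp add: coboundary_def)
next
  case (Suc d)
  let ?g = "\<lambda>j. towards_axis N (Suc d) j"
  let ?z = "sphere_chain N d"
  have cycle: "(\<Sum>s\<leftarrow>?z. coboundary \<theta> s) = 0" for \<theta>
  proof -
    have "(\<Sum>s\<leftarrow>?z. coboundary \<theta> s)
        = (\<Sum>s\<leftarrow>hemisphere N d. coboundary (\<lambda>s. \<theta> s + \<theta> (map antipode s)) s)"
      by (simp only: sphere_chain_sum coboundary_map) (simp add: coboundary_def sum_list_addf)
    also have "\<dots> = 0"
      unfolding Suc.IH
      by (cases d) (simp_all add: bit_cancel sum_list_addf comp_def ac_simps)
    finally show ?thesis .
  qed
  have g0: "map (?g 0) s = s" for s
    by (simp add: towards_axis_def map_idI)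
  have gN: "map (?g N) s = replicate (Suc d) (\<lambda>i. of_bool (i = Suc d))" if "s \<in> set ?z" for s
  proof -
    have "length s = Suc d" using that hemisphere_props by fastforce
    moreover have "?g N = (\<lambda>x i. of_bool (i = Suc d))"
      using N by (simp add: towards_axis_def fun_eq_iff)
    ultimately show ?thesis by (simp add: map_replicate_const)
  qed
  have "(\<Sum>s\<leftarrow>?z. \<phi> (map (?g N) s)) = (\<Sum>s\<leftarrow>?z. \<phi> (replicate (Suc d) (\<lambda>i. of_bool (i = Suc d))))"
    by (intro arg_cong[where f=sum_list] map_cong refl) (simp only: gN)
  also have "\<dots> = 0" by (simp only: sphere_chain_sum bit_cancel) simp
  finally have end0: "(\<Sum>s\<leftarrow>?z. \<phi> (map (?g N) s)) = 0" .
  have "(\<Sum>s\<leftarrow>hemisphere N (Suc d). coboundary \<phi> s)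
     = (\<Sum>j\<leftarrow>[0..<N]. \<Sum>s\<leftarrow>?z. \<Sum>\<tau>\<leftarrow>prism (?g j) (?g (Suc j)) s. coboundary \<phi> \<tau>)"
    by (simp only: hemisphere.simps sum_list_concat map_map comp_def)
  also have "\<dots> = (\<Sum>j\<leftarrow>[0..<N]. (\<Sum>s\<leftarrow>?z. \<phi> (map (?g j) s)) + (\<Sum>s\<leftarrow>?z. \<phi> (map (?g (Suc j)) s)))"
    by (simp only: prism_homotopy sum_list_addf cycle add_0_right)
  also have "\<dots> = (\<Sum>s\<leftarrow>?z. \<phi> (map (?g 0) s)) + (\<Sum>s\<leftarrow>?z. \<phi> (map (?g N) s))"
    by (rule bit_telescope)
  also have "\<dots> = (\<Sum>s\<leftarrow>?z. \<phi> s)"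
    by (simp only: g0 end0 add_0_right)
  finally show ?case by simp
qed

text \<open>
  Ky Fan's argument: modulo 2, the number of alternating simplices of the hemisphere, whatever
  their first sign, does not depend on the dimension. Indeed it equals the number of facets in the
  boundary, which is a sphere one dimension lower, that alternate starting with a fixed sign, and the
  antipodal map exchanges the two first signs. In dimension \<open>0\<close> the number is \<open>1\<close>.
\<close>

lemma alternating_simplex_exists:
  fixes lab :: "(nat \<Rightarrow> real) \<Rightarrow> bool \<times> nat"
  assumes N: "N > 0"
    and lab: "\<And>d x. d \<le> n \<Longrightarrow> x \<in> cross_sphere d \<Longrightarrow> lab (antipode x) = apfst Not (lab x)"
  shows "\<exists>s b. s \<in> set (hemisphere N n) \<and> alt_count b (map lab s) = 1"
proof -
  let ?P = "\<lambda>b s. alt_count b (map lab s)"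
  have "(\<Sum>s\<leftarrow>hemisphere N d. ?P True s + ?P False s) = 1" if "d \<le> n" for d
    using that
  proof (induction d)
    case 0
    then show ?case by (simp add: alt_count_def)
  next
    case (Suc d)
    have "(\<Sum>s\<leftarrow>hemisphere N (Suc d). ?P True s + ?P False s)
        = (\<Sum>s\<leftarrow>hemisphere N (Suc d). coboundary (?P True) s)"
      by (simp add: coboundary_map[symmetric] coboundary_alt_count)
    also have "\<dots> = (\<Sum>s\<leftarrow>hemisphere N d. ?P True s + ?P True (map antipode s))"
      unfolding hemisphere_boundary[OF N] by (simp add: sphere_chain_sum sum_list_addf comp_def)
    also have "\<dots> = (\<Sum>s\<leftarrow>hemisphere N d. ?P True s + ?P False s)"
    proof (intro arg_cong[where f=sum_list] map_cong refl arg_cong2[where f="(+)"])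
      fix s assume "s \<in> set (hemisphere N d)"
      then have "set s \<subseteq> cross_sphere d" using hemisphere_props by blast
      then have flip: "map lab (map antipode s) = map (apfst Not) (map lab s)"
        using lab[of d] Suc.prems by auto
      show "?P True (map antipode s) = ?P False s"
        unfolding flip by (simp only: alt_count_flip not_True_eq_False)
    qed
    finally show ?case using Suc by simp
  qed
  then have sum1: "(\<Sum>s\<leftarrow>hemisphere N n. ?P True s + ?P False s) = 1" by simp
  show ?thesis
  proof (rule ccontr)
    assume "\<not> ?thesis"
    then have "?P b s = 0" if "s \<in> set (hemisphere N n)" for b s
      using that by (meson bit_not_one_iff)
    then have "(\<Sum>s\<leftarrow>hemisphere N n. ?P True s + ?P False s) = (\<Sum>s\<leftarrow>hemisphere N n. 0)"
      by (intro arg_cong[where f=sum_list] map_cong refl) simp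
    then show False using sum1 by simp
  qed
qed

lemma cross_sphere_Suc_mono: "cross_sphere d \<subseteq> cross_sphere (Suc d)"
  by (auto simp: cross_sphere_def)

lemma cross_sphere_mono: "d \<le> e \<Longrightarrow> cross_sphere d \<subseteq> cross_sphere e"
  using lift_Suc_mono_le[of cross_sphere, OF cross_sphere_Suc_mono] .

lemma compact_PiE_Icc: "compact (PiE UNIV (\<lambda>i::nat. {l i..h i::real}))"
proof -
  have "compactin (product_topology (\<lambda>_. euclideanreal) UNIV) (PiE UNIV (\<lambda>i. {l i..h i}))"
    by (subst compactin_PiE) auto
  then show ?thesis by (simp add: euclidean_product_topology)
qed

lemma compact_cross_sphere: "compact (cross_sphere n)"
proof -
  have "closed (cross_sphere n)"
  proof -
    have "cross_sphere n = (\<Inter>i\<in>{n<..}. {x. x i = 0}) \<inter> {x. (\<Sum>i\<le>n. \<bar>x i\<bar>) = 1}"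
      by (auto simp: cross_sphere_def)
    moreover have "closed {x::nat \<Rightarrow> real. x i = 0}" for i
      by (intro closed_Collect_eq continuous_intros continuous_on_product_coordinates)
    moreover have "closed {x::nat \<Rightarrow> real. (\<Sum>i\<le>n. \<bar>x i\<bar>) = 1}"
      by (intro closed_Collect_eq continuous_intros continuous_on_product_coordinates)
    ultimately show ?thesis by (metis closed_INT closed_Int)
  qed
  moreover have "cross_sphere n \<subseteq> PiE UNIV (\<lambda>_. {-1..1})"
  proof
    fix x assume "x \<in> cross_sphere n"
    then have "\<bar>x i\<bar> \<le> 1" for i by (rule cross_sphere_le_1)
    then show "x \<in> PiE UNIV (\<lambda>_. {-1..1})" by (auto simp: abs_le_iff minus_le_iff)
  qed
  ultimately show ?thesis
    using compact_Int_closed[OF compact_PiE_Icc, of "cross_sphere n" "\<lambda>_. -1" "\<lambda>_. 1"] by (simp only: Int_absorb1)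
qed

text \<open>
  The factor \<open>2\<close> is the sum of the weights \<open>(1/2) ^ n\<close> in the metric of the product topology.
\<close>

lemma dist_fun_le:
  fixes x y :: "nat \<Rightarrow> real"
  assumes "\<And>i. \<bar>x i - y i\<bar> \<le> e"
  shows "dist x y \<le> 2 * e"
proof -
  have e: "0 \<le> e" using assms[of 0] by linarith
  have "dist x y = (\<Sum>n. (1/2)^n * min (dist (x (from_nat n)) (y (from_nat n))) 1)"
    by (rule dist_fun_def)
  also have "\<dots> \<le> (\<Sum>n. (1/2)^n * e)"
  proof (intro suminf_le)
    show "(1/2)^n * min (dist (x (from_nat n)) (y (from_nat n))) 1 \<le> (1/2)^n * e" for n
      using assms by (intro mult_left_mono) (auto simp: dist_real_def min_le_iff_disj)
    show "summable (\<lambda>n. (1/2)^n * e)" by (intro summable_mult2 summable_geometric) auto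
    show "summable (\<lambda>n. (1/2)^n * min (dist (x (from_nat n)) (y (from_nat n))) 1)"
      by (rule summable_comparison_test'[where N=0 and g="\<lambda>n. (1/2)^n"])
        (auto intro: summable_geometric simp: mult_le_cancel_left1)
  qed
  also have "\<dots> = 2 * e"
    by (subst suminf_mult2[symmetric]) (auto simp: suminf_geometric intro: summable_geometric)
  finally show ?thesis .
qed

text \<open>
  Without a common zero, every point has a coordinate of absolute value at least some fixed
  \<open>m > 0\<close>; the index of such a coordinate and its sign are an antipodal labelling. On a simplex that is small
  in terms of uniform continuity, labels with equal index have equal sign. An alternating \<open>n\<close>-simplex then
  needs \<open>n + 1\<close> different indices, whereas only \<open>l \<le> n\<close> are available.
\<close>

theorem Borsuk_Ulam:
  fixes f :: "(nat \<Rightarrow> real) \<Rightarrow> nat \<Rightarrow> real"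
  assumes cont: "\<And>i. i < l \<Longrightarrow> continuous_on (cross_sphere n) (\<lambda>x. f x i)"
    and odd: "\<And>x i. x \<in> cross_sphere n \<Longrightarrow> i < l \<Longrightarrow> f (antipode x) i = - f x i"
    and l: "l \<le> n"
  shows "\<exists>x\<in>cross_sphere n. \<forall>i<l. f x i = 0"
proof (rule ccontr)
  assume neg: "\<not> ?thesis"
  let ?S = "cross_sphere n"
  define F where "F x = (\<Sum>i<l. \<bar>f x i\<bar>)" for x
  have ne: "?S \<noteq> {}"
  proof -
    have "(\<lambda>i. of_bool (i = 0)) \<in> cross_sphere 0" by (simp add: cross_sphere_def)
    then show ?thesis using cross_sphere_mono[of 0 n] by auto
  qed
  have "continuous_on ?S F"
    unfolding F_def by (intro continuous_intros cont) auto
  then obtain x0 where x0: "x0 \<in> ?S" "\<And>x. x \<in> ?S \<Longrightarrow> F x0 \<le> F x"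
    using continuous_attains_inf[OF compact_cross_sphere ne] by blast
  have "F x0 \<noteq> 0"
    using neg x0(1) unfolding F_def by (subst sum_nonneg_eq_0_iff) auto
  moreover have "F x0 \<ge> 0" by (auto simp: F_def intro: sum_nonneg)
  ultimately have Fpos: "F x0 > 0" by simp
  then have lpos: "l > 0" by (cases l) (auto simp: F_def)
  define m where "m = F x0 / real l"
  have m: "m > 0" using Fpos lpos by (simp add: m_def)
  have big: "\<exists>i<l. m \<le> \<bar>f x i\<bar>" if "x \<in> ?S" for x
  proof (rule ccontr)
    assume "\<not> ?thesis"
    then have "\<bar>f x i\<bar> < m" if "i < l" for i using that by auto
    then have "F x < (\<Sum>i<l. m)" unfolding F_def using lpos by (intro sum_strict_mono) auto
    also have "\<dots> = F x0" using lpos by (simp add: m_def)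
    finally show False using x0(2)[OF that] by simp
  qed
  have "\<forall>i\<in>{..<l}. \<exists>d>0. \<forall>x\<in>?S. \<forall>y\<in>?S. dist y x < d \<longrightarrow> dist (f y i) (f x i) < 2 * m"
  proof
    fix i assume "i \<in> {..<l}"
    then have "uniformly_continuous_on ?S (\<lambda>x. f x i)"
      using cont compact_uniformly_continuous compact_cross_sphere by auto
    then show "\<exists>d>0. \<forall>x\<in>?S. \<forall>y\<in>?S. dist y x < d \<longrightarrow> dist (f y i) (f x i) < 2 * m"
      using m unfolding uniformly_continuous_on_def by simp
  qed
  then obtain d where d: "\<And>i. i < l \<Longrightarrow> d i > 0"
      "\<And>i x y. i < l \<Longrightarrow> x \<in> ?S \<Longrightarrow> y \<in> ?S \<Longrightarrow> dist y x < d i \<Longrightarrow> dist (f y i) (f x i) < 2 * m"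
    by (metis lessThan_iff)
  define \<delta> where "\<delta> = Min (d ` {..<l})"
  have \<delta>: "\<delta> > 0" "\<And>i. i < l \<Longrightarrow> \<delta> \<le> d i"
    using d(1) lpos by (auto simp: \<delta>_def Min_gr_iff lessThan_empty_iff)
  \<comment> \<open>The mesh \<open>2 n / N\<close> doubles when coordinatewise distances are replaced by the metric.\<close>
  obtain N :: nat where N: "real N > 4 * real n / \<delta>" "N > 0"
    using reals_Archimedean2[of "max 0 (4 * real n / \<delta>)"] by auto
  define lab where "lab x = (let i = (LEAST i. i < l \<and> m \<le> \<bar>f x i\<bar>) in (0 < f x i, i))" for x
  have lab_props: "snd (lab x) < l" "m \<le> \<bar>f x (snd (lab x))\<bar>" "fst (lab x) \<longleftrightarrow> 0 < f x (snd (lab x))"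
    if "x \<in> ?S" for x
    using LeastI_ex[OF big[OF that]] by (auto simp: lab_def Let_def)
  have "lab (antipode x) = apfst Not (lab x)" if "e \<le> n" "x \<in> cross_sphere e" for e x
  proof -
    have x: "x \<in> ?S" using that cross_sphere_mono by blast
    have "(i < l \<and> m \<le> \<bar>f (antipode x) i\<bar>) \<longleftrightarrow> (i < l \<and> m \<le> \<bar>f x i\<bar>)" for i
      using odd[OF x, of i] by auto
    then have s: "snd (lab (antipode x)) = snd (lab x)"
      by (simp add: lab_def Let_def)
    have "fst (lab (antipode x)) = (\<not> fst (lab x))"
      using lab_props[OF x] lab_props[of "antipode x"] x odd[OF x] m s by auto
    then show ?thesis using s by (simp add: prod_eq_iff)
  qed
  then obtain s b where s: "s \<in> set (hemisphere N n)" "alt_count b (map lab s) = 1"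
    using alternating_simplex_exists[OF N(2), of n lab] by blast
  note hp = hemisphere_props[OF s(1)]
  have "length (map lab s) \<le> l"
  proof (rule alt_count_length[OF s(2)])
    show "snd p < l" if "p \<in> set (map lab s)" for p
      using that hp lab_props by auto
    fix p q assume pq: "p \<in> set (map lab s)" "q \<in> set (map lab s)" "snd p = snd q"
    then obtain x y where xy: "x \<in> set s" "y \<in> set s" "p = lab x" "q = lab y" by auto
    have S: "x \<in> ?S" "y \<in> ?S" using xy hp by auto
    have "dist y x \<le> 2 * (2 * real n / real N)"
      using hp xy by (intro dist_fun_le) auto
    also have "\<dots> < \<delta>" using N \<delta>(1) by (simp add: field_simps)
    finally have "dist (f y (snd p)) (f x (snd p)) < 2 * m"
      using d(2)[OF _ S] \<delta>(2) lab_props(1)[OF S(1)] xy by (meson less_le_trans)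
    then show "fst p = fst q"
      using lab_props[OF S(1)] lab_props[OF S(2)] pq xy m by (auto simp: dist_real_def)
  qed
  then show False using hp l by simp
qed

section \<open>Continuously differentiable functions and weak gradients\<close>

lemma C1_with_gradientI:
  assumes "\<And>x. GDERIV u x :> \<psi> x" "continuous_on UNIV \<psi>" shows "C1_with_gradient u \<psi>"
  using assms by (simp add: C1_with_gradient_def)

lemma C1_imp_continuous:
  assumes "C1_with_gradient u \<psi>" shows "continuous_on UNIV u"
  using assms has_derivative_continuous unfolding C1_with_gradient_def gderiv_def
  by (metis continuous_at_imp_continuous_on)

lemma C1_grad_continuous: "C1_with_gradient u \<psi> \<Longrightarrow> continuous_on UNIV \<psi>"
  by (simp add: C1_with_gradient_def)

lemma C1_derivative_along_line:
  assumes u: "C1_with_gradient u \<psi>"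
  shows "((\<lambda>\<tau>. u (x + \<tau> *\<^sub>R b)) has_real_derivative \<psi> (x + t *\<^sub>R b) \<bullet> b) (at t within S)"
proof -
  have ux: "(u has_derivative (\<lambda>h. h \<bullet> \<psi> (x + t *\<^sub>R b))) (at (x + t *\<^sub>R b))"
    using u by (simp add: C1_with_gradient_def gderiv_def)
  have "((\<lambda>\<tau>. u (x + \<tau> *\<^sub>R b)) has_derivative (\<lambda>h. (h *\<^sub>R b) \<bullet> \<psi> (x + t *\<^sub>R b))) (at t within S)"
    by (rule has_derivative_compose[where f="\<lambda>\<tau>. x + \<tau> *\<^sub>R b" and g=u, OF _ ux]) (auto intro!: derivative_eq_intros)
  then show ?thesis
    by (simp add: has_field_derivative_def inner_commute mult.commute mult_commute_abs)
qed

lemma C1_const: "C1_with_gradient (\<lambda>_. c) (\<lambda>_. 0)"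
  by (simp add: C1_with_gradient_def GDERIV_const)

lemma C1_add:
  assumes "C1_with_gradient u \<psi>" "C1_with_gradient v \<theta>"
  shows "C1_with_gradient (\<lambda>x. u x + v x) (\<lambda>x. \<psi> x + \<theta> x)"
  using assms by (auto simp: C1_with_gradient_def intro!: GDERIV_add continuous_intros)

lemma C1_mult:
  assumes "C1_with_gradient u \<psi>" "C1_with_gradient v \<theta>"
  shows "C1_with_gradient (\<lambda>x. u x * v x) (\<lambda>x. u x *\<^sub>R \<theta> x + v x *\<^sub>R \<psi> x)"
  using assms C1_imp_continuous[OF assms(1)] C1_imp_continuous[OF assms(2)]
  by (auto simp: C1_with_gradient_def intro!: GDERIV_mult continuous_intros)

lemma C1_cmult:
  assumes "C1_with_gradient u \<psi>"
  shows "C1_with_gradient (\<lambda>x. c * u x) (\<lambda>x. c *\<^sub>R \<psi> x)"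
  using C1_mult[OF C1_const[of c] assms] by simp

lemma C1_diff:
  assumes "C1_with_gradient u \<psi>" "C1_with_gradient v \<theta>"
  shows "C1_with_gradient (\<lambda>x. u x - v x) (\<lambda>x. \<psi> x - \<theta> x)"
  using assms by (auto simp: C1_with_gradient_def intro!: GDERIV_diff continuous_intros)

lemma C1_sum:
  assumes "\<And>i. i \<in> I \<Longrightarrow> C1_with_gradient (u i) (\<psi> i)"
  shows "C1_with_gradient (\<lambda>x. \<Sum>i\<in>I. u i x) (\<lambda>x. \<Sum>i\<in>I. \<psi> i x)"
  using assms
proof (induction I rule: infinite_finite_induct)
  case (insert i I)
  then show ?case using C1_add[of "u i" "\<psi> i"] by simp
qed (simp_all add: C1_const)

lemma C1_compose:
  assumes u: "C1_with_gradient u \<psi>" and g: "\<And>t. (g has_real_derivative g' t) (at t)"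
    and g': "continuous_on UNIV g'"
  shows "C1_with_gradient (\<lambda>x. g (u x)) (\<lambda>x. g' (u x) *\<^sub>R \<psi> x)"
proof (rule C1_with_gradientI)
  show "GDERIV (\<lambda>x. g (u x)) x :> g' (u x) *\<^sub>R \<psi> x" for x
    using u g by (intro GDERIV_DERIV_compose) (auto simp: C1_with_gradient_def)
  have "continuous_on UNIV (\<lambda>x. g' (u x))"
    using continuous_on_compose2[OF g' C1_imp_continuous[OF u]] by simp
  then show "continuous_on UNIV (\<lambda>x. g' (u x) *\<^sub>R \<psi> x)"
    using C1_grad_continuous[OF u] by (intro continuous_intros)
qed

text \<open>
  Squaring the positive part is what makes the bumps below continuously differentiable.
\<close>

lemma has_derivative_pos_square: "((\<lambda>s. (max 0 s)^2) has_real_derivative 2 * max 0 t) (at (t::real))"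
proof -
  consider "t > 0" | "t < 0" | "t = 0" by linarith
  then show ?thesis
  proof cases
    case 1
    have "((\<lambda>s. s^2) has_real_derivative 2 * max 0 t) (at t)"
      using 1 by (auto intro!: derivative_eq_intros)
    then show ?thesis
      by (rule has_field_derivative_transform_within_open[of _ _ _ "{0<..}"]) (use 1 in auto)
  next
    case 2
    have "((\<lambda>s. 0) has_real_derivative 2 * max 0 t) (at t)"
      using 2 by (auto intro!: derivative_eq_intros)
    then show ?thesis
      by (rule has_field_derivative_transform_within_open[of _ _ _ "{..<0}"]) (use 2 in auto)
  next
    case 3
    have "((\<lambda>h. (max 0 h)^2 / h) \<longlongrightarrow> 0) (at (0::real))"
    proof (rule Lim_null_comparison)
      show "\<forall>\<^sub>F h in at 0. norm ((max 0 h)^2 / h) \<le> \<bar>h\<bar>"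
        by (auto simp: eventually_at_filter max_def power2_eq_square)
      show "((\<lambda>h. \<bar>h\<bar>) \<longlongrightarrow> 0) (at (0::real))" by (auto intro!: tendsto_eq_intros)
    qed
    then show ?thesis using 3 by (simp add: DERIV_def)
  qed
qed

text \<open>
  Not normalised, as Rayleigh quotients are invariant under scaling of the function.
\<close>

definition bump :: "'a::euclidean_space \<Rightarrow> real \<Rightarrow> 'a \<Rightarrow> real" where
  "bump a r x = (max 0 (r^2 - (dist x a)^2))^2"

definition bump_gradient :: "'a::euclidean_space \<Rightarrow> real \<Rightarrow> 'a \<Rightarrow> 'a" where
  "bump_gradient a r x = (2 * max 0 (r^2 - (dist x a)^2)) *\<^sub>R (- 2 *\<^sub>R (x - a))"

lemma C1_bump: "C1_with_gradient (bump a r) (bump_gradient a r)"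
proof -
  have "C1_with_gradient (\<lambda>x. r^2 - (dist x a)^2) (\<lambda>x. - 2 *\<^sub>R (x - a))"
  proof (rule C1_with_gradientI)
    show "GDERIV (\<lambda>x. r^2 - (dist x a)^2) x :> - 2 *\<^sub>R (x - a)" for x
      unfolding gderiv_def dist_norm power2_norm_eq_inner
      by (auto intro!: derivative_eq_intros simp: fun_eq_iff inner_commute algebra_simps)
  qed (intro continuous_intros)
  then show ?thesis
    unfolding bump_def[abs_def] bump_gradient_def[abs_def]
    by (rule C1_compose) (auto intro!: has_derivative_pos_square continuous_intros)
qed

lemma bump_nonneg: "bump a r x \<ge> 0" by (simp add: bump_def)

lemma bump_pos_iff: "r > 0 \<Longrightarrow> bump a r x > 0 \<longleftrightarrow> x \<in> ball a r"
proof -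
  assume "r > 0"
  then have "(dist x a)^2 < r^2 \<longleftrightarrow> dist x a < r"
    by (metis less_imp_le power2_less_imp_less power_strict_mono zero_le_dist zero_less_numeral)
  then show ?thesis by (auto simp: bump_def max_def dist_commute not_le)
qed

lemma bump_zero: "r > 0 \<Longrightarrow> x \<notin> ball a r \<Longrightarrow> bump a r x = 0"
  using bump_pos_iff[of r a x] bump_nonneg[of a r x] by linarith

lemma bump_gradient_zero: "r > 0 \<Longrightarrow> x \<notin> ball a r \<Longrightarrow> bump_gradient a r x = 0"
proof -
  assume "r > 0" "x \<notin> ball a r"
  then have "r^2 \<le> (dist x a)^2" by (intro power_mono) (auto simp: dist_commute)
  then show ?thesis by (simp add: bump_gradient_def)
qed

lemma gradient_zero_outside:
  assumes u: "C1_with_gradient u \<psi>" and K: "closed K" and z: "\<And>x. x \<notin> K \<Longrightarrow> u x = 0" and x: "x \<notin> K"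
  shows "\<psi> x = 0"
proof -
  have "(u has_derivative (\<lambda>h. h \<bullet> \<psi> x)) (at x)"
    using u by (simp add: C1_with_gradient_def gderiv_def)
  moreover have "(u has_derivative (\<lambda>h. 0)) (at x)"
  proof (rule has_derivative_transform_within_open[of "\<lambda>_. 0" _ _ UNIV "- K"])
    show "open (- K)" using K by auto
  qed (use x z in auto)
  ultimately have "(\<lambda>h. h \<bullet> \<psi> x) = (\<lambda>h. 0)" by (rule has_derivative_unique)
  then have "\<psi> x \<bullet> \<psi> x = 0" by metis
  then show ?thesis by simp
qed

lemma compactly_supported_integrable:
  fixes f :: "'a::euclidean_space \<Rightarrow> 'b::euclidean_space"
  assumes "compact K" "continuous_on UNIV f" "\<And>x. x \<notin> K \<Longrightarrow> f x = 0"
  shows "integrable lborel f"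
proof -
  have "(\<lambda>x. indicator K x *\<^sub>R f x) = f" using assms(3) by (auto simp: fun_eq_iff indicator_def)
  then show ?thesis
    using borel_integrable_compact[OF assms(1), of f] continuous_on_subset[OF assms(2)] by simp
qed

text \<open>
  By translation invariance the difference quotients of \<open>u\<close> have integral zero. They converge to the
  directional derivative, dominated by a Lipschitz constant on a compact set.
\<close>

lemma integral_gradient_eq_0:
  assumes u: "C1_with_gradient u \<psi>" and K: "compact K" and z: "\<And>x. x \<notin> K \<Longrightarrow> u x = 0"
  shows "(\<integral>x. \<psi> x \<partial>lborel) = 0"
proof -
  have \<psi>z: "\<psi> x = 0" if "x \<notin> K" for x
    using gradient_zero_outside[OF u compact_imp_closed[OF K] z that] .
  have \<psi>c: "continuous_on UNIV \<psi>" and uc: "continuous_on UNIV u"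
    using u C1_grad_continuous C1_imp_continuous by blast+
  have \<psi>i: "integrable lborel \<psi>" and ui: "integrable lborel u"
    using compactly_supported_integrable K \<psi>c uc \<psi>z z by blast+
  have "bounded (\<psi> ` K)" using compact_continuous_image[OF continuous_on_subset[OF \<psi>c] K] compact_imp_bounded by auto
  then obtain M0 where M0: "\<And>x. x \<in> K \<Longrightarrow> norm (\<psi> x) \<le> M0"
    unfolding bounded_iff by auto
  define M where "M = max 0 M0"
  have M: "norm (\<psi> x) \<le> M" for x
    using M0[of x] \<psi>z[of x] by (cases "x \<in> K") (auto simp: M_def)
  have lip: "\<bar>u x - u y\<bar> \<le> M * norm (x - y)" for x y
  proof -
    have "norm (u x - u y) \<le> M * norm (x - y)"
    proof (rule differentiable_bound[where S=UNIV and f'="\<lambda>x h. h \<bullet> \<psi> x"])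
      show "(u has_derivative (\<lambda>h. h \<bullet> \<psi> x)) (at x within UNIV)" for x
        using u by (simp add: C1_with_gradient_def gderiv_def)
      show "onorm (\<lambda>h. h \<bullet> \<psi> x) \<le> M" for x
      proof (rule onorm_le)
        show "norm (h \<bullet> \<psi> x) \<le> M * norm h" for h
          using Cauchy_Schwarz_ineq2[of h "\<psi> x"] mult_left_mono[OF M[of x] norm_ge_zero[of h]]
          by (simp add: mult.commute)
      qed
    qed auto
    then show ?thesis by simp
  qed
  define K' where "K' = {x + y |x y. x \<in> K \<and> y \<in> cball 0 1}"
  have K': "compact K'" unfolding K'_def by (intro compact_sums K compact_cball)
  have "(\<integral>x. \<psi> x \<bullet> b \<partial>lborel) = 0" if b: "b \<in> Basis" for b
  proof -
    define t where "t n = inverse (real (Suc n))" for n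
    have t: "0 < t n" "t n \<le> 1" for n by (auto simp: t_def inverse_le_1_iff)
    define s where "s n x = (u (t n *\<^sub>R b + x) - u x) / t n" for n x
    have s0: "(\<integral>x. s n x \<partial>lborel) = 0" for n
    proof -
      have d: "distr lborel borel ((+) (t n *\<^sub>R b)) = lborel" by (rule lborel_distr_plus)
      have m: "u \<in> borel_measurable borel" using uc by (rule borel_measurable_continuous_onI)
      have i: "integrable lborel (\<lambda>x. u (t n *\<^sub>R b + x))"
        using ui m by (subst (asm) d[symmetric], subst (asm) integrable_distr_eq) auto
      have "(\<integral>x. u x \<partial>lborel) = (\<integral>x. u (t n *\<^sub>R b + x) \<partial>lborel)"
        using m by (subst d[symmetric], subst integral_distr) auto
      then show ?thesis unfolding s_def using ui i by simp
    qed
    have "(\<lambda>n. \<integral>x. s n x \<partial>lborel) \<longlonglongrightarrow> (\<integral>x. \<psi> x \<bullet> b \<partial>lborel)"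
    proof (rule integral_dominated_convergence)
      show "integrable lborel (\<lambda>x. indicator K' x *\<^sub>R M)"
        by (intro borel_integrable_compact K') auto
      show "AE x in lborel. norm (s n x) \<le> indicator K' x *\<^sub>R M" for n
      proof (rule AE_I2)
        fix x
        show "norm (s n x) \<le> indicator K' x *\<^sub>R M"
        proof (cases "x \<in> K'")
          case True
          have "\<bar>u (t n *\<^sub>R b + x) - u x\<bar> \<le> M * t n"
            using lip[of "t n *\<^sub>R b + x" x] t(1)[of n] b by simp
          then show ?thesis using True t(1)[of n] by (simp add: s_def divide_le_eq)
        next
          case False
          have "x \<notin> K"
          proof
            assume "x \<in> K"
            then have "x + 0 \<in> K'" unfolding K'_def by (intro CollectI exI[of _ x] exI[of _ 0]) auto
            then show False using False by simp
          qed
          moreover have "t n *\<^sub>R b + x \<notin> K"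
          proof
            assume *: "t n *\<^sub>R b + x \<in> K"
            have "(t n *\<^sub>R b + x) + (- t n *\<^sub>R b) \<in> K'"
              unfolding K'_def using * t[of n] b
              by (intro CollectI exI[of _ "t n *\<^sub>R b + x"] exI[of _ "- t n *\<^sub>R b"]) auto
            then show False using False by simp
          qed
          ultimately show ?thesis using z False by (simp add: s_def)
        qed
      qed
      show "AE x in lborel. (\<lambda>n. s n x) \<longlonglongrightarrow> \<psi> x \<bullet> b"
      proof (rule AE_I2)
        fix x
        have "((\<lambda>\<tau>. u (x + \<tau> *\<^sub>R b)) has_real_derivative \<psi> x \<bullet> b) (at 0)"
          using C1_derivative_along_line[OF u, of x b 0] by simp
        then have l: "((\<lambda>h. (u (x + h *\<^sub>R b) - u x) / h) \<longlongrightarrow> \<psi> x \<bullet> b) (at 0)"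
          by (simp add: DERIV_def)
        have "filterlim t (at 0) sequentially"
          unfolding t_def filterlim_at using LIMSEQ_inverse_real_of_nat by auto
        from filterlim_compose[OF l this] show "(\<lambda>n. s n x) \<longlonglongrightarrow> \<psi> x \<bullet> b"
          by (simp add: s_def add.commute)
      qed
      have m: "u \<in> borel_measurable borel" using uc by (rule borel_measurable_continuous_onI)
      then show "s n \<in> borel_measurable lborel" for n unfolding s_def by measurable
      show "(\<lambda>x. \<psi> x \<bullet> b) \<in> borel_measurable lborel"
        using \<psi>i by (intro borel_measurable_inner) auto
    qed
    then show ?thesis using LIMSEQ_unique s0 by (simp add: LIMSEQ_const_iff)
  qed
  moreover have "(\<integral>x. \<psi> x \<bullet> b \<partial>lborel) = (\<integral>x. \<psi> x \<partial>lborel) \<bullet> b" for b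
    using \<psi>i by (intro integral_inner_left)
  ultimately have "\<forall>b\<in>Basis. (\<integral>x. \<psi> x \<partial>lborel) \<bullet> b = 0" by metis
  then show ?thesis by (simp only: euclidean_all_zero_iff)
qed

lemma integral_lebesgue_on_supported:
  fixes f :: "'a::euclidean_space \<Rightarrow> 'b::euclidean_space"
  assumes \<Omega>: "\<Omega> \<in> sets lebesgue" and f: "f \<in> borel_measurable borel" and z: "\<And>x. x \<notin> \<Omega> \<Longrightarrow> f x = 0"
  shows "(\<integral>x. f x \<partial>lebesgue_on \<Omega>) = (\<integral>x. f x \<partial>lborel)"
    and "integrable lborel f \<Longrightarrow> integrable (lebesgue_on \<Omega>) f"
proof -
  have e: "(\<lambda>x. indicator \<Omega> x *\<^sub>R f x) = f" using z by (auto simp: fun_eq_iff indicator_def)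
  show "(\<integral>x. f x \<partial>lebesgue_on \<Omega>) = (\<integral>x. f x \<partial>lborel)"
    using \<Omega> f by (simp add: integral_restrict_space e integral_completion)
  show "integrable lborel f \<Longrightarrow> integrable (lebesgue_on \<Omega>) f"
    using \<Omega> f by (simp add: integrable_restrict_space e integrable_completion)
qed

lemma continuous_integrable_compact:
  fixes f :: "'a::euclidean_space \<Rightarrow> 'b::euclidean_space"
  assumes "compact K" "continuous_on K f" shows "integrable (lebesgue_on K) f"
proof -
  have "integrable lborel (\<lambda>x. indicator K x *\<^sub>R f x)" using assms by (rule borel_integrable_compact)
  then show ?thesis
    using assms by (simp add: integrable_restrict_space lmeasurable_compact fmeasurableD integrable_completion borel_measurable_integrable)
qed

text \<open>
  The product of \<open>u\<close> with a test function is a compactly supported \<open>C\<^sup>1\<close> function, so the integral of its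
  gradient vanishes.
\<close>

lemma has_weak_gradient_C1:
  assumes u: "C1_with_gradient u \<psi>" and \<Omega>: "open \<Omega>"
  shows "has_weak_gradient \<Omega> u \<psi>"
  unfolding has_weak_gradient_def
proof (intro conjI allI impI)
  have uc: "continuous_on S u" and \<psi>c: "continuous_on S \<psi>" for S
    using C1_imp_continuous[OF u] C1_grad_continuous[OF u] continuous_on_subset by blast+
  show "locally_integrable_on \<Omega> u" "locally_integrable_on \<Omega> \<psi>"
    unfolding locally_integrable_on_def using uc \<psi>c continuous_integrable_compact by blast+
  fix \<phi> \<theta> assume "C1_with_gradient \<phi> \<theta> \<and> compactly_supported_in \<Omega> \<phi>"
  then obtain K where \<phi>: "C1_with_gradient \<phi> \<theta>" and K: "compact K" "K \<subseteq> \<Omega>" "\<And>x. x \<notin> K \<Longrightarrow> \<phi> x = 0"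
    unfolding compactly_supported_in_def by blast
  have \<theta>z: "\<theta> x = 0" if "x \<notin> K" for x
    using gradient_zero_outside[OF \<phi> compact_imp_closed[OF K(1)] K(3) that] .
  have \<phi>c: "continuous_on S \<phi>" and \<theta>c: "continuous_on S \<theta>" for S
    using C1_imp_continuous[OF \<phi>] C1_grad_continuous[OF \<phi>] continuous_on_subset by blast+
  have c1: "continuous_on UNIV (\<lambda>x. u x *\<^sub>R \<theta> x)" and c2: "continuous_on UNIV (\<lambda>x. \<phi> x *\<^sub>R \<psi> x)"
    by (intro continuous_intros uc \<psi>c \<phi>c \<theta>c)+
  have i1: "integrable lborel (\<lambda>x. u x *\<^sub>R \<theta> x)" and i2: "integrable lborel (\<lambda>x. \<phi> x *\<^sub>R \<psi> x)"
    using compactly_supported_integrable[OF K(1) c1] compactly_supported_integrable[OF K(1) c2] K \<theta>z by auto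
  have "(\<integral>x. u x *\<^sub>R \<theta> x + \<phi> x *\<^sub>R \<psi> x \<partial>lborel) = 0"
    by (rule integral_gradient_eq_0[OF C1_mult[OF u \<phi>] K(1)]) (use K in auto)
  then have "(\<integral>x. u x *\<^sub>R \<theta> x \<partial>lborel) = - (\<integral>x. \<phi> x *\<^sub>R \<psi> x \<partial>lborel)"
    using i1 i2 by (simp add: eq_neg_iff_add_eq_0)
  moreover have "\<Omega> \<in> sets lebesgue" using \<Omega> by auto
  ultimately show "(\<integral>x. u x *\<^sub>R \<theta> x \<partial>lebesgue_on \<Omega>) = - (\<integral>x. \<phi> x *\<^sub>R \<psi> x \<partial>lebesgue_on \<Omega>)"
    using K \<theta>z c1 c2
    by (subst (1 2) integral_lebesgue_on_supported(1)) (auto intro!: borel_measurable_continuous_onI)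
qed

lemma open_countable_Union_ball:
  fixes U :: "'a::euclidean_space set"
  assumes U: "open U" "U \<noteq> {}"
  shows "\<exists>a r. (\<forall>j::nat. r j > (0::real) \<and> ball (a j) (r j) \<subseteq> U) \<and> U = (\<Union>j. ball (a j) (r j))"
proof -
  let ?F = "{ball x e | x e. e > 0 \<and> ball x e \<subseteq> U}"
  obtain F' where F': "F' \<subseteq> ?F" "countable F'" "\<Union>F' = \<Union>?F"
    by (rule Lindelof[of ?F]) auto
  have "\<Union>?F = U" using U(1) by (auto simp: open_contains_ball) (metis centre_in_ball)
  then have UF: "\<Union>F' = U" using F' by simp
  then have ne: "F' \<noteq> {}" using U by auto
  have rng: "range (from_nat_into F') = F'" using ne F'(2) by (rule range_from_nat_into)
  have "\<forall>j. \<exists>x e. from_nat_into F' j = ball x e \<and> e > 0 \<and> ball x e \<subseteq> U"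
    using F'(1) rng by blast
  then obtain a r where ar: "\<And>j. from_nat_into F' j = ball (a j) (r j) \<and> r j > 0 \<and> ball (a j) (r j) \<subseteq> U"
    by metis
  have "from_nat_into F' = (\<lambda>j. ball (a j) (r j))" by (rule ext) (simp only: ar)
  then have "U = (\<Union>j. ball (a j) (r j))" using UF rng by simp
  moreover have "r j > 0 \<and> ball (a j) (r j) \<subseteq> U" for j using ar[of j] by simp
  ultimately show ?thesis by (intro exI[of _ a] exI[of _ r] conjI allI) simp_all
qed

text \<open>
  Cover \<open>U\<close> by balls and let \<open>w n\<close> be the sum of the bumps on the first \<open>n\<close> of them. At a point of \<open>U\<close> some
  fixed positive bump is a summand for all large \<open>n\<close>, so \<open>1 - exp (- n * w n)\<close> tends to \<open>1\<close> there.
\<close>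

lemma indicator_open_approximation:
  fixes U :: "'a::euclidean_space set"
  assumes U: "open U"
  shows "\<exists>\<phi> \<psi>. (\<forall>n::nat. C1_with_gradient (\<phi> n) (\<psi> n) \<and> (\<forall>x. 0 \<le> \<phi> n x \<and> \<phi> n x \<le> 1 \<and> (x \<notin> U \<longrightarrow> \<phi> n x = 0)))
     \<and> (\<forall>x. (\<lambda>n. \<phi> n x) \<longlonglongrightarrow> indicator U x)"
proof (cases "U = {}")
  case True
  then show ?thesis by (intro exI[of _ "\<lambda>_ _. 0"]) (auto simp: C1_const)
next
  case False
  obtain a r where ar: "\<And>j::nat. r j > (0::real) \<and> ball (a j) (r j) \<subseteq> U" and Ueq: "U = (\<Union>j. ball (a j) (r j))"
    using open_countable_Union_ball[OF U False] by blast
  define w where "w n x = (\<Sum>j<n. bump (a j) (r j) x)" for n x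
  define \<phi> where "\<phi> n x = 1 - exp (- (real n * w n x))" for n x
  have C1w: "C1_with_gradient (w n) (\<lambda>x. \<Sum>j<n. bump_gradient (a j) (r j) x)" for n
    unfolding w_def[abs_def] by (intro C1_sum C1_bump)
  have C1: "\<exists>\<psi>. C1_with_gradient (\<phi> n) \<psi>" for n
    unfolding \<phi>_def[abs_def]
    by (rule exI, rule C1_compose[OF C1w, where g="\<lambda>t. 1 - exp (- (real n * t))" and g'="\<lambda>t. real n * exp (- (real n * t))"])
      (auto intro!: derivative_eq_intros continuous_intros)
  have w0: "0 \<le> w n x" for n x unfolding w_def by (intro sum_nonneg bump_nonneg)
  have wz: "w n x = 0" if "x \<notin> U" for n x
    unfolding w_def using that Ueq ar by (intro sum.neutral ballI bump_zero) auto
  have lim: "(\<lambda>n. \<phi> n x) \<longlonglongrightarrow> indicator U x" for x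
  proof (cases "x \<in> U")
    case True
    then obtain j where j: "x \<in> ball (a j) (r j)" using Ueq by auto
    define c where "c = bump (a j) (r j) x"
    have c: "c > 0" unfolding c_def using bump_pos_iff[of "r j"] ar j by blast
    have "(\<lambda>n. exp (- (real n * w n x))) \<longlonglongrightarrow> 0"
    proof (rule Lim_null_comparison)
      show "\<forall>\<^sub>F n in sequentially. norm (exp (- (real n * w n x))) \<le> exp (- c) ^ n"
        unfolding eventually_sequentially
      proof (intro exI allI impI)
        fix n assume "Suc j \<le> n"
        then have "c \<le> w n x"
          unfolding w_def c_def by (intro member_le_sum) (auto simp: bump_nonneg)
        then have "real n * c \<le> real n * w n x" by (intro mult_left_mono) auto
        then show "norm (exp (- (real n * w n x))) \<le> exp (- c) ^ n"
          by (simp add: exp_of_nat_mult[symmetric])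
      qed
      show "(\<lambda>n. exp (- c) ^ n) \<longlonglongrightarrow> 0" using c by (intro LIMSEQ_power_zero) auto
    qed
    then have "(\<lambda>n. \<phi> n x) \<longlonglongrightarrow> 1 - 0" unfolding \<phi>_def by (intro tendsto_intros)
    then show ?thesis using True by simp
  next
    case False
    then show ?thesis by (simp add: \<phi>_def wz)
  qed
  obtain \<psi> where "\<And>n. C1_with_gradient (\<phi> n) (\<psi> n)" using C1 by metis
  moreover have "0 \<le> \<phi> n x \<and> \<phi> n x \<le> 1 \<and> (x \<notin> U \<longrightarrow> \<phi> n x = 0)" for n x
    using w0[of n x] wz by (auto simp: \<phi>_def)
  ultimately show ?thesis using lim by blast
qed

text \<open>
  Up to a null set, \<open>{h > 0}\<close> is an intersection of countably many open sets. The integral of \<open>h\<close> over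
  finite intersections of them vanishes, and in the limit so does the integral of \<open>h\<close> over \<open>{h > 0}\<close>.
\<close>

lemma negligible_pos_of_open_integrals_zero:
  fixes h :: "'a::euclidean_space \<Rightarrow> real"
  assumes h: "integrable lebesgue h" and V: "open V"
    and zero: "\<And>U. open U \<Longrightarrow> U \<subseteq> V \<Longrightarrow> (\<integral>x. indicator U x * h x \<partial>lebesgue) = 0"
  shows "negligible {x\<in>V. h x > 0}"
proof -
  define S where "S = {x\<in>V. h x > 0}"
  have hm[measurable]: "h \<in> borel_measurable lebesgue" using h by auto
  have S: "S \<in> sets lebesgue"
  proof -
    have "S = V \<inter> {x\<in>space lebesgue. h x > 0}" by (auto simp: S_def)
    moreover have "{x\<in>space lebesgue. h x > 0} \<in> sets lebesgue" by measurable
    ultimately show ?thesis using V by (simp add: sets.Int del: space_completion)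
  qed
  obtain G N where G: "gdelta G" and N: "N \<in> null_sets lebesgue" and SN: "S \<union> N = G"
    by (rule lebesgue_set_almost_gdelta[OF S])
  from G obtain T where T: "\<And>n::nat. open (T n)" "G = (\<Inter>n. T n)" by (auto elim: gdelta.cases)
  define D where "D n = (\<Inter>m\<le>n. T m) \<inter> V" for n
  define I where "I = (\<Inter>m. T m) \<inter> V"
  have Dopen: "open (D n)" "D n \<subseteq> V" for n unfolding D_def using T V by auto
  have Im: "I \<in> sets lebesgue" unfolding I_def using T V by (intro sets.Int sets.countable_INT) auto
  have "(\<lambda>n. \<integral>x. indicator (D n) x * h x \<partial>lebesgue) \<longlonglongrightarrow> (\<integral>x. indicator I x * h x \<partial>lebesgue)"
  proof (rule integral_dominated_convergence)
    show "integrable lebesgue (\<lambda>x. \<bar>h x\<bar>)" using h by auto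
    show "AE x in lebesgue. norm (indicator (D n) x * h x) \<le> \<bar>h x\<bar>" for n
      by (intro AE_I2) (auto simp: indicator_def)
    show "AE x in lebesgue. (\<lambda>n. indicator (D n) x * h x) \<longlonglongrightarrow> indicator I x * h x"
    proof (intro AE_I2 tendsto_intros)
      fix x
      show "(\<lambda>n. indicator (D n) x :: real) \<longlonglongrightarrow> indicator I x"
      proof (cases "x \<in> I")
        case True
        then show ?thesis by (auto simp: D_def I_def)
      next
        case False
        then obtain m where "x \<notin> T m \<or> x \<notin> V" by (auto simp: I_def)
        then have "\<And>n. n \<ge> m \<Longrightarrow> x \<notin> D n" by (auto simp: D_def)
        then have "\<forall>\<^sub>F n in sequentially. indicator (D n) x = (0::real)"
          unfolding eventually_sequentially by (intro exI[of _ m]) auto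
        then show ?thesis using False by (simp add: tendsto_eventually)
      qed
    qed
    show "(\<lambda>x. indicator (D n) x * h x) \<in> borel_measurable lebesgue" for n
      using Dopen by (intro borel_measurable_times borel_measurable_indicator) auto
    show "(\<lambda>x. indicator I x * h x) \<in> borel_measurable lebesgue"
      using Im by (intro borel_measurable_times borel_measurable_indicator) auto
  qed
  then have I0: "(\<integral>x. indicator I x * h x \<partial>lebesgue) = 0"
    using zero[OF Dopen] by (simp add: LIMSEQ_const_iff)
  have SI: "x \<in> S \<longleftrightarrow> x \<in> I" if "x \<notin> N" for x
    using that SN unfolding T(2) by (auto simp: I_def S_def)
  have "(\<integral>x. indicator S x * h x \<partial>lebesgue) = (\<integral>x. indicator I x * h x \<partial>lebesgue)"
  proof (rule integral_cong_AE)
    show "AE x in lebesgue. indicator S x * h x = indicator I x * h x"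
      using AE_not_in[OF N] by eventually_elim (use SI in \<open>auto simp: indicator_def\<close>)
    show "(\<lambda>x. indicator S x * h x) \<in> borel_measurable lebesgue" "(\<lambda>x. indicator I x * h x) \<in> borel_measurable lebesgue"
      using S Im by (intro borel_measurable_times borel_measurable_indicator; auto)+
  qed
  then have "(\<integral>x. indicator S x * h x \<partial>lebesgue) = 0" using I0 by simp
  moreover have "integrable lebesgue (\<lambda>x. indicator S x * h x)"
    using integrable_mult_indicator[OF S h] by simp
  moreover have "AE x in lebesgue. 0 \<le> indicator S x * h x" by (intro AE_I2) (auto simp: S_def indicator_def)
  ultimately have "AE x in lebesgue. indicator S x * h x = 0"
    using integral_nonneg_eq_0_iff_AE by blast
  then have "AE x in lebesgue. x \<notin> S" by eventually_elim (auto simp: S_def indicator_def split: if_splits)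
  then have "S \<in> null_sets lebesgue" using S AE_iff_null_sets by blast
  then show ?thesis by (simp add: S_def negligible_iff_null_sets)
qed

text \<open>
  Compactness of the closure of \<open>V\<close> makes \<open>g\<close> integrable there and gives functions that vanish off \<open>V\<close>
  compact support, so approximate indicators of open subsets of \<open>V\<close> are admissible test functions.
\<close>

lemma negligible_if_test_integrals_zero:
  fixes g :: "'a::euclidean_space \<Rightarrow> real"
  assumes \<Omega>: "open \<Omega>" and g: "locally_integrable_on \<Omega> g"
    and zero: "\<And>\<phi> \<psi>. C1_with_gradient \<phi> \<psi> \<Longrightarrow> compactly_supported_in \<Omega> \<phi> \<Longrightarrow> (\<integral>x. \<phi> x * g x \<partial>lebesgue_on \<Omega>) = 0"
    and V: "open V" "compact (closure V)" "closure V \<subseteq> \<Omega>"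
  shows "negligible {x\<in>V. g x \<noteq> 0}"
proof -
  define K where "K = closure V"
  define h where "h x = indicator K x * g x" for x
  have Km: "K \<in> sets lebesgue" unfolding K_def by (simp add: borel_closed)
  have "integrable (lebesgue_on K) g" using g V unfolding K_def locally_integrable_on_def by blast
  then have h: "integrable lebesgue h"
    unfolding h_def using Km by (simp add: integrable_restrict_space)
  have hm: "h \<in> borel_measurable lebesgue" using h by auto
  have int0: "(\<integral>x. indicator U x * h x \<partial>lebesgue) = 0" if U: "open U" "U \<subseteq> V" for U
  proof -
    obtain \<phi> \<psi> where \<phi>: "\<And>n::nat. C1_with_gradient (\<phi> n) (\<psi> n)" "\<And>n x. 0 \<le> \<phi> n x \<and> \<phi> n x \<le> 1"
       "\<And>n x. x \<notin> U \<Longrightarrow> \<phi> n x = 0" "\<And>x. (\<lambda>n. \<phi> n x) \<longlonglongrightarrow> indicator U x"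
      using indicator_open_approximation[OF U(1)] by blast
    have "(\<integral>x. \<phi> n x * h x \<partial>lebesgue) = 0" for n
    proof -
      have supp: "compactly_supported_in \<Omega> (\<phi> n)"
        unfolding compactly_supported_in_def
        using V U \<phi>(3) closure_subset[of V] by (intro exI[of _ "closure V"]) blast
      have "(\<lambda>x. indicator \<Omega> x *\<^sub>R (\<phi> n x * g x)) = (\<lambda>x. \<phi> n x * h x)"
        using \<phi>(3)[of _ n] U V closure_subset[of V]
        by (auto simp: fun_eq_iff h_def K_def indicator_def)
      then have "(\<integral>x. \<phi> n x * h x \<partial>lebesgue) = (\<integral>x. \<phi> n x * g x \<partial>lebesgue_on \<Omega>)"
        using \<Omega> by (simp add: integral_restrict_space)
      then show ?thesis using zero[OF \<phi>(1) supp] by simp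
    qed
    moreover have "(\<lambda>n. \<integral>x. \<phi> n x * h x \<partial>lebesgue) \<longlonglongrightarrow> (\<integral>x. indicator U x * h x \<partial>lebesgue)"
    proof (rule integral_dominated_convergence)
      show "integrable lebesgue (\<lambda>x. \<bar>h x\<bar>)" using h by auto
      show "AE x in lebesgue. norm (\<phi> n x * h x) \<le> \<bar>h x\<bar>" for n
        using \<phi>(2) by (intro AE_I2) (auto simp: abs_mult intro: mult_left_le_one_le)
      show "AE x in lebesgue. (\<lambda>n. \<phi> n x * h x) \<longlonglongrightarrow> indicator U x * h x"
        by (intro AE_I2 tendsto_intros \<phi>)
      have "\<phi> n \<in> borel_measurable lborel" for n
        using C1_imp_continuous[OF \<phi>(1)] by (simp add: borel_measurable_continuous_onI)
      then have "\<phi> n \<in> borel_measurable lebesgue" for n by (rule measurable_completion)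
      then show "(\<lambda>x. \<phi> n x * h x) \<in> borel_measurable lebesgue" for n using hm by (intro borel_measurable_times)
      show "(\<lambda>x. indicator U x * h x) \<in> borel_measurable lebesgue"
        using U hm by (intro borel_measurable_times borel_measurable_indicator) auto
    qed
    ultimately show ?thesis by (simp add: LIMSEQ_const_iff)
  qed
  have "negligible {x\<in>V. h x > 0}"
    using negligible_pos_of_open_integrals_zero[OF h V(1)] int0 by blast
  moreover have "negligible {x\<in>V. - h x > 0}"
    using negligible_pos_of_open_integrals_zero[of "\<lambda>x. - h x" V] h V(1) int0 by simp
  moreover have "{x\<in>V. g x \<noteq> 0} \<subseteq> {x\<in>V. h x > 0} \<union> {x\<in>V. - h x > 0}"
    using closure_subset[of V] by (auto simp: h_def K_def)
  ultimately show ?thesis using negligible_Un negligible_subset by blast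
qed

text \<open>
  The fundamental lemma of the calculus of variations. Negligibility is a local property, so it
  suffices to consider small balls.
\<close>

lemma AE_zero_if_test_integrals_zero:
  fixes g :: "'a::euclidean_space \<Rightarrow> real"
  assumes \<Omega>: "open \<Omega>" and g: "locally_integrable_on \<Omega> g"
    and zero: "\<And>\<phi> \<psi>. C1_with_gradient \<phi> \<psi> \<Longrightarrow> compactly_supported_in \<Omega> \<phi> \<Longrightarrow> (\<integral>x. \<phi> x * g x \<partial>lebesgue_on \<Omega>) = 0"
  shows "AE x in lebesgue_on \<Omega>. g x = 0"
proof -
  let ?S = "{x\<in>\<Omega>. g x \<noteq> 0}"
  have "negligible ?S"
    unfolding locally_negligible_alt[of ?S]
  proof
    fix x assume x: "x \<in> ?S"
    then obtain e where e: "e > 0" "cball x e \<subseteq> \<Omega>" using \<Omega> open_contains_cball by blast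
    have "negligible {y\<in>ball x e. g y \<noteq> 0}"
      by (rule negligible_if_test_integrals_zero[OF \<Omega> g zero]) (use e in auto)
    moreover have "?S \<inter> ball x e \<subseteq> {y\<in>ball x e. g y \<noteq> 0}" by auto
    ultimately have "negligible (?S \<inter> ball x e)" using negligible_subset by blast
    then show "\<exists>U. openin (top_of_set ?S) U \<and> x \<in> U \<and> negligible U"
      using x e by (intro exI[of _ "?S \<inter> ball x e"]) (auto simp: openin_open)
  qed
  then have "?S \<in> null_sets lebesgue" by (simp add: negligible_iff_null_sets)
  then have "AE x in lebesgue. x \<notin> ?S" by (rule AE_not_in)
  then have "AE x in lebesgue. x \<in> \<Omega> \<longrightarrow> g x = 0" by eventually_elim auto
  then show ?thesis using \<Omega> by (simp add: AE_restrict_space_iff)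
qed

lemma integrable_test_mult:
  fixes G :: "'a::euclidean_space \<Rightarrow> 'b::euclidean_space"
  assumes \<Omega>: "open \<Omega>" and G: "locally_integrable_on \<Omega> G"
    and \<phi>: "continuous_on UNIV \<phi>" "compactly_supported_in \<Omega> \<phi>"
  shows "integrable (lebesgue_on \<Omega>) (\<lambda>x. \<phi> x *\<^sub>R G x)"
proof -
  obtain K where K: "compact K" "K \<subseteq> \<Omega>" "\<And>x. x \<notin> K \<Longrightarrow> \<phi> x = 0"
    using \<phi>(2) unfolding compactly_supported_in_def by blast
  have Km: "K \<in> sets lebesgue" using K(1) by (simp add: lmeasurable_compact fmeasurableD)
  define h where "h x = indicator K x *\<^sub>R G x" for x
  have "integrable (lebesgue_on K) G" using G K unfolding locally_integrable_on_def by blast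
  then have h: "integrable lebesgue h" unfolding h_def using Km by (simp add: integrable_restrict_space)
  have "bounded (\<phi> ` K)"
    using compact_continuous_image[OF continuous_on_subset[OF \<phi>(1)] K(1)] compact_imp_bounded by auto
  then obtain M where M: "\<And>x. x \<in> K \<Longrightarrow> \<bar>\<phi> x\<bar> \<le> M" unfolding bounded_iff by auto
  have "\<phi> \<in> borel_measurable lborel" using \<phi>(1) by (simp add: borel_measurable_continuous_onI)
  then have \<phi>m: "\<phi> \<in> borel_measurable lebesgue" by (rule measurable_completion)
  have "integrable lebesgue (\<lambda>x. \<phi> x *\<^sub>R h x)"
  proof (rule Bochner_Integration.integrable_bound[of _ "\<lambda>x. M *\<^sub>R norm (h x)"])
    show "integrable lebesgue (\<lambda>x. M *\<^sub>R norm (h x))" using h by auto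
    show "(\<lambda>x. \<phi> x *\<^sub>R h x) \<in> borel_measurable lebesgue"
      using \<phi>m h by (intro borel_measurable_scaleR) auto
    show "AE x in lebesgue. norm (\<phi> x *\<^sub>R h x) \<le> norm (M *\<^sub>R norm (h x))"
    proof (rule AE_I2)
      fix x
      show "norm (\<phi> x *\<^sub>R h x) \<le> norm (M *\<^sub>R norm (h x))"
      proof (cases "x \<in> K")
        case True
        have "\<bar>\<phi> x\<bar> * norm (h x) \<le> \<bar>M\<bar> * norm (h x)"
          using M[OF True] by (intro mult_right_mono) auto
        then show ?thesis by (simp add: abs_mult)
      qed (simp add: h_def)
    qed
  qed
  moreover have "(\<lambda>x. indicator \<Omega> x *\<^sub>R \<phi> x *\<^sub>R G x) = (\<lambda>x. \<phi> x *\<^sub>R h x)"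
    using K by (auto simp: fun_eq_iff h_def indicator_def)
  ultimately show ?thesis using \<Omega> by (simp add: integrable_restrict_space)
qed

lemma weak_gradient_unique:
  assumes \<Omega>: "open \<Omega>" and G1: "has_weak_gradient \<Omega> u G1" and G2: "has_weak_gradient \<Omega> u G2"
  shows "AE x in lebesgue_on \<Omega>. G1 x = G2 x"
proof -
  have li: "locally_integrable_on \<Omega> G1" "locally_integrable_on \<Omega> G2"
    using G1 G2 unfolding has_weak_gradient_def by auto
  have "AE x in lebesgue_on \<Omega>. (G1 x - G2 x) \<bullet> b = 0" if "b \<in> Basis" for b
  proof (rule AE_zero_if_test_integrals_zero[OF \<Omega>])
    show "locally_integrable_on \<Omega> (\<lambda>x. (G1 x - G2 x) \<bullet> b)"
      unfolding locally_integrable_on_def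
    proof (intro allI impI integrable_inner_left Bochner_Integration.integrable_diff)
      fix K assume "compact K \<and> K \<subseteq> \<Omega>"
      then show "integrable (lebesgue_on K) G1" "integrable (lebesgue_on K) G2"
        using li unfolding locally_integrable_on_def by blast+
    qed
    fix \<phi> \<psi> assume \<phi>: "C1_with_gradient \<phi> \<psi>" "compactly_supported_in \<Omega> \<phi>"
    note c = C1_imp_continuous[OF \<phi>(1)]
    note i = integrable_test_mult[OF \<Omega> li(1) c \<phi>(2)] integrable_test_mult[OF \<Omega> li(2) c \<phi>(2)]
    have "(\<integral>x. \<phi> x *\<^sub>R G1 x \<partial>lebesgue_on \<Omega>) = (\<integral>x. \<phi> x *\<^sub>R G2 x \<partial>lebesgue_on \<Omega>)"
    proof -
      have "(\<integral>x. u x *\<^sub>R \<psi> x \<partial>lebesgue_on \<Omega>) = - (\<integral>x. \<phi> x *\<^sub>R G x \<partial>lebesgue_on \<Omega>)"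
        if "has_weak_gradient \<Omega> u G" for G
        using that \<phi> unfolding has_weak_gradient_def by blast
      from this[OF G1] this[OF G2] show ?thesis by simp
    qed
    then have "(\<integral>x. \<phi> x *\<^sub>R G1 x - \<phi> x *\<^sub>R G2 x \<partial>lebesgue_on \<Omega>) = 0"
      using i by simp
    then have "(\<integral>x. (\<phi> x *\<^sub>R G1 x - \<phi> x *\<^sub>R G2 x) \<bullet> b \<partial>lebesgue_on \<Omega>) = 0"
      using i by (subst integral_inner_left) auto
    then show "(\<integral>x. \<phi> x * ((G1 x - G2 x) \<bullet> b) \<partial>lebesgue_on \<Omega>) = 0"
      by (simp add: inner_diff_left algebra_simps)
  qed
  then have "AE x in lebesgue_on \<Omega>. \<forall>b\<in>Basis. (G1 x - G2 x) \<bullet> b = 0"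
    by (intro AE_finite_allI) auto
  then show ?thesis
    by eventually_elim (metis eq_iff_diff_eq_0 euclidean_all_zero_iff)
qed

text \<open>
  Identifies the representative chosen in the definition of \<open>weak_gradient\<close>.
\<close>

lemma weak_gradient_C1:
  assumes u: "C1_with_gradient u \<psi>" and \<Omega>: "open \<Omega>"
  shows "AE x in lebesgue_on \<Omega>. weak_gradient \<Omega> u x = \<psi> x"
  using weak_gradient_unique[OF \<Omega> someI[of "has_weak_gradient \<Omega> u"]] has_weak_gradient_C1[OF u \<Omega>]
  unfolding weak_gradient_def by blast

section \<open>Morrey's inequality and traces\<close>

text \<open>
  Plays the role of Hoelder's inequality: above the level \<open>l\<close>, the function \<open>g\<close> is dominated by a multiple
  of its \<open>p\<close>-th power.
\<close>

lemma powr_young_trivial: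
  fixes g l p :: real
  assumes "0 \<le> g" "0 < l" "1 \<le> p"
  shows "g \<le> l + l powr (1 - p) * g powr p"
proof (cases "g \<le> l")
  case True
  have "0 \<le> l powr (1 - p) * g powr p" by simp
  with True show ?thesis by linarith
next
  case False
  then have g: "g > 0" using assms by linarith
  have "1 \<le> (g / l) powr (p - 1)"
    using False assms by (intro ge_one_powr_ge_zero) (auto simp: le_divide_eq)
  then have "g * 1 \<le> g * (g / l) powr (p - 1)"
    using g by (intro mult_left_mono) auto
  also have "\<dots> = g * (g powr (p - 1) * l powr (1 - p))"
  proof -
    have "l powr (1 - p) = 1 / l powr (p - 1)" using powr_minus_divide[of l "p - 1"] by simp
    moreover have "(g / l) powr (p - 1) = g powr (p - 1) / l powr (p - 1)"
      using assms g by (simp only: powr_divide)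
    ultimately show ?thesis by simp
  qed
  also have "\<dots> = l powr (1 - p) * g powr p"
    using g powr_mult_base[of g "p - 1"] by (simp add: mult.commute mult.left_commute)
  finally show ?thesis using assms by linarith
qed

lemma nn_integral_powr_unit:
  assumes "a > -1"
  shows "(\<integral>\<^sup>+t. ennreal (t powr a) * indicator {0<..1} t \<partial>lborel) = ennreal (1 / (a + 1))"
proof -
  have "(\<integral>\<^sup>+t. ennreal (t powr a) * indicator {0<..1} t \<partial>lborel)
      = (\<integral>\<^sup>+t. ennreal (t powr a) * indicator {0..1} t \<partial>lborel)"
    by (intro nn_integral_cong) (auto simp: indicator_def)
  also have "\<dots> = ennreal (1 powr (a + 1) / (a + 1))"
    by (rule nn_integral_has_integral_lebesgue'[OF _ has_integral_powr_from_0]) (use assms in auto)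
  finally show ?thesis by simp
qed

lemma C1_increment_nn_integral:
  fixes x y :: "'a::euclidean_space"
  assumes u: "C1_with_gradient u \<psi>" and D: "norm (y - x) \<le> D"
  shows "ennreal \<bar>u x - u y\<bar> \<le> (\<integral>\<^sup>+t. ennreal (D * norm (\<psi> (x + t *\<^sub>R (y - x)))) * indicator {0<..1} t \<partial>lborel)"
proof -
  define q where "q t = \<psi> (x + t *\<^sub>R (y - x)) \<bullet> (y - x)" for t
  have \<psi>c: "continuous_on S (\<lambda>t. \<psi> (x + t *\<^sub>R (y - x)))" for S
    by (intro continuous_on_compose2[OF C1_grad_continuous[OF u]] continuous_intros) auto
  have qc: "continuous_on S q" for S unfolding q_def by (intro continuous_intros \<psi>c)
  have i: "integrable lborel (\<lambda>t. indicator {0..1} t *\<^sub>R q t)"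
    by (rule borel_integrable_compact[OF _ qc]) auto
  have "(\<integral>t. indicator {0..1} t *\<^sub>R q t \<partial>lborel) = u (x + 1 *\<^sub>R (y - x)) - u (x + 0 *\<^sub>R (y - x))"
  proof (rule integral_FTC_atLeastAtMost[OF _ _ qc])
    fix t :: real
    show "((\<lambda>\<tau>. u (x + \<tau> *\<^sub>R (y - x))) has_vector_derivative q t) (at t within {0..1})"
      using C1_derivative_along_line[OF u] unfolding q_def has_real_derivative_iff_has_vector_derivative .
  qed simp
  then have e: "(\<integral>t. indicator {0..1} t *\<^sub>R q t \<partial>lborel) = u y - u x" by simp
  have "\<bar>u x - u y\<bar> = norm (\<integral>t. indicator {0..1} t *\<^sub>R q t \<partial>lborel)"
    unfolding e by (simp add: abs_minus_commute)
  then have "ennreal \<bar>u x - u y\<bar> \<le> (\<integral>\<^sup>+t. norm (indicator {0..1} t *\<^sub>R q t) \<partial>lborel)"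
    using integral_norm_bound_ennreal[OF i] by simp
  also have "\<dots> \<le> (\<integral>\<^sup>+t. ennreal (D * norm (\<psi> (x + t *\<^sub>R (y - x)))) * indicator {0<..1} t \<partial>lborel)"
  proof (rule nn_integral_mono_AE)
    have "AE t in lborel. t \<noteq> (0::real)" by (rule AE_lborel_singleton)
    then show "AE t in lborel. ennreal (norm (indicator {0..1} t *\<^sub>R q t))
        \<le> ennreal (D * norm (\<psi> (x + t *\<^sub>R (y - x)))) * indicator {0<..1} t"
    proof eventually_elim
      fix t :: real assume t: "t \<noteq> 0"
      have "\<bar>q t\<bar> \<le> norm (\<psi> (x + t *\<^sub>R (y - x))) * norm (y - x)"
        unfolding q_def by (rule Cauchy_Schwarz_ineq2)
      also have "\<dots> \<le> D * norm (\<psi> (x + t *\<^sub>R (y - x)))"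
        using D by (subst mult.commute) (intro mult_right_mono, auto)
      finally show "ennreal (norm (indicator {0..1} t *\<^sub>R q t))
        \<le> ennreal (D * norm (\<psi> (x + t *\<^sub>R (y - x)))) * indicator {0<..1} t"
        using t by (auto simp: indicator_def intro!: ennreal_leI)
    qed
  qed
  finally show ?thesis .
qed

text \<open>
  The homothety with centre \<open>x\<close> and ratio \<open>t\<close> maps the convex set \<open>\<Omega>\<close> into itself.
\<close>

lemma nn_integral_homothety_le:
  fixes \<Omega> :: "'a::euclidean_space set" and F :: "'a \<Rightarrow> ennreal"
  assumes F[measurable]: "F \<in> borel_measurable borel" and \<Omega>: "open \<Omega>" "convex \<Omega>" and x: "x \<in> closure \<Omega>"
    and t: "0 < t" "t \<le> 1"
  shows "(\<integral>\<^sup>+y. F (x + t *\<^sub>R (y - x)) * indicator \<Omega> y \<partial>lborel)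
       \<le> ennreal (t powr - real DIM('a)) * (\<integral>\<^sup>+y. F y * indicator \<Omega> y \<partial>lborel)"
proof -
  let ?n = "DIM('a)"
  have [measurable]: "\<Omega> \<in> sets borel" using \<Omega> by simp
  have inside: "x + t *\<^sub>R (y - x) \<in> \<Omega>" if "y \<in> \<Omega>" for y
  proof -
    have "x - t *\<^sub>R (x - y) \<in> interior \<Omega>"
      using \<Omega> that x t by (intro mem_interior_closure_convex_shrink) (auto simp: interior_open)
    then show ?thesis using \<Omega> by (simp add: interior_open algebra_simps)
  qed
  let ?T = "\<lambda>y. (x - t *\<^sub>R x) + t *\<^sub>R y"
  have "(\<integral>\<^sup>+y. F y * indicator \<Omega> y \<partial>lborel)
     = (\<integral>\<^sup>+y. F y * indicator \<Omega> y \<partial>(density (distr lborel borel ?T) (\<lambda>_. \<bar>t\<bar>^?n)))"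
    using t by (subst lborel_affine[of t "x - t *\<^sub>R x"]) auto
  also have "\<dots> = (\<integral>\<^sup>+y. ennreal (t ^ ?n) * (F (?T y) * indicator \<Omega> (?T y)) \<partial>lborel)"
    using t by (subst nn_integral_density) (auto simp: nn_integral_distr)
  also have "\<dots> = ennreal (t ^ ?n) * (\<integral>\<^sup>+y. F (?T y) * indicator \<Omega> (?T y) \<partial>lborel)"
    by (rule nn_integral_cmult) simp
  finally have e: "(\<integral>\<^sup>+y. F y * indicator \<Omega> y \<partial>lborel)
       = ennreal (t ^ ?n) * (\<integral>\<^sup>+y. F (?T y) * indicator \<Omega> (?T y) \<partial>lborel)" .
  have "(\<integral>\<^sup>+y. F (x + t *\<^sub>R (y - x)) * indicator \<Omega> y \<partial>lborel)
      \<le> (\<integral>\<^sup>+y. F (?T y) * indicator \<Omega> (?T y) \<partial>lborel)"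
  proof (rule nn_integral_mono)
    fix y
    have eq: "x + t *\<^sub>R (y - x) = ?T y" by (simp add: algebra_simps)
    show "F (x + t *\<^sub>R (y - x)) * indicator \<Omega> y \<le> F (?T y) * indicator \<Omega> (?T y)"
      using inside[of y] unfolding eq by (auto simp: indicator_def)
  qed
  also have "\<dots> = ennreal (t powr - real ?n) * (ennreal (t ^ ?n) * (\<integral>\<^sup>+y. F (?T y) * indicator \<Omega> (?T y) \<partial>lborel))"
    using t by (simp add: mult.assoc[symmetric] ennreal_mult[symmetric] powr_minus powr_realpow)
  finally show ?thesis unfolding e .
qed

text \<open>
  Integrate \<open>|u x - u y|\<close>, bounded by the integral of the gradient over the segment, over all
  \<open>y \<in> \<Omega>\<close>, and exchange the integrals. Let \<open>t\<close> be the parameter on the segment, and split the gradient at the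
  level \<open>\<eta> * t powr - a\<close>. The part below the level is integrable in \<open>t\<close> if \<open>a < 1\<close>. The part above is
  bounded by the energy times the integral of \<open>t powr (a * (p - 1) - n)\<close>, where \<open>t powr - n\<close> comes from the
  homothety; it is finite if \<open>a > (n - 1) / (p - 1)\<close>. Such an \<open>a\<close> exists because \<open>p > n\<close>. The level \<open>\<eta>\<close>
  stays free, so that the first term can be made small before the energy is.
\<close>

lemma morrey_bound:
  fixes \<Omega> :: "'a::euclidean_space set"
  assumes \<Omega>: "open \<Omega>" "convex \<Omega>" "bounded \<Omega>" and x: "x \<in> closure \<Omega>" and p: "p > real DIM('a)"
  shows "\<exists>C>0. \<forall>u \<psi> \<eta>. C1_with_gradient u \<psi> \<and> \<eta> > 0 \<longrightarrow>
     ennreal \<bar>u x\<bar> * emeasure lborel \<Omega> \<le> ennreal (C * \<eta>) + ennreal (C * \<eta> powr (1 - p)) *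
       ((\<integral>\<^sup>+y. ennreal (\<bar>u y\<bar> powr p) * indicator \<Omega> y \<partial>lborel)
         + (\<integral>\<^sup>+y. ennreal (norm (\<psi> y) powr p) * indicator \<Omega> y \<partial>lborel))"
proof -
  define n where "n = real DIM('a)"
  have n: "n \<ge> 1" unfolding n_def by (simp add: Suc_leI)
  have p1: "p > 1" using p n unfolding n_def by linarith
  \<comment> \<open>The exponent \<open>a\<close> is the midpoint of the admissible interval from \<open>q\<close> to \<open>1\<close>.\<close>
  define q where "q = (n - 1) / (p - 1)"
  define a where "a = (q + 1) / 2"
  have q1: "q < 1" using p p1 by (simp add: q_def n_def divide_less_eq)
  have q0: "0 \<le> q" using p1 n by (simp add: q_def)
  have a: "q < a" "a < 1" "0 < a" using q1 q0 by (simp_all add: a_def)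
  have a2: "a * (p - 1) - n > -1"
    using a(1) p1 by (simp add: q_def divide_less_eq)
  have [measurable]: "\<Omega> \<in> sets borel" using \<Omega> by simp
  obtain B where B: "\<And>y. y \<in> \<Omega> \<Longrightarrow> norm y \<le> B" using \<Omega>(3) unfolding bounded_iff by blast
  define D where "D = \<bar>B\<bar> + norm x"
  have D: "norm (y - x) \<le> D" if "y \<in> \<Omega>" for y
    using norm_triangle_ineq4[of y x] B[OF that] by (simp add: D_def)
  have D0: "D \<ge> 0" by (simp add: D_def)
  have fin: "emeasure lborel \<Omega> < \<infinity>" using \<Omega>(3) by (rule emeasure_bounded_finite)
  define V where "V = measure lborel \<Omega>"
  have V: "emeasure lborel \<Omega> = ennreal V" "V \<ge> 0"
    using fin by (auto simp: V_def emeasure_eq_ennreal_measure)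
  define c1 where "c1 = 1 / (1 - a)"
  define c2 where "c2 = 1 / (a * (p - 1) - n + 1)"
  have c: "c1 > 0" "c2 > 0" using a a2 by (auto simp: c1_def c2_def)
  define C where "C = V + D * c1 * V + D * c2 + 1"
  have C: "C > 0" using V D0 c by (auto simp: C_def add_nonneg_pos)
  have main: "ennreal \<bar>u x\<bar> * emeasure lborel \<Omega> \<le> ennreal (C * \<eta>) + ennreal (C * \<eta> powr (1 - p)) *
       ((\<integral>\<^sup>+y. ennreal (\<bar>u y\<bar> powr p) * indicator \<Omega> y \<partial>lborel)
         + (\<integral>\<^sup>+y. ennreal (norm (\<psi> y) powr p) * indicator \<Omega> y \<partial>lborel))"
    if u: "C1_with_gradient u \<psi>" and \<eta>: "\<eta> > 0" for u \<psi> \<eta>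
  proof -
    have [measurable]: "u \<in> borel_measurable borel" "\<psi> \<in> borel_measurable borel"
      using C1_imp_continuous[OF u] C1_grad_continuous[OF u] by (auto intro: borel_measurable_continuous_onI)
    let ?A = "\<integral>\<^sup>+y. ennreal (\<bar>u y\<bar> powr p) * indicator \<Omega> y \<partial>lborel"
    let ?I = "\<integral>\<^sup>+y. ennreal (norm (\<psi> y) powr p) * indicator \<Omega> y \<partial>lborel"
    let ?k = "\<eta> powr (1 - p)"
    let ?lam = "\<lambda>t. \<eta> * t powr - a"
    let ?P = "\<lambda>y t. ennreal (norm (\<psi> (x + t *\<^sub>R (y - x))) powr p)"
    have young: "D * norm (\<psi> z) \<le> D * (?lam t) + D * (?k * t powr (a * (p - 1)) * norm (\<psi> z) powr p)"
      if "t > 0" for t z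
    proof -
      have "(?lam t) powr (1 - p) = ?k * t powr (a * (p - 1))"
        using that \<eta> by (simp add: powr_mult powr_powr algebra_simps)
      then have "norm (\<psi> z) \<le> ?lam t + (?k * t powr (a * (p - 1))) * norm (\<psi> z) powr p"
        using powr_young_trivial[of "norm (\<psi> z)" "?lam t" p] that \<eta> p1 by simp
      then show ?thesis using mult_left_mono[OF _ D0] by (metis distrib_left)
    qed
    define R where "R y t = ennreal (D * ?k) * (ennreal (t powr (a * (p - 1))) * ?P y t * indicator {0<..1} t)" for y t
    have pw: "ennreal \<bar>u x\<bar> \<le> ennreal (\<eta> + D * \<eta> * c1) + ennreal (?k) * ennreal (\<bar>u y\<bar> powr p) + (\<integral>\<^sup>+t. R y t \<partial>lborel)"
      if y: "y \<in> \<Omega>" for y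
    proof -
      have "ennreal \<bar>u x - u y\<bar> \<le> (\<integral>\<^sup>+t. ennreal (D * norm (\<psi> (x + t *\<^sub>R (y - x)))) * indicator {0<..1} t \<partial>lborel)"
        by (rule C1_increment_nn_integral[OF u D[OF y]])
      also have "\<dots> \<le> (\<integral>\<^sup>+t. ennreal (D * \<eta>) * (ennreal (t powr - a) * indicator {0<..1} t) + R y t \<partial>lborel)"
      proof (rule nn_integral_mono)
        fix t :: real
        show "ennreal (D * norm (\<psi> (x + t *\<^sub>R (y - x)))) * indicator {0<..1} t
          \<le> ennreal (D * \<eta>) * (ennreal (t powr - a) * indicator {0<..1} t) + R y t"
        proof (cases "t \<in> {0<..1}")
          case True
          then show ?thesis
            using young[of t "x + t *\<^sub>R (y - x)"] D0 \<eta>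
            by (simp add: R_def ennreal_mult[symmetric] ennreal_plus[symmetric] mult.assoc del: ennreal_plus)
        qed simp
      qed
      also have "\<dots> = ennreal (D * \<eta>) * ennreal c1 + (\<integral>\<^sup>+t. R y t \<partial>lborel)"
      proof -
        have "(\<lambda>t. R y t) \<in> borel_measurable lborel" unfolding R_def by measurable
        moreover have "(\<integral>\<^sup>+t. ennreal (t powr - a) * indicator {0<..1} t \<partial>lborel) = ennreal c1"
          using nn_integral_powr_unit[of "- a"] a by (simp add: c1_def algebra_simps)
        ultimately show ?thesis by (simp add: nn_integral_add nn_integral_cmult)
      qed
      finally have i: "ennreal \<bar>u x - u y\<bar> \<le> ennreal (D * \<eta> * c1) + (\<integral>\<^sup>+t. R y t \<partial>lborel)"
        using D0 \<eta> c by (simp add: ennreal_mult[symmetric])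
      have "\<bar>u x\<bar> \<le> \<bar>u x - u y\<bar> + (\<eta> + ?k * \<bar>u y\<bar> powr p)"
        using powr_young_trivial[of "\<bar>u y\<bar>" \<eta> p] \<eta> p1 by linarith
      then have "ennreal \<bar>u x\<bar> \<le> ennreal \<bar>u x - u y\<bar> + (ennreal \<eta> + ennreal ?k * ennreal (\<bar>u y\<bar> powr p))"
        using \<eta> by (simp add: ennreal_mult[symmetric] ennreal_plus[symmetric] ennreal_leI del: ennreal_plus)
      also have "\<dots> \<le> (ennreal (D * \<eta> * c1) + (\<integral>\<^sup>+t. R y t \<partial>lborel)) + (ennreal \<eta> + ennreal ?k * ennreal (\<bar>u y\<bar> powr p))"
        by (intro add_right_mono i)
      also have "\<dots> = ennreal (\<eta> + D * \<eta> * c1) + ennreal (?k) * ennreal (\<bar>u y\<bar> powr p) + (\<integral>\<^sup>+t. R y t \<partial>lborel)"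
        using D0 \<eta> c by (simp add: ac_simps)
      finally show ?thesis .
    qed
    have Rm: "(\<lambda>(y, t). R y t * indicator \<Omega> y) \<in> borel_measurable (lborel \<Otimes>\<^sub>M lborel)"
      unfolding R_def by measurable
    have Rm1: "(\<lambda>y. \<integral>\<^sup>+t. R y t * indicator \<Omega> y \<partial>lborel) \<in> borel_measurable lborel"
      using lborel.borel_measurable_nn_integral[of "\<lambda>y t. R y t * indicator \<Omega> y" lborel] Rm by simp
    have "(\<integral>\<^sup>+y. (\<integral>\<^sup>+t. R y t * indicator \<Omega> y \<partial>lborel) \<partial>lborel) = (\<integral>\<^sup>+t. (\<integral>\<^sup>+y. R y t * indicator \<Omega> y \<partial>lborel) \<partial>lborel)"
      using lborel_pair.Fubini'[of "\<lambda>y t. R y t * indicator \<Omega> y"] Rm by simp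
    also have "\<dots> \<le> (\<integral>\<^sup>+t. (ennreal (D * ?k) * ?I) * (ennreal (t powr (a * (p - 1) - n)) * indicator {0<..1} t) \<partial>lborel)"
    proof (rule nn_integral_mono)
      fix t :: real
      show "(\<integral>\<^sup>+y. R y t * indicator \<Omega> y \<partial>lborel) \<le> (ennreal (D * ?k) * ?I) * (ennreal (t powr (a * (p - 1) - n)) * indicator {0<..1} t)"
      proof (cases "t \<in> {0<..1}")
        case True
        have "(\<integral>\<^sup>+y. R y t * indicator \<Omega> y \<partial>lborel)
           = (\<integral>\<^sup>+y. (ennreal (D * ?k) * ennreal (t powr (a * (p - 1)))) * (?P y t * indicator \<Omega> y) \<partial>lborel)"
          using True by (intro nn_integral_cong) (simp add: R_def ac_simps)
        also have "\<dots> = (ennreal (D * ?k) * ennreal (t powr (a * (p - 1)))) * (\<integral>\<^sup>+y. ?P y t * indicator \<Omega> y \<partial>lborel)"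
          by (rule nn_integral_cmult) measurable
        also have "\<dots> \<le> (ennreal (D * ?k) * ennreal (t powr (a * (p - 1)))) * (ennreal (t powr - n) * ?I)"
          unfolding n_def using True \<Omega> x
          by (intro mult_left_mono nn_integral_homothety_le[where F="\<lambda>z. ennreal (norm (\<psi> z) powr p)"]) auto
        also have "\<dots> = (ennreal (D * ?k) * ?I) * (ennreal (t powr (a * (p - 1))) * ennreal (t powr - n))"
          by (simp add: ac_simps)
        also have "ennreal (t powr (a * (p - 1))) * ennreal (t powr - n) = ennreal (t powr (a * (p - 1) - n))"
          using True by (simp add: ennreal_mult[symmetric] powr_add[symmetric])
        finally show ?thesis using True by simp
      qed (simp add: R_def)
    qed
    also have "\<dots> = (ennreal (D * ?k) * ?I) * ennreal c2"
      using nn_integral_powr_unit[OF a2] by (subst nn_integral_cmult) (auto simp: c2_def)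
    finally have Rint: "(\<integral>\<^sup>+y. (\<integral>\<^sup>+t. R y t * indicator \<Omega> y \<partial>lborel) \<partial>lborel) \<le> ennreal (D * c2 * ?k) * ?I"
      using D0 c by (simp add: ennreal_mult ac_simps)
    have "ennreal \<bar>u x\<bar> * emeasure lborel \<Omega> = (\<integral>\<^sup>+y. ennreal \<bar>u x\<bar> * indicator \<Omega> y \<partial>lborel)"
      by (simp add: nn_integral_cmult_indicator)
    also have "\<dots> \<le> (\<integral>\<^sup>+y. ennreal (\<eta> + D * \<eta> * c1) * indicator \<Omega> y
        + (ennreal ?k * (ennreal (\<bar>u y\<bar> powr p) * indicator \<Omega> y) + (\<integral>\<^sup>+t. R y t * indicator \<Omega> y \<partial>lborel)) \<partial>lborel)"
    proof (rule nn_integral_mono)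
      fix y
      show "ennreal \<bar>u x\<bar> * indicator \<Omega> y \<le> ennreal (\<eta> + D * \<eta> * c1) * indicator \<Omega> y
        + (ennreal ?k * (ennreal (\<bar>u y\<bar> powr p) * indicator \<Omega> y) + (\<integral>\<^sup>+t. R y t * indicator \<Omega> y \<partial>lborel))"
        using pw[of y] by (cases "y \<in> \<Omega>") (auto simp: add.assoc)
    qed
    also have "\<dots> = ennreal (\<eta> + D * \<eta> * c1) * emeasure lborel \<Omega>
        + (ennreal ?k * ?A + (\<integral>\<^sup>+y. (\<integral>\<^sup>+t. R y t * indicator \<Omega> y \<partial>lborel) \<partial>lborel))"
      using Rm1 by (simp add: nn_integral_add nn_integral_cmult nn_integral_cmult_indicator)
    also have "\<dots> \<le> ennreal (\<eta> + D * \<eta> * c1) * ennreal V + (ennreal ?k * ?A + ennreal (D * c2 * ?k) * ?I)"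
      unfolding V(1) by (intro add_left_mono Rint)
    also have "\<dots> \<le> ennreal (C * \<eta>) + (ennreal (C * ?k) * ?A + ennreal (C * ?k) * ?I)"
    proof (intro add_mono mult_right_mono)
      have "(\<eta> + D * \<eta> * c1) * V = \<eta> * (V + D * c1 * V)" by (simp add: algebra_simps)
      also have "\<dots> \<le> \<eta> * C" using \<eta> D0 c by (intro mult_left_mono) (auto simp: C_def)
      finally have "ennreal ((\<eta> + D * \<eta> * c1) * V) \<le> ennreal (C * \<eta>)"
        by (simp add: ennreal_leI mult.commute[of \<eta>] del: ennreal_plus)
      moreover have "ennreal ((\<eta> + D * \<eta> * c1) * V) = ennreal (\<eta> + D * \<eta> * c1) * ennreal V"
        using \<eta> D0 c V(2) by (intro ennreal_mult) auto
      ultimately show "ennreal (\<eta> + D * \<eta> * c1) * ennreal V \<le> ennreal (C * \<eta>)" by simp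
      have "1 * ?k \<le> C * ?k" using V D0 c by (intro mult_right_mono) (auto simp: C_def)
      then show "ennreal ?k \<le> ennreal (C * ?k)" by (simp add: ennreal_leI)
      have "D * c2 * ?k \<le> C * ?k" using V D0 c by (intro mult_right_mono) (auto simp: C_def)
      then show "ennreal (D * c2 * ?k) \<le> ennreal (C * ?k)" by (simp add: ennreal_leI)
    qed auto
    finally show ?thesis by (simp add: distrib_left)
  qed
  then show ?thesis using C by blast
qed

lemma open_emeasure_pos:
  fixes \<Omega> :: "'a::euclidean_space set"
  assumes "open \<Omega>" "\<Omega> \<noteq> {}" shows "emeasure lborel \<Omega> > 0"
proof -
  have "\<not> negligible \<Omega>" using assms open_not_negligible by blast
  then have "emeasure lebesgue \<Omega> \<noteq> 0"
    using assms by (auto simp: negligible_iff_null_sets)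
  then show ?thesis using assms by (simp add: zero_less_iff_neq_zero)
qed

lemma bounded_continuous_integrable_on:
  fixes f :: "'a::euclidean_space \<Rightarrow> real"
  assumes \<Omega>: "open \<Omega>" "bounded \<Omega>" and f: "continuous_on UNIV f"
  shows "integrable (lebesgue_on \<Omega>) f"
    and "(\<And>x. 0 \<le> f x) \<Longrightarrow> ennreal (\<integral>x. f x \<partial>lebesgue_on \<Omega>) = (\<integral>\<^sup>+x. ennreal (f x) * indicator \<Omega> x \<partial>lborel)"
proof -
  have \<Omega>m: "\<Omega> \<in> sets lebesgue" "\<Omega> \<in> sets borel" using \<Omega> by auto
  have i1: "integrable lborel (\<lambda>x. indicator (closure \<Omega>) x *\<^sub>R f x)"
    using \<Omega> f by (intro borel_integrable_compact) (auto intro: continuous_on_subset)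
  have "integrable lborel (\<lambda>x. indicator \<Omega> x *\<^sub>R (indicator (closure \<Omega>) x *\<^sub>R f x))"
    using \<Omega>m by (intro integrable_mult_indicator i1) auto
  moreover have "(\<lambda>x. indicator \<Omega> x *\<^sub>R (indicator (closure \<Omega>) x *\<^sub>R f x)) = (\<lambda>x. indicator \<Omega> x *\<^sub>R f x)"
    using closure_subset[of \<Omega>] by (auto simp: fun_eq_iff indicator_def)
  ultimately have i: "integrable lborel (\<lambda>x. indicator \<Omega> x *\<^sub>R f x)" by simp
  have m: "(\<lambda>x. indicator \<Omega> x *\<^sub>R f x) \<in> borel_measurable lborel" using i by auto
  show "integrable (lebesgue_on \<Omega>) f"
    using i m \<Omega>m by (simp add: integrable_restrict_space integrable_completion)
  assume f0: "\<And>x. 0 \<le> f x"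
  have "ennreal (\<integral>x. f x \<partial>lebesgue_on \<Omega>) = ennreal (\<integral>x. indicator \<Omega> x *\<^sub>R f x \<partial>lborel)"
    using \<Omega>m m by (simp add: integral_restrict_space integral_completion)
  also have "\<dots> = (\<integral>\<^sup>+x. ennreal (indicator \<Omega> x *\<^sub>R f x) \<partial>lborel)"
    using f0 by (intro nn_integral_eq_integral[symmetric] i AE_I2) auto
  also have "\<dots> = (\<integral>\<^sup>+x. ennreal (f x) * indicator \<Omega> x \<partial>lborel)"
    by (intro nn_integral_cong) (auto simp: indicator_def)
  finally show "ennreal (\<integral>x. f x \<partial>lebesgue_on \<Omega>) = (\<integral>\<^sup>+x. ennreal (f x) * indicator \<Omega> x \<partial>lborel)" .
qed

lemma continuous_norm_powr:
  fixes f :: "'a::euclidean_space \<Rightarrow> 'b::euclidean_space"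
  assumes "continuous_on S f" "p > 0" shows "continuous_on S (\<lambda>x. norm (f x) powr p)"
  using assms by (intro continuous_on_powr' continuous_intros) auto

lemma Lp_continuous:
  fixes f :: "'a::euclidean_space \<Rightarrow> 'b::euclidean_space"
  assumes "open \<Omega>" "bounded \<Omega>" "continuous_on UNIV f" "p > 0"
  shows "f \<in> Lp p (lebesgue_on \<Omega>)"
proof -
  have "f \<in> borel_measurable lborel" using assms(3) by (simp add: borel_measurable_continuous_onI)
  then have "f \<in> borel_measurable lebesgue" by (rule measurable_completion)
  then have "f \<in> borel_measurable (lebesgue_on \<Omega>)" by (rule measurable_restrict_space1)
  then show ?thesis
    unfolding Lp_def using assms by (auto intro!: bounded_continuous_integrable_on(1) continuous_norm_powr)
qed

lemma C1_in_sobolev: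
  assumes \<Omega>: "open \<Omega>" "bounded \<Omega>" and u: "C1_with_gradient u \<psi>" and p: "p > 0"
  shows "u \<in> sobolev p \<Omega>"
  unfolding sobolev_def
  using Lp_continuous[OF \<Omega> C1_imp_continuous[OF u] p] Lp_continuous[OF \<Omega> C1_grad_continuous[OF u] p]
    has_weak_gradient_C1[OF u \<Omega>(1)] by blast

text \<open>
  The chosen representative is measurable because Lebesgue measure is complete.
\<close>

lemma weak_gradient_C1_integral:
  assumes u: "C1_with_gradient u \<psi>" and \<Omega>: "open \<Omega>"
  shows "(\<integral>x. norm (weak_gradient \<Omega> u x) powr p \<partial>lebesgue_on \<Omega>) = (\<integral>x. norm (\<psi> x) powr p \<partial>lebesgue_on \<Omega>)"
proof (rule integral_cong_AE)
  have ae: "AE x in lebesgue_on \<Omega>. \<psi> x = weak_gradient \<Omega> u x"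
    using weak_gradient_C1[OF u \<Omega>] by eventually_elim simp
  have "\<psi> \<in> borel_measurable lborel" using C1_grad_continuous[OF u] by (simp add: borel_measurable_continuous_onI)
  then have "\<psi> \<in> borel_measurable lebesgue" by (rule measurable_completion)
  then have m: "\<psi> \<in> borel_measurable (lebesgue_on \<Omega>)" by (rule measurable_restrict_space1)
  then show "(\<lambda>x. norm (\<psi> x) powr p) \<in> borel_measurable (lebesgue_on \<Omega>)" by measurable
  have "weak_gradient \<Omega> u \<in> borel_measurable (lebesgue_on \<Omega>)"
  proof -
    have \<Omega>m: "\<Omega> \<inter> space lebesgue \<in> sets lebesgue" using \<Omega> by simp
    have "AE x in lebesgue. indicator \<Omega> x *\<^sub>R \<psi> x = indicator \<Omega> x *\<^sub>R weak_gradient \<Omega> u x"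
      using ae unfolding AE_restrict_space_iff[OF \<Omega>m] by eventually_elim (auto simp: indicator_def)
    then have "(\<lambda>x. indicator \<Omega> x *\<^sub>R weak_gradient \<Omega> u x) \<in> borel_measurable lebesgue"
      using m unfolding borel_measurable_restrict_space_iff[OF \<Omega>m] by (rule borel_measurable_AE[rotated])
    then show ?thesis unfolding borel_measurable_restrict_space_iff[OF \<Omega>m] .
  qed
  then show "(\<lambda>x. norm (weak_gradient \<Omega> u x) powr p) \<in> borel_measurable (lebesgue_on \<Omega>)" by measurable
  show "AE x in lebesgue_on \<Omega>. norm (weak_gradient \<Omega> u x) powr p = norm (\<psi> x) powr p"
    using ae by eventually_elim simp
qed

lemma sobolev_norm_C1:
  assumes u: "C1_with_gradient u \<psi>" and \<Omega>: "open \<Omega>"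
  shows "sobolev_norm p \<Omega> u =
    ((\<integral>x. \<bar>u x\<bar> powr p \<partial>lebesgue_on \<Omega>) + (\<integral>x. norm (\<psi> x) powr p \<partial>lebesgue_on \<Omega>)) powr (1 / p)"
  unfolding sobolev_norm_def weak_gradient_C1_integral[OF assms] ..

lemma sobolev_convergence_pointwise:
  fixes \<Omega> :: "'a::euclidean_space set"
  assumes \<Omega>: "open \<Omega>" "convex \<Omega>" "bounded \<Omega>" "\<Omega> \<noteq> {}" and x: "x \<in> closure \<Omega>" and p: "p > real DIM('a)"
    and C1: "\<And>m. C1_with_gradient (v m) (\<psi> m)" and lim: "(\<lambda>m. sobolev_norm p \<Omega> (v m)) \<longlonglongrightarrow> 0"
  shows "(\<lambda>m. v m x) \<longlonglongrightarrow> 0"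
proof -
  have p0: "p > 0" using p by (metis le_less_trans of_nat_0_le_iff)
  define e where "e m = (\<integral>x. \<bar>v m x\<bar> powr p \<partial>lebesgue_on \<Omega>) + (\<integral>x. norm (\<psi> m x) powr p \<partial>lebesgue_on \<Omega>)" for m
  have e0: "0 \<le> e m" for m unfolding e_def by (intro add_nonneg_nonneg integral_nonneg_AE) auto
  have "(\<lambda>m. sobolev_norm p \<Omega> (v m) powr p) \<longlonglongrightarrow> 0 powr p"
  proof (rule tendsto_powr'[OF lim tendsto_const])
    show "(0::real) \<noteq> 0 \<or> 0 < p \<and> (\<forall>\<^sub>F m in sequentially. 0 \<le> sobolev_norm p \<Omega> (v m))"
      using p0 by (auto simp: sobolev_norm_def)
  qed
  moreover have "sobolev_norm p \<Omega> (v m) powr p = e m" for m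
    using p0 e0[of m] by (simp add: sobolev_norm_C1[OF C1 \<Omega>(1)] e_def[symmetric] powr_powr)
  ultimately have elim: "e \<longlonglongrightarrow> 0" using p0 by simp
  obtain C where C: "C > 0" and bound: "\<And>u \<psi> \<eta>. C1_with_gradient u \<psi> \<Longrightarrow> \<eta> > 0 \<Longrightarrow>
     ennreal \<bar>u x\<bar> * emeasure lborel \<Omega> \<le> ennreal (C * \<eta>) + ennreal (C * \<eta> powr (1 - p)) *
       ((\<integral>\<^sup>+y. ennreal (\<bar>u y\<bar> powr p) * indicator \<Omega> y \<partial>lborel)
         + (\<integral>\<^sup>+y. ennreal (norm (\<psi> y) powr p) * indicator \<Omega> y \<partial>lborel))"
    using morrey_bound[OF \<Omega>(1-3) x p] by blast
  define V where "V = measure lborel \<Omega>"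
  have V: "emeasure lborel \<Omega> = ennreal V"
    using emeasure_bounded_finite[OF \<Omega>(3)] by (auto simp: V_def emeasure_eq_ennreal_measure)
  have Vpos: "V > 0" using open_emeasure_pos[OF \<Omega>(1,4)] unfolding V by simp
  have main: "\<bar>v m x\<bar> * V \<le> C * \<eta> + C * \<eta> powr (1 - p) * e m" if "\<eta> > 0" for \<eta> m
  proof -
    have A: "(\<integral>\<^sup>+y. ennreal (\<bar>v m y\<bar> powr p) * indicator \<Omega> y \<partial>lborel) = ennreal (\<integral>x. \<bar>v m x\<bar> powr p \<partial>lebesgue_on \<Omega>)"
      using bounded_continuous_integrable_on(2)[OF \<Omega>(1,3) continuous_norm_powr[OF C1_imp_continuous[OF C1] p0]] by simp
    have B: "(\<integral>\<^sup>+y. ennreal (norm (\<psi> m y) powr p) * indicator \<Omega> y \<partial>lborel) = ennreal (\<integral>x. norm (\<psi> m x) powr p \<partial>lebesgue_on \<Omega>)"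
      using bounded_continuous_integrable_on(2)[OF \<Omega>(1,3) continuous_norm_powr[OF C1_grad_continuous[OF C1] p0]] by simp
    have "ennreal \<bar>v m x\<bar> * ennreal V \<le> ennreal (C * \<eta>) + ennreal (C * \<eta> powr (1 - p)) * ennreal (e m)"
      using bound[OF C1 that, of m] unfolding A B V e_def by (simp add: ennreal_plus integral_nonneg_AE)
    then have "ennreal (\<bar>v m x\<bar> * V) \<le> ennreal (C * \<eta> + C * \<eta> powr (1 - p) * e m)"
      using C that e0[of m] Vpos by (simp add: ennreal_mult ennreal_plus)
    then show ?thesis using C that e0[of m] by (subst (asm) ennreal_le_iff) auto
  qed
  show ?thesis
  proof (rule LIMSEQ_I)
    fix r :: real assume r: "0 < r"
    \<comment> \<open>Each of the two terms of the bound is to be at most \<open>r * V / 4\<close>.\<close>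
    define \<eta> where "\<eta> = r * V / (4 * C)"
    have \<eta>: "\<eta> > 0" using r Vpos C by (simp add: \<eta>_def)
    have "(\<lambda>m. C * \<eta> powr (1 - p) * e m) \<longlonglongrightarrow> C * \<eta> powr (1 - p) * 0"
      by (intro tendsto_intros elim)
    then obtain M where M: "\<And>m. m \<ge> M \<Longrightarrow> norm (C * \<eta> powr (1 - p) * e m - 0) < r * V / 4"
      using LIMSEQ_D[of "\<lambda>m. C * \<eta> powr (1 - p) * e m" 0 "r * V / 4"] r Vpos mult_pos_pos[OF r Vpos]
      by (metis divide_pos_pos mult_zero_right zero_less_numeral)
    show "\<exists>M. \<forall>m\<ge>M. norm (v m x - 0) < r"
    proof (intro exI[of _ M] allI impI)
      fix m assume "m \<ge> M"
      then have "C * \<eta> powr (1 - p) * e m < r * V / 4" using M[of m] by simp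
      moreover have "C * \<eta> = r * V / 4" using C by (simp add: \<eta>_def)
      ultimately have "\<bar>v m x\<bar> * V < r * V"
        using main[OF \<eta>, of m] r Vpos mult_pos_pos[OF r Vpos] by linarith
      then show "norm (v m x - 0) < r" using Vpos by simp
    qed
  qed
qed

text \<open>
  The \<open>C\<^sup>1\<close> functions that define the trace converge to \<open>u\<close> at every boundary point, and a subsequence of
  them converges to \<open>g\<close> almost everywhere on the boundary.
\<close>

lemma trace_C1_unique:
  fixes \<Omega> :: "'a::euclidean_space set"
  assumes \<Omega>: "open \<Omega>" "convex \<Omega>" "bounded \<Omega>" "\<Omega> \<noteq> {}" and p: "p > real DIM('a)"
    and u: "C1_with_gradient u \<theta>" and g: "has_trace p \<Omega> u g"
  shows "AE x in boundary_measure \<Omega>. g x = u x"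
proof -
  have p0: "p > 0" using p by (metis le_less_trans of_nat_0_le_iff)
  let ?B = "boundary_measure \<Omega>"
  obtain \<phi> where \<phi>: "\<And>m. \<exists>\<psi>. C1_with_gradient (\<phi> m) \<psi>" "\<And>m. \<phi> m \<in> Lp p ?B"
    "(\<lambda>m. sobolev_norm p \<Omega> (\<lambda>x. \<phi> m x - u x)) \<longlonglongrightarrow> 0"
    "(\<lambda>m. Lp_norm p ?B (\<lambda>x. \<phi> m x - g x)) \<longlonglongrightarrow> 0"
    using g unfolding has_trace_def by blast
  obtain \<psi> where \<psi>: "\<And>m. C1_with_gradient (\<phi> m) (\<psi> m)" using \<phi>(1) by metis
  have gL: "g \<in> Lp p ?B" using g unfolding has_trace_def by blast
  have ptw: "(\<lambda>m. \<phi> m x - u x) \<longlonglongrightarrow> 0" if "x \<in> closure \<Omega>" for x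
    by (rule sobolev_convergence_pointwise[OF \<Omega> that p C1_diff[OF \<psi> u] \<phi>(3)])
  define d where "d m x = \<bar>\<phi> m x - g x\<bar> powr p" for m x
  have di: "integrable ?B (d m)" for m
  proof (rule Bochner_Integration.integrable_bound)
    show "integrable ?B (\<lambda>x. 2 powr p * (norm (\<phi> m x) powr p + norm (g x) powr p))"
      using \<phi>(2)[of m] gL by (auto simp: Lp_def)
    show "d m \<in> borel_measurable ?B"
      using \<phi>(2)[of m] gL unfolding d_def[abs_def] Lp_def by auto
    have "\<bar>s - t\<bar> powr p \<le> 2 powr p * (\<bar>s\<bar> powr p + \<bar>t\<bar> powr p)" for s t :: real
    proof -
      have "\<bar>s - t\<bar> powr p \<le> (2 * max \<bar>s\<bar> \<bar>t\<bar>) powr p" using p0 by (intro powr_mono2) auto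
      also have "\<dots> = 2 powr p * (max \<bar>s\<bar> \<bar>t\<bar>) powr p" by (simp add: powr_mult)
      also have "\<dots> \<le> 2 powr p * (\<bar>s\<bar> powr p + \<bar>t\<bar> powr p)"
        by (intro mult_left_mono) (auto simp: max_def)
      finally show ?thesis .
    qed
    then show "AE x in ?B. norm (d m x) \<le> norm (2 powr p * (norm (\<phi> m x) powr p + norm (g x) powr p))"
      by (intro AE_I2) (auto simp: d_def)
  qed
  have "(\<lambda>m. Lp_norm p ?B (\<lambda>x. \<phi> m x - g x) powr p) \<longlonglongrightarrow> 0 powr p"
  proof (rule tendsto_powr'[OF \<phi>(4) tendsto_const])
    show "(0::real) \<noteq> 0 \<or> 0 < p \<and> (\<forall>\<^sub>F m in sequentially. 0 \<le> Lp_norm p ?B (\<lambda>x. \<phi> m x - g x))"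
      using p0 by (auto simp: Lp_norm_def)
  qed
  moreover have "Lp_norm p ?B (\<lambda>x. \<phi> m x - g x) powr p = (\<integral>x. norm (d m x) \<partial>?B)" for m
  proof -
    have "0 \<le> (\<integral>x. \<bar>\<phi> m x - g x\<bar> powr p \<partial>?B)" by (intro integral_nonneg_AE) auto
    then show ?thesis using p0 by (simp add: Lp_norm_def powr_powr d_def)
  qed
  ultimately have "(\<lambda>m. \<integral>x. norm (d m x) \<partial>?B) \<longlonglongrightarrow> 0" using p0 by simp
  then obtain r where r: "strict_mono r" "AE x in ?B. (\<lambda>m. d (r m) x) \<longlonglongrightarrow> 0"
    using tendsto_L1_AE_subseq[of ?B d, OF di] by blast
  have "AE x in ?B. x \<in> frontier \<Omega>"
    by (rule AE_I2) (simp add: boundary_measure_def space_restrict_space)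
  with r(2) show ?thesis
  proof eventually_elim
    fix x assume d0: "(\<lambda>m. d (r m) x) \<longlonglongrightarrow> 0" and x: "x \<in> frontier \<Omega>"
    have "x \<in> closure \<Omega>" using x by (simp add: frontier_def)
    then have "(\<lambda>m. \<phi> (r m) x - u x) \<longlonglongrightarrow> 0"
      using LIMSEQ_subseq_LIMSEQ[OF ptw r(1)] by (simp add: comp_def)
    then have "(\<lambda>m. (\<phi> (r m) x - u x) + (u x - g x)) \<longlonglongrightarrow> 0 + (u x - g x)"
      by (intro tendsto_intros)
    then have "(\<lambda>m. \<bar>\<phi> (r m) x - g x\<bar> powr p) \<longlonglongrightarrow> \<bar>u x - g x\<bar> powr p"
      using p0 by (intro tendsto_powr' tendsto_rabs) auto
    then have "\<bar>u x - g x\<bar> powr p = 0"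
      using LIMSEQ_unique d0 unfolding d_def by blast
    then show "g x = u x" by simp
  qed
qed

lemma trace_C1:
  fixes \<Omega> :: "'a::euclidean_space set"
  assumes \<Omega>: "open \<Omega>" "convex \<Omega>" "bounded \<Omega>" "\<Omega> \<noteq> {}" and p: "p > real DIM('a)"
    and u: "C1_with_gradient u \<theta>" and uB: "u \<in> Lp p (boundary_measure \<Omega>)"
  shows "(\<integral>x. \<bar>trace_on_boundary p \<Omega> u x\<bar> powr p \<partial>boundary_measure \<Omega>) = (\<integral>x. \<bar>u x\<bar> powr p \<partial>boundary_measure \<Omega>)"
proof -
  have p0: "p > 0" using p by (metis le_less_trans of_nat_0_le_iff)
  have "has_trace p \<Omega> u u"
    unfolding has_trace_def
  proof (intro conjI exI[of _ "\<lambda>_. u"] allI)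
    have "sobolev_norm p \<Omega> (\<lambda>x. u x - u x) = 0"
      using sobolev_norm_C1[OF C1_const \<Omega>(1), of p 0] p0 by simp
    then show "(\<lambda>m. sobolev_norm p \<Omega> (\<lambda>x. u x - u x)) \<longlonglongrightarrow> 0" by simp
    show "(\<lambda>m. Lp_norm p (boundary_measure \<Omega>) (\<lambda>x. u x - u x)) \<longlonglongrightarrow> 0"
      using p0 by (simp add: Lp_norm_def)
  qed (use C1_in_sobolev[OF \<Omega>(1,3) u p0] uB u in auto)
  then have t: "has_trace p \<Omega> u (trace_on_boundary p \<Omega> u)"
    unfolding trace_on_boundary_def by (rule someI[of "has_trace p \<Omega> u"])
  then have m: "trace_on_boundary p \<Omega> u \<in> borel_measurable (boundary_measure \<Omega>)"
    by (auto simp: has_trace_def Lp_def)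
  have ae: "AE x in boundary_measure \<Omega>. trace_on_boundary p \<Omega> u x = u x"
    by (rule trace_C1_unique[OF \<Omega> p u t])
  show ?thesis
    using m uB ae by (intro integral_cong_AE) (auto simp: Lp_def elim: eventually_mono)
qed

section \<open>Hausdorff measure\<close>

locale metric_outer_measure =
  fixes \<mu> :: "'a::metric_space set \<Rightarrow> ennreal"
  assumes empty: "\<mu> {} = 0"
    and mono: "\<And>A B. A \<subseteq> B \<Longrightarrow> \<mu> A \<le> \<mu> B"
    and countable_subadditive: "\<And>A. \<mu> (\<Union>i::nat. A i) \<le> (\<Sum>i. \<mu> (A i))"
    and separated: "\<And>A B e. 0 < e \<Longrightarrow> (\<And>x y. x \<in> A \<Longrightarrow> y \<in> B \<Longrightarrow> e \<le> dist x y) \<Longrightarrow> \<mu> A + \<mu> B \<le> \<mu> (A \<union> B)"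
begin

lemma subadditive: "\<mu> (A \<union> B) \<le> \<mu> A + \<mu> B"
proof -
  have "\<mu> (A \<union> B) = \<mu> (\<Union>i. binaryset A B i)" by (simp add: UN_binaryset_eq)
  also have "\<dots> \<le> (\<Sum>i. \<mu> (binaryset A B i))" by (rule countable_subadditive)
  also have "\<dots> = \<mu> A + \<mu> B" by (rule suminf_binaryset_eq[where f=\<mu>, OF empty])
  finally show ?thesis .
qed

lemma separated_shells:
  assumes gap: "\<And>j k x y. j < k \<Longrightarrow> x \<in> R j \<Longrightarrow> y \<in> R k \<Longrightarrow> e k \<le> dist x y" and e: "\<And>k. 0 < e k"
  shows "(\<Sum>k<m::nat. \<mu> (R k)) \<le> \<mu> (\<Union>k<m. R k)"
proof (induction m)
  case 0
  then show ?case by simp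
next
  case (Suc m)
  have "(\<Sum>k<Suc m. \<mu> (R k)) \<le> \<mu> (\<Union>k<m. R k) + \<mu> (R m)"
    using Suc by (simp add: add_right_mono)
  also have "\<dots> \<le> \<mu> ((\<Union>k<m. R k) \<union> R m)"
    by (rule separated[OF e[of m]]) (use gap in auto)
  also have "(\<Union>k<m. R k) \<union> R m = (\<Union>k<Suc m. R k)" by (auto simp: less_Suc_eq)
  finally show ?case .
qed

text \<open>
  Let \<open>An n\<close> be the part of \<open>A\<close> at distance at least \<open>h n\<close> from \<open>F\<close>, and \<open>R n\<close> the shell between \<open>An n\<close> and
  \<open>An (Suc n)\<close>. Shells whose indices differ by at least two are separated, so the masses of all shells with
  indices of one parity add up to at most \<open>\<mu> A\<close>. Hence the tails of the sum over all shells tend to zero,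
  and \<open>A - F\<close> may be replaced by \<open>An n\<close>, which is separated from \<open>A \<inter> F\<close>.
\<close>

lemma closed_splits:
  assumes F: "closed F"
  shows "\<mu> (A \<inter> F) + \<mu> (A - F) \<le> \<mu> A"
proof (cases "F = {} \<or> \<mu> A = \<infinity>")
  case True
  then show ?thesis by (auto simp: empty)
next
  case False
  then have ne: "F \<noteq> {}" and fin: "\<mu> A \<noteq> \<infinity>" by auto
  define h where "h n = 1 / real (Suc n)" for n
  have h: "0 < h n" for n by (simp add: h_def)
  have hdec: "h n < h m" if "m < n" for m n using that by (simp add: h_def frac_less2)
  define An where "An n = {x\<in>A. h n \<le> infdist x F}" for n
  define R where "R n = {x\<in>A. h (Suc n) \<le> infdist x F \<and> infdist x F < h n}" for n
  have infd: "infdist x F - infdist y F \<le> dist x y" for x y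
    using infdist_triangle[of x F y] by simp
  have alternate: "(\<Sum>k<m. \<mu> (R (2 * k + i))) \<le> \<mu> A" for m i
  proof -
    have "(\<Sum>k<m. \<mu> (R (2 * k + i))) \<le> \<mu> (\<Union>k<m. R (2 * k + i))"
    proof (rule separated_shells)
      fix j k :: nat and x y assume jk: "j < k" and x: "x \<in> R (2 * j + i)" and y: "y \<in> R (2 * k + i)"
      have "h (2 * k + i - 1) \<le> h (Suc (2 * j + i))"
        using jk by (auto simp: h_def intro!: frac_le)
      \<comment> \<open>The last summand keeps the gap positive for \<open>k = 0\<close>, where \<open>2 * k + i - 1\<close> may be truncated.\<close>
      then show "h (2 * k + i - 1) - h (2 * k + i) + (if k = 0 then 1 else 0) \<le> dist x y"
        using x y infd[of x y] jk by (auto simp: R_def)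
    next
      fix k :: nat
      show "0 < h (2 * k + i - 1) - h (2 * k + i) + (if k = 0 then 1 else 0)"
        using hdec[of "2 * k + i - 1" "2 * k + i"] by (cases "k = 0"; cases i) (auto simp: h_def)
    qed
    also have "\<dots> \<le> \<mu> A" by (intro mono) (auto simp: R_def)
    finally show ?thesis .
  qed
  have "(\<Sum>k<2 * m. \<mu> (R k)) \<le> \<mu> A + \<mu> A" for m
  proof -
    have "(\<Sum>k<2 * m. \<mu> (R k)) = (\<Sum>k<m. \<mu> (R (2 * k + 0))) + (\<Sum>k<m. \<mu> (R (2 * k + 1)))"
      by (induction m) (auto simp: ac_simps)
    then show ?thesis using alternate[of 0 m] alternate[of 1 m] by (simp add: add_mono)
  qed
  moreover have "(\<Sum>k<m. \<mu> (R k)) \<le> (\<Sum>k<2 * m. \<mu> (R k))" for m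
    by (intro sum_mono2) auto
  ultimately have "(\<Sum>k<m. \<mu> (R k)) \<le> \<mu> A + \<mu> A" for m
    using order_trans by blast
  then have "(\<Sum>k. \<mu> (R k)) \<le> \<mu> A + \<mu> A"
    using ennreal_suminf_bound_add[of "\<lambda>k. \<mu> (R k)" 0] by simp
  then have Rfin: "(\<Sum>k. \<mu> (R k)) \<noteq> top"
    using fin by (auto simp: top_unique)
  have cover: "A - F \<subseteq> An n \<union> (\<Union>k. R (k + n))" for n
  proof
    fix x assume x: "x \<in> A - F"
    show "x \<in> An n \<union> (\<Union>k. R (k + n))"
    proof (cases "h n \<le> infdist x F")
      case True
      then show ?thesis using x by (simp add: An_def)
    next
      case False
      have "infdist x F > 0"
        using x F ne in_closed_iff_infdist_zero[of F x] infdist_nonneg[of x F] by force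
      then obtain N where N: "h N < infdist x F"
        unfolding h_def by (rule nat_approx_posE)
      define M where "M = (LEAST M. h M \<le> infdist x F)"
      have M: "h M \<le> infdist x F" unfolding M_def by (rule LeastI[of "\<lambda>M. h M \<le> infdist x F" N]) (use N in simp)
      have Mn: "M > n"
      proof (rule ccontr)
        assume "\<not> M > n"
        then have "h n \<le> h M" using hdec[of M n] by (cases "M = n") auto
        then show False using M False by simp
      qed
      then obtain k where k: "M = Suc (k + n)" using less_imp_Suc_add[of n M] by (auto simp: add.commute)
      have "\<not> h (k + n) \<le> infdist x F"
        using not_less_Least[of "k + n" "\<lambda>M. h M \<le> infdist x F"] k by (simp add: M_def[symmetric])
      then have "x \<in> R (k + n)" using x M k by (simp add: R_def)
      then show ?thesis by blast
    qed
  qed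
  define r where "r k = enn2real (\<mu> (R k))" for k
  have Rk: "\<mu> (R k) = ennreal (r k)" for k
    unfolding r_def using ennreal_suminf_lessD[of "\<lambda>k. \<mu> (R k)" top k] Rfin
    by (simp add: less_top[symmetric] ennreal_enn2real_if)
  have r0: "0 \<le> r k" for k by (simp add: r_def)
  have sr: "summable r"
    by (rule summable_suminf_not_top[OF r0 Rfin[unfolded Rk]])
  have step: "\<mu> (A \<inter> F) + \<mu> (A - F) \<le> \<mu> A + ennreal (\<Sum>k. r (k + n))" for n
  proof -
    have "\<mu> (A - F) \<le> \<mu> (An n \<union> (\<Union>k. R (k + n)))" by (rule mono[OF cover])
    also have "\<dots> \<le> \<mu> (An n) + \<mu> (\<Union>k. R (k + n))" by (rule subadditive)
    also have "\<dots> \<le> \<mu> (An n) + (\<Sum>k. \<mu> (R (k + n)))" by (intro add_left_mono countable_subadditive)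
    also have "(\<Sum>k. \<mu> (R (k + n))) = ennreal (\<Sum>k. r (k + n))"
      unfolding Rk using sr r0 by (intro suminf_ennreal2) (auto simp: summable_iff_shift)
    finally have "\<mu> (A \<inter> F) + \<mu> (A - F) \<le> (\<mu> (A \<inter> F) + \<mu> (An n)) + ennreal (\<Sum>k. r (k + n))"
      by (simp add: add_left_mono add.assoc)
    also have "\<mu> (A \<inter> F) + \<mu> (An n) \<le> \<mu> ((A \<inter> F) \<union> An n)"
    proof (rule separated[OF h[of n]])
      fix x y assume "x \<in> A \<inter> F" "y \<in> An n"
      then have "h n \<le> infdist y F" "x \<in> F" by (auto simp: An_def)
      then show "h n \<le> dist x y" using infdist_le[of x F y] by (simp add: dist_commute)
    qed
    also have "\<mu> ((A \<inter> F) \<union> An n) \<le> \<mu> A" by (intro mono) (auto simp: An_def)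
    finally show ?thesis by (simp add: add_right_mono)
  qed
  have "(\<lambda>n. \<mu> A + ennreal (\<Sum>k. r (k + n))) \<longlonglongrightarrow> \<mu> A + ennreal 0"
    by (intro tendsto_add tendsto_const tendsto_ennrealI suminf_exist_split2 sr)
  then show ?thesis
    using step by (intro LIMSEQ_le_const[of "\<lambda>n. \<mu> A + ennreal (\<Sum>k. r (k + n))"]) auto
qed

lemma measure_space_borel: "measure_space UNIV (sets borel) \<mu>"
proof -
  interpret P: sigma_algebra "UNIV :: 'a set" "UNIV :: 'a set set"
    using sigma_algebra_Pow[of "UNIV :: 'a set"] by simp
  let ?L = "lambda_system UNIV UNIV \<mu>"
  have "outer_measure_space UNIV \<mu>"
    unfolding outer_measure_space_def positive_def increasing_def countably_subadditive_def
    using empty mono countable_subadditive by auto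
  then have ms: "measure_space UNIV ?L \<mu>" by (rule P.caratheodory_lemma)
  then interpret L: sigma_algebra UNIV ?L by (simp add: measure_space_def)
  have "F \<in> ?L" if "closed F" for F
    unfolding P.lambda_system_eq
  proof (intro CollectI conjI ballI antisym)
    fix A
    show "\<mu> (A \<inter> F) + \<mu> (A - F) \<le> \<mu> A" by (rule closed_splits[OF that])
    show "\<mu> A \<le> \<mu> (A \<inter> F) + \<mu> (A - F)"
      using subadditive[of "A \<inter> F" "A - F"] by (simp add: Int_Diff_Un)
  qed simp
  then have "sigma_sets UNIV (Collect closed) \<subseteq> ?L"
    by (intro L.sigma_sets_subset) auto
  then have "sets borel \<subseteq> ?L" by (simp add: borel_eq_closed)
  moreover have "sigma_algebra UNIV (sets (borel :: 'a measure))"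
    using sets.sigma_algebra_axioms[of "borel :: 'a measure"] by simp
  ultimately show ?thesis using measure_down[OF ms] by blast
qed

end

lemma hausdorff_weight_empty [simp]: "hausdorff_weight s {} = 0"
  by (simp add: hausdorff_weight_def)

lemma hausdorff_content_le:
  assumes "A \<subseteq> (\<Union>j. C j)" "\<And>j. bounded (C j)" "\<And>j. diameter (C j) \<le> \<delta>"
  shows "hausdorff_content s \<delta> A \<le> (\<Sum>j. hausdorff_weight s (C j))"
  unfolding hausdorff_content_def using assms by (intro INF_lower) auto

lemma hausdorff_content_mono: "A \<subseteq> B \<Longrightarrow> hausdorff_content s \<delta> A \<le> hausdorff_content s \<delta> B"
  unfolding hausdorff_content_def by (intro INF_superset_mono) auto

lemma hausdorff_content_antimono: "\<delta> \<le> \<epsilon> \<Longrightarrow> hausdorff_content s \<epsilon> A \<le> hausdorff_content s \<delta> A"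
  unfolding hausdorff_content_def by (intro INF_superset_mono) (auto intro: order_trans)

lemma hausdorff_content_countable_subadditive:
  fixes A :: "nat \<Rightarrow> 'a::euclidean_space set"
  shows "hausdorff_content s \<delta> (\<Union>i. A i) \<le> (\<Sum>i. hausdorff_content s \<delta> (A i))"
proof (rule ennreal_le_epsilon)
  fix e :: real assume e: "0 < e" and "(\<Sum>i. hausdorff_content s \<delta> (A i)) < top"
  then have fin: "hausdorff_content s \<delta> (A i) \<noteq> \<infinity>" for i
    using ennreal_suminf_lessD[of "\<lambda>i. hausdorff_content s \<delta> (A i)" top i] by (simp add: less_top)
  have "\<exists>C. A i \<subseteq> (\<Union>j::nat. C j) \<and> (\<forall>j. bounded (C j) \<and> diameter (C j) \<le> \<delta>) \<and>
      (\<Sum>j. hausdorff_weight s (C j)) < hausdorff_content s \<delta> (A i) + ennreal (e * (1/2) ^ Suc i)" for i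
    using INF_approx_ennreal[OF _ hausdorff_content_def fin[of i], of "e * (1/2) ^ Suc i"] e by auto
  then obtain C where C: "\<And>i. A i \<subseteq> (\<Union>j::nat. C i j)" "\<And>i j. bounded (C i j)" "\<And>i j. diameter (C i j) \<le> \<delta>"
     "\<And>i. (\<Sum>j. hausdorff_weight s (C i j)) < hausdorff_content s \<delta> (A i) + ennreal (e * (1/2) ^ Suc i)"
    by metis
  define D where "D k = (case prod_decode k of (i, j) \<Rightarrow> C i j)" for k
  have "hausdorff_content s \<delta> (\<Union>i. A i) \<le> (\<Sum>k. hausdorff_weight s (D k))"
  proof (rule hausdorff_content_le)
    show "(\<Union>i. A i) \<subseteq> (\<Union>k. D k)"
    proof
      fix x assume "x \<in> (\<Union>i. A i)"
      then obtain i j where "x \<in> C i j" using C(1) by blast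
      then have "x \<in> D (prod_encode (i, j))" by (simp add: D_def)
      then show "x \<in> (\<Union>k. D k)" by blast
    qed
  qed (auto simp: D_def C split: prod.splits)
  also have "\<dots> = (\<Sum>i. \<Sum>j. hausdorff_weight s (C i j))"
    using suminf_ennreal_2dimen[of "\<lambda>i. \<Sum>j. hausdorff_weight s (C i j)" "\<lambda>(i, j). hausdorff_weight s (C i j)"]
    by (simp add: D_def split_beta)
  also have "\<dots> \<le> (\<Sum>i. hausdorff_content s \<delta> (A i) + ennreal (e * (1/2) ^ Suc i))"
    using C(4) by (intro suminf_le) (auto intro: less_imp_le)
  also have "\<dots> = (\<Sum>i. hausdorff_content s \<delta> (A i)) + (\<Sum>i. ennreal (e * (1/2) ^ Suc i))"
    by (intro suminf_add[symmetric]) auto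
  also have "(\<Sum>i. ennreal (e * (1/2) ^ Suc i)) = ennreal e"
  proof -
    have "(\<lambda>i. e * (1/2) ^ Suc i) sums (e * 1)" by (intro sums_mult power_half_series)
    then show ?thesis using e by (intro sums_unique[symmetric] sums_ennreal[THEN iffD2]) auto
  qed
  finally show "hausdorff_content s \<delta> (\<Union>i. A i) \<le> (\<Sum>i. hausdorff_content s \<delta> (A i)) + ennreal e" .
qed

text \<open>
  A covering set of diameter less than \<open>e\<close> meets only one of \<open>A\<close> and \<open>B\<close>.
\<close>

lemma hausdorff_content_separated:
  assumes e: "\<And>x y. x \<in> A \<Longrightarrow> y \<in> B \<Longrightarrow> e \<le> dist x y" and d: "\<delta> < e" "0 < \<delta>"
  shows "hausdorff_content s \<delta> A + hausdorff_content s \<delta> B \<le> hausdorff_content s \<delta> (A \<union> B)"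
  unfolding hausdorff_content_def[of s \<delta> "A \<union> B"]
proof (rule INF_greatest)
  fix C :: "nat \<Rightarrow> 'a set" assume "C \<in> {C. A \<union> B \<subseteq> (\<Union>j. C j) \<and> (\<forall>j. bounded (C j) \<and> diameter (C j) \<le> \<delta>)}"
  then have C: "A \<union> B \<subseteq> (\<Union>j. C j)" "\<And>j. bounded (C j)" "\<And>j. diameter (C j) \<le> \<delta>" by auto
  define CA where "CA j = (if C j \<inter> A = {} then {} else C j)" for j
  define CB where "CB j = (if C j \<inter> B = {} then {} else C j)" for j
  have "hausdorff_content s \<delta> A \<le> (\<Sum>j. hausdorff_weight s (CA j))"
  proof (rule hausdorff_content_le)
    show "A \<subseteq> (\<Union>j. CA j)" using C(1) by (fastforce simp: CA_def)
  qed (use C d in \<open>auto simp: CA_def\<close>)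
  moreover have "hausdorff_content s \<delta> B \<le> (\<Sum>j. hausdorff_weight s (CB j))"
  proof (rule hausdorff_content_le)
    show "B \<subseteq> (\<Union>j. CB j)" using C(1) by (fastforce simp: CB_def)
  qed (use C d in \<open>auto simp: CB_def\<close>)
  ultimately have "hausdorff_content s \<delta> A + hausdorff_content s \<delta> B
     \<le> (\<Sum>j. hausdorff_weight s (CA j)) + (\<Sum>j. hausdorff_weight s (CB j))"
    by (rule add_mono)
  also have "\<dots> = (\<Sum>j. hausdorff_weight s (CA j) + hausdorff_weight s (CB j))"
    by (intro suminf_add) auto
  also have "\<dots> \<le> (\<Sum>j. hausdorff_weight s (C j))"
  proof (intro suminf_le)
    fix j
    have "C j \<inter> A = {} \<or> C j \<inter> B = {}"
    proof (rule ccontr)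
      assume "\<not> ?thesis"
      then obtain x y where xy: "x \<in> C j" "x \<in> A" "y \<in> C j" "y \<in> B" by blast
      then have "dist x y \<le> \<delta>" using diameter_bounded_bound[OF C(2) xy(1,3)] C(3)[of j] by simp
      then show False using e[OF xy(2,4)] d by simp
    qed
    then show "hausdorff_weight s (CA j) + hausdorff_weight s (CB j) \<le> hausdorff_weight s (C j)"
      by (auto simp: CA_def CB_def)
  qed auto
  finally show "hausdorff_content s \<delta> A + hausdorff_content s \<delta> B \<le> (\<Sum>j. hausdorff_weight s (C j))" .
qed

lemma hausdorff_content_le_outer: "0 < \<delta> \<Longrightarrow> hausdorff_content s \<delta> A \<le> hausdorff_outer_measure s A"
  unfolding hausdorff_outer_measure_def by (intro SUP_upper) auto

interpretation hausdorff: metric_outer_measure "hausdorff_outer_measure s :: 'a::euclidean_space set \<Rightarrow> ennreal"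
proof
  show "hausdorff_outer_measure s ({} :: 'a set) = 0"
  proof -
    have "hausdorff_content s \<delta> ({} :: 'a set) = 0" if "0 < \<delta>" for \<delta>
      using hausdorff_content_le[of "{} :: 'a set" "\<lambda>_. {}" \<delta> s] that by simp
    then show ?thesis unfolding hausdorff_outer_measure_def
      by (metis (no_types, lifting) SUP_bot bot_ennreal SUP_cong greaterThan_iff)
  qed
  show "hausdorff_outer_measure s A \<le> hausdorff_outer_measure s B" if "A \<subseteq> B" for A B :: "'a set"
    unfolding hausdorff_outer_measure_def using that by (intro SUP_mono) (auto intro: hausdorff_content_mono)
  show "hausdorff_outer_measure s (\<Union>i. A i) \<le> (\<Sum>i. hausdorff_outer_measure s (A i))" for A :: "nat \<Rightarrow> 'a set"
    unfolding hausdorff_outer_measure_def[of s "\<Union>i. A i"]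
  proof (rule SUP_least)
    fix \<delta> :: real assume "\<delta> \<in> {0<..}"
    then have "(\<Sum>i. hausdorff_content s \<delta> (A i)) \<le> (\<Sum>i. hausdorff_outer_measure s (A i))"
      by (intro suminf_le) (auto intro: hausdorff_content_le_outer)
    then show "hausdorff_content s \<delta> (\<Union>i. A i) \<le> (\<Sum>i. hausdorff_outer_measure s (A i))"
      using hausdorff_content_countable_subadditive order_trans by blast
  qed
  show "hausdorff_outer_measure s A + hausdorff_outer_measure s B \<le> hausdorff_outer_measure s (A \<union> B)"
    if e: "0 < e" and d: "\<And>x y. x \<in> A \<Longrightarrow> y \<in> B \<Longrightarrow> e \<le> dist x y" for e and A B :: "'a set"
  proof -
    have "hausdorff_outer_measure s A + hausdorff_outer_measure s B
       = (SUP \<delta>\<in>{0<..}. hausdorff_content s \<delta> A + hausdorff_content s \<delta> B)"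
      unfolding hausdorff_outer_measure_def
    proof (rule SUP_add_directed_ennreal[symmetric])
      fix i j :: real assume ij: "i \<in> {0<..}" "j \<in> {0<..}"
      show "\<exists>k\<in>{0<..}. hausdorff_content s i A + hausdorff_content s j B \<le> hausdorff_content s k A + hausdorff_content s k B"
        using ij by (intro bexI[of _ "min i j"] add_mono hausdorff_content_antimono) auto
    qed
    also have "\<dots> \<le> hausdorff_outer_measure s (A \<union> B)"
    proof (rule SUP_least)
      fix \<delta> :: real assume \<delta>: "\<delta> \<in> {0<..}"
      define \<epsilon> where "\<epsilon> = min \<delta> (e / 2)"
      have \<epsilon>: "0 < \<epsilon>" "\<epsilon> < e" "\<epsilon> \<le> \<delta>" using \<delta> e by (auto simp: \<epsilon>_def)
      have "hausdorff_content s \<delta> A + hausdorff_content s \<delta> B \<le> hausdorff_content s \<epsilon> A + hausdorff_content s \<epsilon> B"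
        by (intro add_mono hausdorff_content_antimono \<epsilon>)
      also have "\<dots> \<le> hausdorff_content s \<epsilon> (A \<union> B)"
        by (rule hausdorff_content_separated[OF d \<epsilon>(2,1)])
      also have "\<dots> \<le> hausdorff_outer_measure s (A \<union> B)"
        by (rule hausdorff_content_le_outer[OF \<epsilon>(1)])
      finally show "hausdorff_content s \<delta> A + hausdorff_content s \<delta> B \<le> hausdorff_outer_measure s (A \<union> B)" .
    qed
    finally show ?thesis .
  qed
qed

lemma sets_hausdorff_measure [simp, measurable_cong]: "sets (hausdorff_measure s) = sets borel"
  unfolding hausdorff_measure_def using sets.sigma_sets_eq[of "borel :: 'a measure"] by (simp add: sets_measure_of_conv)

lemma space_hausdorff_measure [simp]: "space (hausdorff_measure s) = UNIV"
  by (simp add: hausdorff_measure_def space_measure_of_conv)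

lemma emeasure_hausdorff_measure:
  assumes "A \<in> sets borel"
  shows "emeasure (hausdorff_measure s) A = hausdorff_outer_measure s A"
  unfolding hausdorff_measure_def
  using hausdorff.measure_space_borel[of s] assms
  by (intro emeasure_measure_of_sigma) (auto simp: measure_space_def)

section \<open>Boundary area and volume of convex domains in balls\<close>

lemma outer_normal_exists:
  fixes \<Omega> :: "'a::euclidean_space set"
  assumes \<Omega>: "convex \<Omega>" "\<Omega> \<noteq> {}" and y: "y \<notin> \<Omega>"
  shows "\<exists>\<nu>. norm \<nu> = 1 \<and> (\<forall>w\<in>closure \<Omega>. \<nu> \<bullet> w \<le> \<nu> \<bullet> y)"
proof -
  obtain a b where a: "a \<noteq> 0" "\<And>x. x \<in> \<Omega> \<Longrightarrow> a \<bullet> x \<le> b" "b \<le> a \<bullet> y"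
    using separating_hyperplane_sets[of \<Omega> "{y}"] assms by auto
  define \<nu> where "\<nu> = a /\<^sub>R norm a"
  have n: "norm \<nu> = 1" using a(1) by (simp add: \<nu>_def)
  have "\<Omega> \<subseteq> {w. \<nu> \<bullet> w \<le> \<nu> \<bullet> y}"
  proof
    fix w assume "w \<in> \<Omega>"
    then have "a \<bullet> w \<le> a \<bullet> y" using a by force
    then show "w \<in> {w. \<nu> \<bullet> w \<le> \<nu> \<bullet> y}" using a(1) by (simp add: \<nu>_def divide_right_mono)
  qed
  then have "closure \<Omega> \<subseteq> {w. \<nu> \<bullet> w \<le> \<nu> \<bullet> y}"
    by (rule closure_minimal) (rule closed_halfspace_le)
  then show ?thesis using n by blast
qed

text \<open>
  Start at a boundary point and follow an outer normal until it leaves \<open>Q\<close>; the nearest point of the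
  closure of \<open>\<Omega>\<close> is still the starting point.
\<close>

lemma frontier_subset_projection:
  fixes \<Omega> :: "'a::euclidean_space set"
  assumes \<Omega>: "open \<Omega>" "convex \<Omega>" "\<Omega> \<noteq> {}" and Q: "bounded Q"
  shows "frontier \<Omega> \<inter> interior Q \<subseteq> closest_point (closure \<Omega>) ` frontier Q"
proof
  fix y assume y: "y \<in> frontier \<Omega> \<inter> interior Q"
  then have yc: "y \<in> closure \<Omega>" and "y \<notin> \<Omega>" using \<Omega>(1) by (auto simp: frontier_def interior_open)
  then obtain \<nu> where \<nu>: "norm \<nu> = 1" "\<And>w. w \<in> closure \<Omega> \<Longrightarrow> \<nu> \<bullet> w \<le> \<nu> \<bullet> y"
    using outer_normal_exists[OF \<Omega>(2,3)] by blast
  obtain d where d: "0 < d" "y + d *\<^sub>R \<nu> \<in> frontier Q"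
    using ray_to_frontier[OF Q, of y \<nu>] y \<nu>(1) by force
  have "y = closest_point (closure \<Omega>) (y + d *\<^sub>R \<nu>)"
  proof (rule closest_point_unique)
    show "\<forall>w\<in>closure \<Omega>. dist (y + d *\<^sub>R \<nu>) y \<le> dist (y + d *\<^sub>R \<nu>) w"
    proof
      fix w assume "w \<in> closure \<Omega>"
      then have "0 \<le> \<nu> \<bullet> (y - w)" using \<nu>(2) by (simp add: inner_diff_right)
      then have "d \<le> \<nu> \<bullet> (y + d *\<^sub>R \<nu> - w)"
        using \<nu>(1) by (simp add: inner_diff_right inner_add_right norm_eq_1)
      also have "\<dots> \<le> norm \<nu> * norm (y + d *\<^sub>R \<nu> - w)" by (rule norm_cauchy_schwarz)
      finally show "dist (y + d *\<^sub>R \<nu>) y \<le> dist (y + d *\<^sub>R \<nu>) w"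
        using \<nu>(1) d(1) by (simp add: dist_norm)
    qed
  qed (use yc \<Omega> in \<open>auto intro: convex_closure\<close>)
  then show "y \<in> closest_point (closure \<Omega>) ` frontier Q" using d(2) by blast
qed

lemma hausdorff_content_finite_cover:
  fixes C :: "'i \<Rightarrow> 'a::euclidean_space set"
  assumes J: "finite J" and cover: "A \<subseteq> (\<Union>j\<in>J. C j)"
    and diam: "\<And>j x y. j \<in> J \<Longrightarrow> x \<in> C j \<Longrightarrow> y \<in> C j \<Longrightarrow> dist x y \<le> d" and d: "0 \<le> d" "d \<le> \<delta>"
  shows "hausdorff_content s \<delta> A \<le> ennreal (real (card J) * (unit_ball_vol (real s) * (d / 2) ^ s))"
proof -
  obtain f where f: "bij_betw f {..<card J} J" using ex_bij_betw_nat_finite[OF J] by (auto simp: atLeast0LessThan)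
  define D where "D k = (if k < card J then C (f k) else {})" for k
  have fJ: "f k \<in> J" if "k < card J" for k using f that by (auto simp: bij_betw_def)
  have Dd: "dist x y \<le> d" if "x \<in> D k" "y \<in> D k" for x y k
    using that diam[OF fJ] by (auto simp: D_def split: if_splits)
  have diamD: "diameter (D k) \<le> d" for k
    using Dd d(1) by (intro diameter_le) (auto simp: dist_norm)
  have bD: "bounded (D k)" for k
    using Dd unfolding bounded_def by blast
  have "hausdorff_content s \<delta> A \<le> (\<Sum>k. hausdorff_weight s (D k))"
  proof (rule hausdorff_content_le)
    show "A \<subseteq> (\<Union>k. D k)"
    proof
      fix x assume "x \<in> A"
      then obtain j where j: "j \<in> J" "x \<in> C j" using cover by blast
      have "j \<in> f ` {..<card J}" using bij_betw_imp_surj_on[OF f] j(1) by simp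
      then obtain k where "k \<in> {..<card J}" "j = f k" by (rule imageE)
      then have "x \<in> D k" using j(2) by (simp add: D_def)
      then show "x \<in> (\<Union>k. D k)" by blast
    qed
    show "diameter (D k) \<le> \<delta>" for k using diamD[of k] d(2) by linarith
  qed (rule bD)
  also have "\<dots> = (\<Sum>k<card J. hausdorff_weight s (D k))"
    by (intro suminf_finite) (auto simp: D_def)
  also have "\<dots> \<le> (\<Sum>k<card J. ennreal (unit_ball_vol (real s) * (d / 2) ^ s))"
  proof (intro sum_mono)
    fix k
    have "unit_ball_vol (real s) * (diameter (D k) / 2) ^ s \<le> unit_ball_vol (real s) * (d / 2) ^ s"
      using diamD[of k] diameter_ge_0[OF bD[of k]] by (intro mult_left_mono power_mono) auto
    then show "hausdorff_weight s (D k) \<le> ennreal (unit_ball_vol (real s) * (d / 2) ^ s)"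
      by (simp add: hausdorff_weight_def ennreal_leI)
  qed
  also have "\<dots> = ennreal (real (card J) * (unit_ball_vol (real s) * (d / 2) ^ s))"
    using d by (simp add: ennreal_of_nat_eq_real_of_nat ennreal_mult)
  finally show ?thesis .
qed

lemma grid_index:
  fixes \<tau> :: real
  assumes "0 \<le> \<tau>" "\<tau> \<le> real N" "0 < N"
  shows "\<exists>m<N. real m \<le> \<tau> \<and> \<tau> \<le> real m + 1"
proof (cases "\<tau> = real N")
  case True
  then show ?thesis using assms by (intro exI[of _ "N - 1"]) (auto simp: of_nat_diff)
next
  case False
  have "real (nat \<lfloor>\<tau>\<rfloor>) \<le> \<tau>" "\<tau> \<le> real (nat \<lfloor>\<tau>\<rfloor>) + 1"
    using assms(1) by (simp_all add: of_nat_nat) 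
  moreover from this have "nat \<lfloor>\<tau>\<rfloor> < N" using False assms by linarith
  ultimately show ?thesis by blast
qed

text \<open>
  The constant that results from cutting the \<open>2 n\<close> faces of a cube into small cells.
\<close>

definition frontier_density :: "nat \<Rightarrow> real" where
  "frontier_density n = 2 * real n * unit_ball_vol (real (n - 1)) * real n ^ (n - 1)"

lemma frontier_density_pos: "0 < n \<Longrightarrow> 0 < frontier_density n"
  by (auto simp: frontier_density_def intro!: mult_pos_pos)

text \<open>
  The surface of the cube of edge \<open>2 R\<close> around the ball consists of \<open>2 n N ^ (n - 1)\<close> cells of diameter at
  most \<open>2 n R / N\<close>. Their nearest-point projections cover the boundary in the ball and are no wider. As the
  number \<open>N\<close> cancels, the bound persists for coverings by arbitrarily small sets.
\<close>

lemma hausdorff_frontier_ball_le: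
  fixes \<Omega> :: "'a::euclidean_space set"
  assumes \<Omega>: "open \<Omega>" "convex \<Omega>" "\<Omega> \<noteq> {}" and R: "0 < R" and n: "DIM('a) \<ge> 2"
  shows "hausdorff_outer_measure (DIM('a) - 1) (frontier \<Omega> \<inter> ball x R)
    \<le> ennreal (frontier_density DIM('a) * R ^ (DIM('a) - 1))"
  unfolding hausdorff_outer_measure_def
proof (rule SUP_least)
  let ?n = "DIM('a)" and ?s = "DIM('a) - 1"
  fix \<delta> :: real assume "\<delta> \<in> {0<..}"
  then have \<delta>: "\<delta> > 0" by simp
  obtain N :: nat where N: "real N > 2 * real ?n * R / \<delta>" "N > 0"
    using reals_Archimedean2[of "max 0 (2 * real ?n * R / \<delta>)"] by auto
  define d where "d = 2 * real ?n * R / real N"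
  have d: "0 \<le> d" "d \<le> \<delta>" using N R \<delta> by (auto simp: d_def field_simps)
  define Q where "Q = cbox (x - R *\<^sub>R One) (x + R *\<^sub>R One)"
  define P where "P = closest_point (closure \<Omega>)"
  define J where "J = (SIGMA i:(Basis::'a set). (UNIV :: bool set) \<times> (Pi\<^sub>E (Basis - {i}) (\<lambda>_. {..<N})))"
  define cell where "cell = (\<lambda>(i, b, g). {z::'a. z \<bullet> i = x \<bullet> i + (if b then R else - R) \<and>
     (\<forall>j\<in>Basis - {i}. x \<bullet> j - R + 2 * R * real (g j) / real N \<le> z \<bullet> j \<and> z \<bullet> j \<le> x \<bullet> j - R + 2 * R * (real (g j) + 1) / real N)})"
  have Jfin: "finite J" unfolding J_def by (auto intro!: finite_SigmaI finite_PiE)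
  have "card J = (\<Sum>i\<in>(Basis::'a set). card ((UNIV :: bool set) \<times> (Pi\<^sub>E (Basis - {i}) (\<lambda>_. {..<N}))))"
    unfolding J_def by (intro card_SigmaI) (auto intro!: finite_PiE)
  also have "\<dots> = (\<Sum>i\<in>(Basis::'a set). 2 * N ^ ?s)"
    by (intro sum.cong) (auto simp: card_cartesian_product card_PiE)
  finally have J: "finite J" "card J = ?n * (2 * N ^ ?s)" using Jfin by simp_all
  have "ball x R \<subseteq> interior Q"
  proof
    fix z assume z: "z \<in> ball x R"
    have "x \<bullet> i - R < z \<bullet> i \<and> z \<bullet> i < x \<bullet> i + R" if "i \<in> Basis" for i
      using Basis_le_norm[OF that, of "x - z"] z by (auto simp: dist_norm inner_diff_left)
    then show "z \<in> interior Q"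
      by (auto simp: Q_def interior_cbox mem_box algebra_simps)
  qed
  then have "frontier \<Omega> \<inter> ball x R \<subseteq> P ` frontier Q"
    using frontier_subset_projection[OF \<Omega>, of Q] by (auto simp: P_def Q_def)
  also have "frontier Q \<subseteq> (\<Union>j\<in>J. cell j)"
  proof
    fix z assume z: "z \<in> frontier Q"
    then have zb: "x \<bullet> j - R \<le> z \<bullet> j \<and> z \<bullet> j \<le> x \<bullet> j + R" if "j \<in> Basis" for j
      using that by (auto simp: Q_def frontier_cbox mem_box algebra_simps)
    have "\<exists>i\<in>Basis. \<not> (x \<bullet> i - R < z \<bullet> i \<and> z \<bullet> i < x \<bullet> i + R)"
      using z by (auto simp: Q_def frontier_cbox mem_box algebra_simps)
    then obtain i b where i: "i \<in> Basis" "z \<bullet> i = x \<bullet> i + (if b then R else - R)"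
      using zb by (metis (full_types) add_uminus_conv_diff antisym_conv2 not_less)
    have "\<forall>j\<in>Basis - {i}. \<exists>m<N. x \<bullet> j - R + 2 * R * real m / real N \<le> z \<bullet> j \<and> z \<bullet> j \<le> x \<bullet> j - R + 2 * R * (real m + 1) / real N"
    proof
      fix j assume j: "j \<in> Basis - {i}"
      define \<tau> where "\<tau> = (z \<bullet> j - x \<bullet> j + R) * real N / (2 * R)"
      have "0 \<le> z \<bullet> j - x \<bullet> j + R" "z \<bullet> j - x \<bullet> j + R \<le> 2 * R" using zb[of j] j by auto
      then have "0 \<le> \<tau>" "(z \<bullet> j - x \<bullet> j + R) * real N \<le> 2 * R * real N"
        using R by (simp_all add: \<tau>_def mult_right_mono)
      moreover from this(2) have "\<tau> \<le> real N" using R by (simp add: \<tau>_def divide_le_eq mult.commute)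
      ultimately have "0 \<le> \<tau>" "\<tau> \<le> real N" by simp_all
      then obtain m where m: "m < N" "real m \<le> \<tau>" "\<tau> \<le> real m + 1" using grid_index N(2) by blast
      have t: "z \<bullet> j = x \<bullet> j - R + 2 * R * \<tau> / real N" using R N(2) by (simp add: \<tau>_def)
      show "\<exists>m<N. x \<bullet> j - R + 2 * R * real m / real N \<le> z \<bullet> j \<and> z \<bullet> j \<le> x \<bullet> j - R + 2 * R * (real m + 1) / real N"
        unfolding t using m R by (intro exI[of _ m]) (auto intro!: divide_right_mono mult_left_mono)
    qed
    then obtain g where g: "\<And>j. j \<in> Basis - {i} \<Longrightarrow> g j < N \<and> x \<bullet> j - R + 2 * R * real (g j) / real N \<le> z \<bullet> j \<and> z \<bullet> j \<le> x \<bullet> j - R + 2 * R * (real (g j) + 1) / real N"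
      by metis
    have "(i, b, restrict g (Basis - {i})) \<in> J" using i g by (auto simp: J_def)
    moreover have "z \<in> cell (i, b, restrict g (Basis - {i}))" using i g by (auto simp: cell_def)
    ultimately show "z \<in> (\<Union>j\<in>J. cell j)" by blast
  qed
  finally have cover: "frontier \<Omega> \<inter> ball x R \<subseteq> (\<Union>j\<in>J. P ` cell j)" by auto
  have diam: "dist y y' \<le> d" if j: "j \<in> J" and y: "y \<in> P ` cell j" "y' \<in> P ` cell j" for j y y'
  proof -
    obtain z z' where z: "z \<in> cell j" "z' \<in> cell j" "y = P z" "y' = P z'" using y by blast
    obtain i b g where jj: "j = (i, b, g)" by (cases j)
    have "\<bar>(z - z') \<bullet> k\<bar> \<le> 2 * R / real N" if "k \<in> Basis" for k
    proof (cases "k = i")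
      case True
      then show ?thesis using z R by (simp add: cell_def jj inner_diff_left)
    next
      case False
      then have "x \<bullet> k - R + 2 * R * real (g k) / real N \<le> w \<bullet> k \<and> w \<bullet> k \<le> x \<bullet> k - R + 2 * R * (real (g k) + 1) / real N"
        if "w \<in> cell j" for w using that \<open>k \<in> Basis\<close> by (auto simp: cell_def jj)
      from this[OF z(1)] this[OF z(2)] show ?thesis
        by (simp add: inner_diff_left abs_le_iff algebra_simps add_divide_distrib)
    qed
    then have "norm (z - z') \<le> (\<Sum>k\<in>(Basis::'a set). 2 * R / real N)"
      by (intro order_trans[OF norm_le_l1] sum_mono)
    also have "\<dots> = d" by (simp add: d_def)
    finally have "dist z z' \<le> d" by (simp add: dist_norm)
    moreover have "dist y y' \<le> dist z z'"
      unfolding z P_def using \<Omega> by (intro closest_point_lipschitz) (auto intro: convex_closure)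
    ultimately show ?thesis by linarith
  qed
  have "hausdorff_content ?s \<delta> (frontier \<Omega> \<inter> ball x R)
     \<le> ennreal (real (card J) * (unit_ball_vol (real ?s) * (d / 2) ^ ?s))"
    by (rule hausdorff_content_finite_cover[OF J(1) cover diam d])
  also have "real (card J) * (unit_ball_vol (real ?s) * (d / 2) ^ ?s)
      = frontier_density ?n * R ^ ?s"
  proof -
    have "real N ^ ?s * (d / 2) ^ ?s = (real ?n * R) ^ ?s"
      using N(2) by (subst power_mult_distrib[symmetric]) (simp add: d_def)
    then show ?thesis unfolding J(2) frontier_density_def by (simp add: power_mult_distrib algebra_simps)
  qed
  finally show "hausdorff_content ?s \<delta> (frontier \<Omega> \<inter> ball x R)
     \<le> ennreal (frontier_density ?n * R ^ ?s)" .
qed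

text \<open>
  Let \<open>d\<close> be the diameter of \<open>C\<close>. Balls of radius \<open>2 d\<close> whose centres are spaced by \<open>d\<close> along the direction \<open>\<nu>\<close>
  cover the cylinder. If \<open>d = 0\<close>, the cylinder is a segment, which is a null set in dimension at
  least two.
\<close>

lemma cylinder_emeasure_le:
  fixes C :: "'a::euclidean_space set"
  assumes n: "DIM('a) \<ge> 2" and C: "C \<noteq> {}" "bounded C" "diameter C \<le> r" and r: "0 < r" and \<nu>: "norm \<nu> = 1"
  shows "\<exists>E \<in> sets borel. {y. \<exists>t. 0 \<le> t \<and> t \<le> r \<and> y + t *\<^sub>R \<nu> \<in> C} \<subseteq> E \<and>
     emeasure lborel E \<le> ennreal (3 * r * unit_ball_vol (real DIM('a)) * 2 ^ DIM('a) * diameter C ^ (DIM('a) - 1))"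
proof -
  let ?n = "DIM('a)"
  define d where "d = diameter C"
  have d0: "0 \<le> d" unfolding d_def by (rule diameter_ge_0[OF C(2)])
  obtain c where c: "c \<in> C" using C by blast
  have dd: "norm (y - c) \<le> d" if "y \<in> C" for y
    using diameter_bounded_bound[OF C(2) that c] by (simp add: d_def dist_norm)
  show ?thesis
  proof (cases "d = 0")
    case True
    let ?E = "closed_segment c (c - r *\<^sub>R \<nu>)"
    have "?E \<subseteq> (+) c ` span {\<nu>}"
    proof
      fix z assume "z \<in> ?E"
      then obtain u where "z = (1 - u) *\<^sub>R c + u *\<^sub>R (c - r *\<^sub>R \<nu>)" by (auto simp: in_segment)
      then have "z = c + (- (u * r)) *\<^sub>R \<nu>" by (simp add: algebra_simps)
      then show "z \<in> (+) c ` span {\<nu>}" using span_mul[OF span_base[of \<nu> "{\<nu>}"]] by blast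
    qed
    moreover have "dim (span {\<nu>}) < DIM('a)"
      using n dim_le_card'[of "{\<nu>}"] by (simp add: dim_span)
    ultimately have "negligible ?E"
      using negligible_lowdim negligible_translation negligible_subset by metis
    then have "?E \<in> null_sets lebesgue" by (simp add: negligible_iff_null_sets)
    then have "?E \<in> null_sets lborel" by (simp add: null_sets_completion_iff)
    then have "emeasure lborel ?E = 0" by auto
    moreover have "{y. \<exists>t. 0 \<le> t \<and> t \<le> r \<and> y + t *\<^sub>R \<nu> \<in> C} \<subseteq> ?E"
    proof
      fix y assume "y \<in> {y. \<exists>t. 0 \<le> t \<and> t \<le> r \<and> y + t *\<^sub>R \<nu> \<in> C}"
      then obtain t where t: "0 \<le> t" "t \<le> r" "y + t *\<^sub>R \<nu> \<in> C" by blast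
      then have "y = c - t *\<^sub>R \<nu>" using dd True by (simp add: algebra_simps)
      then show "y \<in> ?E"
        unfolding in_segment using t r by (intro exI[of _ "t / r"]) (auto simp: algebra_simps)
    qed
    ultimately show ?thesis by (intro bexI[of _ ?E]) auto
  next
    case False
    then have d: "0 < d" using d0 by simp
    define M where "M = nat \<lfloor>r / d\<rfloor>"
    have M: "real M \<le> r / d" using r d by (simp add: M_def)
    define E where "E = (\<Union>i\<le>M. cball (c - (real i * d) *\<^sub>R \<nu>) (2 * d))"
    have "{y. \<exists>t. 0 \<le> t \<and> t \<le> r \<and> y + t *\<^sub>R \<nu> \<in> C} \<subseteq> E"
    proof
      fix y assume "y \<in> {y. \<exists>t. 0 \<le> t \<and> t \<le> r \<and> y + t *\<^sub>R \<nu> \<in> C}"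
      then obtain t where t: "0 \<le> t" "t \<le> r" "y + t *\<^sub>R \<nu> \<in> C" by blast
      define i where "i = nat \<lfloor>t / d\<rfloor>"
      have "\<lfloor>t / d\<rfloor> \<le> \<lfloor>r / d\<rfloor>" using t d by (intro floor_mono divide_right_mono) auto
      then have i: "i \<le> M" by (simp add: i_def M_def)
      have "real i \<le> t / d" "t / d < real i + 1" using t d by (auto simp: i_def)
      then have ti: "real i * d \<le> t" "t \<le> real i * d + d" using d by (auto simp: field_simps)
      have "norm (y - (c - (real i * d) *\<^sub>R \<nu>)) = norm ((y + t *\<^sub>R \<nu> - c) - (t - real i * d) *\<^sub>R \<nu>)"
        by (simp add: algebra_simps)
      also have "\<dots> \<le> norm (y + t *\<^sub>R \<nu> - c) + norm ((t - real i * d) *\<^sub>R \<nu>)" by (rule norm_triangle_ineq4)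
      also have "\<dots> \<le> d + d" using dd[OF t(3)] ti \<nu> by (intro add_mono) auto
      finally have "y \<in> cball (c - (real i * d) *\<^sub>R \<nu>) (2 * d)"
        by (simp add: dist_norm norm_minus_commute)
      then show "y \<in> E" using i by (auto simp: E_def)
    qed
    moreover have "emeasure lborel E \<le> ennreal (3 * r * unit_ball_vol (real ?n) * 2 ^ ?n * d ^ (?n - 1))"
    proof -
      have "emeasure lborel E \<le> (\<Sum>i\<le>M. emeasure lborel (cball (c - (real i * d) *\<^sub>R \<nu>) (2 * d)))"
        unfolding E_def by (intro emeasure_subadditive_finite) auto
      also have "\<dots> = (\<Sum>i\<le>M. ennreal (unit_ball_vol (real ?n) * (2 * d) ^ ?n))"
        using d by (intro sum.cong) (auto simp: emeasure_cball)
      also have "\<dots> = ennreal ((real M + 1) * (unit_ball_vol (real ?n) * (2 * d) ^ ?n))"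
        using d by (subst sum_ennreal) (auto simp: algebra_simps)
      also have "\<dots> \<le> ennreal ((3 * r / d) * (unit_ball_vol (real ?n) * (2 * d) ^ ?n))"
      proof (intro ennreal_leI mult_right_mono)
        have "1 \<le> r / d" using C(3) d by (simp add: d_def)
        moreover have "3 * r / d = 3 * (r / d)" by simp
        ultimately show "real M + 1 \<le> 3 * r / d" using M by linarith
      qed (use d in auto)
      also have "(3 * r / d) * (unit_ball_vol (real ?n) * (2 * d) ^ ?n) = 3 * r * unit_ball_vol (real ?n) * 2 ^ ?n * d ^ (?n - 1)"
      proof -
        have "d ^ ?n = d * d ^ (?n - 1)" using n by (cases ?n) auto
        then show ?thesis using d by (simp add: power_mult_distrib)
      qed
      finally show ?thesis .
    qed
    moreover have "E \<in> sets borel" unfolding E_def by (intro sets.finite_UN) auto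
    ultimately show ?thesis unfolding d_def by blast
  qed
qed

text \<open>
  The constant that results from covering cylinders of height \<open>r\<close> over small sets by balls.
\<close>

definition cylinder_ratio :: "nat \<Rightarrow> real" where
  "cylinder_ratio n = unit_ball_vol (real (n - 1)) / (3 * unit_ball_vol (real n) * 4 ^ n)"

lemma cylinder_ratio_pos: "0 < cylinder_ratio n"
  by (auto simp: cylinder_ratio_def intro!: divide_pos_pos mult_pos_pos)

text \<open>
  Let \<open>\<nu>\<close> be an outer normal at \<open>x\<close>. A point of \<open>\<Omega>\<close> at distance less than \<open>r / 2\<close> from \<open>x\<close> is at most as far
  from the supporting hyperplane, so it meets the boundary within the ball of radius \<open>r\<close> when it moves in
  direction \<open>\<nu>\<close>. The cylinders over the sets of a covering of the boundary in this ball thus cover the part of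
  \<open>\<Omega>\<close> near \<open>x\<close>.
\<close>

lemma volume_le_hausdorff_frontier:
  fixes \<Omega> :: "'a::euclidean_space set"
  assumes n: "DIM('a) \<ge> 2" and \<Omega>: "open \<Omega>" "convex \<Omega>" and x: "x \<in> frontier \<Omega>" and r: "0 < r"
  shows "ennreal (cylinder_ratio DIM('a) / r)
      * emeasure lborel (\<Omega> \<inter> ball x (r / 2))
    \<le> hausdorff_outer_measure (DIM('a) - 1) (frontier \<Omega> \<inter> ball x r)"
proof -
  let ?n = "DIM('a)" and ?s = "DIM('a) - 1"
  let ?k = "cylinder_ratio ?n / r"
  let ?B = "frontier \<Omega> \<inter> ball x r"
  have w: "unit_ball_vol (real ?s) > 0" "unit_ball_vol (real ?n) > 0" by auto
  have ne: "\<Omega> \<noteq> {}" and xo: "x \<notin> \<Omega>" using x \<Omega>(1) by (auto simp: frontier_def interior_open)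
  obtain \<nu> where \<nu>: "norm \<nu> = 1" "\<And>w. w \<in> closure \<Omega> \<Longrightarrow> \<nu> \<bullet> w \<le> \<nu> \<bullet> x"
    using outer_normal_exists[OF \<Omega>(2) ne xo] by blast
  have reach: "\<exists>t. 0 \<le> t \<and> t \<le> r \<and> y + t *\<^sub>R \<nu> \<in> ?B" if y: "y \<in> \<Omega> \<inter> ball x (r / 2)" for y
  proof -
    define h where "h = \<nu> \<bullet> (x - y)"
    have "h \<ge> 0" using \<nu>(2)[of y] y closure_subset[of \<Omega>] by (auto simp: h_def inner_diff_right)
    moreover have "h \<le> norm \<nu> * norm (x - y)" unfolding h_def by (rule norm_cauchy_schwarz)
    ultimately have h: "0 \<le> h" "h < r / 2" using y \<nu>(1) by (auto simp: dist_norm)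
    have "y + h *\<^sub>R \<nu> \<notin> \<Omega>"
    proof
      assume "y + h *\<^sub>R \<nu> \<in> \<Omega>"
      then obtain e where e: "e > 0" "ball (y + h *\<^sub>R \<nu>) e \<subseteq> \<Omega>" using \<Omega>(1) open_contains_ball by blast
      have "y + h *\<^sub>R \<nu> + (e / 2) *\<^sub>R \<nu> \<in> ball (y + h *\<^sub>R \<nu>) e" using e \<nu>(1) by (simp add: dist_norm)
      then have "\<nu> \<bullet> (y + h *\<^sub>R \<nu> + (e / 2) *\<^sub>R \<nu>) \<le> \<nu> \<bullet> x"
        using e closure_subset by (intro \<nu>(2)) blast
      moreover have "\<nu> \<bullet> \<nu> = 1" using \<nu>(1) by (simp add: norm_eq_1)
      ultimately show False using e by (simp add: h_def inner_add_right inner_diff_right)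
    qed
    then have "closed_segment y (y + h *\<^sub>R \<nu>) \<inter> frontier \<Omega> \<noteq> {}"
      using y by (intro connected_Int_frontier connected_segment) auto
    then obtain u where u: "0 \<le> u" "u \<le> 1" "(1 - u) *\<^sub>R y + u *\<^sub>R (y + h *\<^sub>R \<nu>) \<in> frontier \<Omega>"
      by (auto simp: in_segment)
    have eq: "(1 - u) *\<^sub>R y + u *\<^sub>R (y + h *\<^sub>R \<nu>) = y + (u * h) *\<^sub>R \<nu>" by (simp add: algebra_simps)
    have uh: "0 \<le> u * h" "u * h < r / 2" using u h mult_left_le_one_le[of h u] by auto
    have "dist x (y + (u * h) *\<^sub>R \<nu>) \<le> dist x y + dist y (y + (u * h) *\<^sub>R \<nu>)" by (rule dist_triangle)
    also have "\<dots> < r / 2 + r / 2" using y uh \<nu>(1) by (intro add_strict_mono) (auto simp: dist_norm)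
    finally have "y + (u * h) *\<^sub>R \<nu> \<in> ?B" using u(3) unfolding eq by simp
    then show ?thesis using uh by (intro exI[of _ "u * h"]) auto
  qed
  have "ennreal ?k * emeasure lborel (\<Omega> \<inter> ball x (r / 2)) \<le> hausdorff_content ?s r ?B"
    unfolding hausdorff_content_def
  proof (rule INF_greatest)
    fix C :: "nat \<Rightarrow> 'a set" assume "C \<in> {C. ?B \<subseteq> (\<Union>j. C j) \<and> (\<forall>j. bounded (C j) \<and> diameter (C j) \<le> r)}"
    then have C: "?B \<subseteq> (\<Union>j. C j)" "\<And>j. bounded (C j)" "\<And>j. diameter (C j) \<le> r" by auto
    define Z where "Z j = {y. \<exists>t. 0 \<le> t \<and> t \<le> r \<and> y + t *\<^sub>R \<nu> \<in> C j}" for j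
    have "\<exists>E. E \<in> sets borel \<and> Z j \<subseteq> E \<and>
       ennreal ?k * emeasure lborel E \<le> hausdorff_weight ?s (C j)" for j
    proof (cases "C j = {}")
      case True
      then show ?thesis by (intro exI[of _ "{}"]) (auto simp: Z_def)
    next
      case False
      obtain E where E: "E \<in> sets borel" "Z j \<subseteq> E"
         "emeasure lborel E \<le> ennreal (3 * r * unit_ball_vol (real ?n) * 2 ^ ?n * diameter (C j) ^ ?s)"
        using cylinder_emeasure_le[OF n False C(2,3) r \<nu>(1)] unfolding Z_def by blast
      have d0: "0 \<le> diameter (C j)" by (rule diameter_ge_0[OF C(2)])
      have "ennreal ?k * emeasure lborel E \<le> ennreal ?k * ennreal (3 * r * unit_ball_vol (real ?n) * 2 ^ ?n * diameter (C j) ^ ?s)"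
        by (intro mult_left_mono E(3)) auto
      also have "\<dots> = ennreal (?k * (3 * r * unit_ball_vol (real ?n) * 2 ^ ?n * diameter (C j) ^ ?s))"
        using w r d0 cylinder_ratio_pos[of ?n] by (intro ennreal_mult[symmetric]) auto
      also have "?k * (3 * r * unit_ball_vol (real ?n) * 2 ^ ?n * diameter (C j) ^ ?s)
         = unit_ball_vol (real ?s) * (diameter (C j) ^ ?s * (2 ^ ?n / 4 ^ ?n))"
      proof -
        have "a / (3 * b * 4 ^ ?n) / r * (3 * r * b * 2 ^ ?n * e) = a * (e * (2 ^ ?n / 4 ^ ?n))"
          if "b > 0" for a b e :: real using that r by (simp add: field_simps)
        from this[OF w(2)] show ?thesis by (simp add: cylinder_ratio_def)
      qed
      also have "\<dots> \<le> unit_ball_vol (real ?s) * (diameter (C j) ^ ?s * (1 / 2 ^ ?s))"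
      proof (intro mult_left_mono)
        have "(4::real) ^ ?n = 2 ^ ?n * 2 ^ ?n" by (simp flip: power_mult_distrib)
        then have "(2::real) ^ ?n / 4 ^ ?n = 1 / 2 ^ ?n" by simp
        also have "\<dots> \<le> 1 / 2 ^ ?s" by (intro divide_left_mono power_increasing) auto
        finally show "(2::real) ^ ?n / 4 ^ ?n \<le> 1 / 2 ^ ?s" .
      qed (use w d0 in auto)
      also have "ennreal (unit_ball_vol (real ?s) * (diameter (C j) ^ ?s * (1 / 2 ^ ?s))) = hausdorff_weight ?s (C j)"
        using False by (simp add: hausdorff_weight_def power_divide)
      finally show ?thesis using E(1,2) by (metis ennreal_leI)
    qed
    then obtain E where E: "\<And>j. E j \<in> sets borel" "\<And>j. Z j \<subseteq> E j"
       "\<And>j. ennreal ?k * emeasure lborel (E j) \<le> hausdorff_weight ?s (C j)" by (metis (no_types))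
    have "\<Omega> \<inter> ball x (r / 2) \<subseteq> (\<Union>j. E j)"
    proof
      fix y assume "y \<in> \<Omega> \<inter> ball x (r / 2)"
      then obtain t where t: "0 \<le> t" "t \<le> r" "y + t *\<^sub>R \<nu> \<in> ?B" using reach by blast
      then obtain j where "y + t *\<^sub>R \<nu> \<in> C j" using C(1) by blast
      then have "y \<in> E j" using E(2)[of j] t unfolding Z_def by blast
      then show "y \<in> (\<Union>j. E j)" by blast
    qed
    then have "emeasure lborel (\<Omega> \<inter> ball x (r / 2)) \<le> emeasure lborel (\<Union>j. E j)"
      using E(1) by (intro emeasure_mono) auto
    also have "\<dots> \<le> (\<Sum>j. emeasure lborel (E j))"
      using E(1) by (intro emeasure_subadditive_countably) auto
    finally have "ennreal ?k * emeasure lborel (\<Omega> \<inter> ball x (r / 2)) \<le> ennreal ?k * (\<Sum>j. emeasure lborel (E j))"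
      by (intro mult_left_mono) auto
    also have "\<dots> = (\<Sum>j. ennreal ?k * emeasure lborel (E j))" by simp
    also have "\<dots> \<le> (\<Sum>j. hausdorff_weight ?s (C j))" by (intro suminf_le E(3)) auto
    finally show "ennreal ?k * emeasure lborel (\<Omega> \<inter> ball x (r / 2)) \<le> (\<Sum>j. hausdorff_weight ?s (C j))" .
  qed
  also have "\<dots> \<le> hausdorff_outer_measure ?s ?B" by (rule hausdorff_content_le_outer[OF r])
  finally show ?thesis .
qed

text \<open>
  Follows from the homothety with centre \<open>x\<close> and ratio \<open>1/4\<close>.
\<close>

lemma emeasure_convex_ball_doubling:
  fixes \<Omega> :: "'a::euclidean_space set"
  assumes \<Omega>: "open \<Omega>" "convex \<Omega>" and x: "x \<in> closure \<Omega>"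
  shows "emeasure lborel (\<Omega> \<inter> ball x (2 * r)) \<le> ennreal (4 ^ DIM('a)) * emeasure lborel (\<Omega> \<inter> ball x (r / 2))"
proof -
  have "emeasure lborel (\<Omega> \<inter> ball x (2 * r)) = (\<integral>\<^sup>+y. indicator (\<Omega> \<inter> ball x (2 * r)) y \<partial>lborel)"
    using \<Omega> by simp
  also have "\<dots> = (\<integral>\<^sup>+y. indicator (ball x (r / 2)) (x + (1/4) *\<^sub>R (y - x)) * indicator \<Omega> y \<partial>lborel)"
    by (intro nn_integral_cong) (auto simp: indicator_def dist_norm norm_minus_commute)
  also have "\<dots> \<le> ennreal ((1/4) powr - real DIM('a)) * (\<integral>\<^sup>+y. indicator (ball x (r / 2)) y * indicator \<Omega> y \<partial>lborel)"
    by (rule nn_integral_homothety_le[OF _ \<Omega> x]) (auto intro!: borel_measurable_indicator)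
  also have "(\<integral>\<^sup>+y. indicator (ball x (r / 2)) y * indicator \<Omega> y \<partial>lborel) = (\<integral>\<^sup>+y. indicator (\<Omega> \<inter> ball x (r / 2)) y \<partial>lborel)"
    by (intro nn_integral_cong) (auto simp: indicator_def)
  also have "\<dots> = emeasure lborel (\<Omega> \<inter> ball x (r / 2))" using \<Omega> by simp
  also have "(1/4 :: real) powr - real DIM('a) = 4 ^ DIM('a)"
    by (simp add: powr_minus powr_realpow power_divide)
  finally show ?thesis .
qed

section \<open>Eigenvalue bounds from disjoint test functions\<close>

lemma disjoint_sum_powr:
  fixes v :: "'i \<Rightarrow> 'b::euclidean_space"
  assumes I: "finite I" and dis: "\<And>i j. i \<in> I \<Longrightarrow> j \<in> I \<Longrightarrow> i \<noteq> j \<Longrightarrow> v i = 0 \<or> v j = 0"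
  shows "norm (\<Sum>i\<in>I. a i *\<^sub>R v i) powr p = (\<Sum>i\<in>I. \<bar>a i\<bar> powr p * norm (v i) powr p)"
proof (cases "\<forall>i\<in>I. v i = 0")
  case True
  then show ?thesis by simp
next
  case False
  then obtain i where i: "i \<in> I" "v i \<noteq> 0" by blast
  have z: "v j = 0" if "j \<in> I - {i}" for j using dis[of i j] i that by auto
  have "(\<Sum>i\<in>I. a i *\<^sub>R v i) = a i *\<^sub>R v i"
    using I i z by (subst sum.remove[of I i]) (auto intro: sum.neutral)
  moreover have "(\<Sum>i\<in>I. \<bar>a i\<bar> powr p * norm (v i) powr p) = \<bar>a i\<bar> powr p * norm (v i) powr p"
    using I i z by (subst sum.remove[of I i]) (auto intro: sum.neutral)
  ultimately show ?thesis by (simp add: powr_mult)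
qed

lemma space_boundary_measure [simp]: "space (boundary_measure \<Omega>) = frontier \<Omega>"
  by (simp add: boundary_measure_def space_restrict_space)

lemma borel_measurable_boundary:
  "f \<in> borel_measurable borel \<Longrightarrow> f \<in> borel_measurable (boundary_measure \<Omega>)"
  unfolding boundary_measure_def
  by (rule measurable_restrict_space1) (simp add: measurable_cong_sets[OF sets_hausdorff_measure refl])

lemma integrable_boundary_continuous:
  fixes f :: "'a::euclidean_space \<Rightarrow> real"
  assumes fin: "finite_measure (boundary_measure \<Omega>)" and \<Omega>: "bounded \<Omega>" and f: "continuous_on UNIV f"
  shows "integrable (boundary_measure \<Omega>) f"
proof -
  interpret finite_measure "boundary_measure \<Omega>" by (rule fin)
  have "compact (frontier \<Omega>)" using \<Omega> by (rule compact_frontier_bounded)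
  then have "bounded (f ` frontier \<Omega>)"
    using compact_continuous_image[OF continuous_on_subset[OF f]] compact_imp_bounded by blast
  then obtain M where "\<And>x. x \<in> frontier \<Omega> \<Longrightarrow> norm (f x) \<le> M" unfolding bounded_iff by auto
  then show ?thesis
    using f by (intro integrable_const_bound[of _ M] AE_I2 borel_measurable_boundary borel_measurable_continuous_onI) auto
qed

text \<open>
  With disjoint supports, \<open>p\<close>-th powers of linear combinations are additive. Their Rayleigh quotients are
  then weighted means of the quotients of the single functions.
\<close>

locale disjoint_test_functions =
  fixes p :: real and \<Omega> :: "'a::euclidean_space set" and k :: nat
    and u :: "nat \<Rightarrow> 'a \<Rightarrow> real" and \<psi> :: "nat \<Rightarrow> 'a \<Rightarrow> 'a"
  assumes domain: "open \<Omega>" "convex \<Omega>" "bounded \<Omega>" "\<Omega> \<noteq> {}"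
    and p: "p > real DIM('a)"
    and k: "1 \<le> k"
    and finite_boundary: "finite_measure (boundary_measure \<Omega>)"
    and C1: "\<And>i. i < k \<Longrightarrow> C1_with_gradient (u i) (\<psi> i)"
    and disjoint: "\<And>i j x. i < k \<Longrightarrow> j < k \<Longrightarrow> i \<noteq> j \<Longrightarrow> (u i x = 0 \<and> \<psi> i x = 0) \<or> (u j x = 0 \<and> \<psi> j x = 0)"
    and boundary_pos: "\<And>i. i < k \<Longrightarrow> 0 < (\<integral>x. \<bar>u i x\<bar> powr p \<partial>boundary_measure \<Omega>)"
begin

lemma p_pos: "p > 0"
  using p by (metis le_less_trans of_nat_0_le_iff)

definition comb :: "(nat \<Rightarrow> real) \<Rightarrow> 'a \<Rightarrow> real" where
  "comb a x = (\<Sum>i<k. a i * u i x)"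

definition comb_gradient :: "(nat \<Rightarrow> real) \<Rightarrow> 'a \<Rightarrow> 'a" where
  "comb_gradient a x = (\<Sum>i<k. a i *\<^sub>R \<psi> i x)"

definition mass :: "nat \<Rightarrow> real" where
  "mass i = (\<integral>x. \<bar>u i x\<bar> powr p \<partial>lebesgue_on \<Omega>)"

definition energy :: "nat \<Rightarrow> real" where
  "energy i = (\<integral>x. norm (\<psi> i x) powr p \<partial>lebesgue_on \<Omega>)"

definition boundary_mass :: "nat \<Rightarrow> real" where
  "boundary_mass i = (\<integral>x. \<bar>u i x\<bar> powr p \<partial>boundary_measure \<Omega>)"

lemma comb_C1: "C1_with_gradient (comb a) (comb_gradient a)"
  unfolding comb_def[abs_def] comb_gradient_def[abs_def] by (intro C1_sum C1_cmult C1) auto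

lemma comb_diff: "comb a x - comb b x = comb (\<lambda>i. a i - b i) x"
  by (simp add: comb_def sum_subtractf algebra_simps)

lemma comb_powr: "\<bar>comb a x\<bar> powr p = (\<Sum>i<k. \<bar>a i\<bar> powr p * \<bar>u i x\<bar> powr p)"
  using disjoint_sum_powr[of "{..<k}" "\<lambda>i. u i x" a p] disjoint unfolding comb_def by fastforce

lemma comb_gradient_powr: "norm (comb_gradient a x) powr p = (\<Sum>i<k. \<bar>a i\<bar> powr p * norm (\<psi> i x) powr p)"
  using disjoint_sum_powr[of "{..<k}" "\<lambda>i. \<psi> i x" a p] disjoint unfolding comb_gradient_def by fastforce

lemma u_powr_continuous: "i < k \<Longrightarrow> continuous_on UNIV (\<lambda>x. \<bar>u i x\<bar> powr p)"
  using continuous_norm_powr[OF C1_imp_continuous[OF C1] p_pos] by simp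

lemma comb_mass: "(\<integral>x. \<bar>comb a x\<bar> powr p \<partial>lebesgue_on \<Omega>) = (\<Sum>i<k. \<bar>a i\<bar> powr p * mass i)"
  unfolding comb_powr mass_def
  using bounded_continuous_integrable_on(1)[OF domain(1,3) u_powr_continuous] by simp

lemma comb_energy: "(\<integral>x. norm (comb_gradient a x) powr p \<partial>lebesgue_on \<Omega>) = (\<Sum>i<k. \<bar>a i\<bar> powr p * energy i)"
  unfolding comb_gradient_powr energy_def
  using bounded_continuous_integrable_on(1)[OF domain(1,3) continuous_norm_powr[OF C1_grad_continuous[OF C1] p_pos]]
  by simp

lemma comb_in_Lp_boundary: "comb a \<in> Lp p (boundary_measure \<Omega>)"
  unfolding Lp_def
proof (intro CollectI conjI)
  have c: "continuous_on UNIV (comb a)" by (rule C1_imp_continuous[OF comb_C1])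
  show "comb a \<in> borel_measurable (boundary_measure \<Omega>)"
    using c by (intro borel_measurable_boundary borel_measurable_continuous_onI)
  show "integrable (boundary_measure \<Omega>) (\<lambda>x. norm (comb a x) powr p)"
    by (intro integrable_boundary_continuous finite_boundary domain continuous_norm_powr c p_pos)
qed

lemma comb_boundary_mass:
  "(\<integral>x. \<bar>trace_on_boundary p \<Omega> (comb a) x\<bar> powr p \<partial>boundary_measure \<Omega>) = (\<Sum>i<k. \<bar>a i\<bar> powr p * boundary_mass i)"
  unfolding trace_C1[OF domain p comb_C1 comb_in_Lp_boundary] comb_powr boundary_mass_def
  using integrable_boundary_continuous[OF finite_boundary domain(3) u_powr_continuous] by simp

lemma comb_in_sobolev: "comb a \<in> sobolev p \<Omega>"
  by (rule C1_in_sobolev[OF domain(1,3) comb_C1 p_pos])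

lemma comb_sobolev_norm:
  "sobolev_norm p \<Omega> (comb a) = (\<Sum>i<k. \<bar>a i\<bar> powr p * (mass i + energy i)) powr (1 / p)"
  unfolding sobolev_norm_C1[OF comb_C1 domain(1)] comb_mass comb_energy
  by (simp add: sum.distrib distrib_left)

lemma continuous_sum_powr:
  "continuous_on UNIV (\<lambda>a. \<Sum>i<k. \<bar>a i - b i\<bar> powr p * c i)"
  using p_pos by (intro continuous_intros continuous_on_powr' continuous_on_product_coordinates) auto

text \<open>
  The Sobolev distance of two combinations is an explicit continuous function of the coefficients.
\<close>

lemma comb_continuous: "continuous_map euclidean (sobolev_topology p \<Omega>) comb"
  unfolding continuous_map_def
proof (intro conjI allI impI)
  have "openin (sobolev_topology p \<Omega>) (sobolev p \<Omega>)"
    unfolding openin_sobolev_topology sobolev_open_def by (auto intro: exI[of _ 1])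
  then have "sobolev p \<Omega> \<subseteq> topspace (sobolev_topology p \<Omega>)" by (rule openin_subset)
  then show "comb \<in> topspace euclidean \<rightarrow> topspace (sobolev_topology p \<Omega>)"
    using comb_in_sobolev by auto
  fix U assume U: "openin (sobolev_topology p \<Omega>) U"
  have "open {a. comb a \<in> U}"
    unfolding open_subopen[of "{a. comb a \<in> U}"]
  proof
    fix a assume "a \<in> {a. comb a \<in> U}"
    then obtain e where e: "e > 0" "\<And>v. v \<in> sobolev p \<Omega> \<Longrightarrow> sobolev_norm p \<Omega> (\<lambda>x. v x - comb a x) < e \<Longrightarrow> v \<in> U"
      using U unfolding openin_sobolev_topology sobolev_open_def by blast
    define W where "W = {b. (\<Sum>i<k. \<bar>b i - a i\<bar> powr p * (mass i + energy i)) < e powr p}"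
    have "open W"
      unfolding W_def by (intro open_Collect_less continuous_sum_powr continuous_intros)
    moreover have "a \<in> W" using e(1) by (simp add: W_def)
    moreover have "W \<subseteq> {a. comb a \<in> U}"
    proof
      fix b assume b: "b \<in> W"
      have nn: "0 \<le> mass i + energy i" for i
        unfolding mass_def energy_def by (intro add_nonneg_nonneg integral_nonneg_AE) auto
      have "sobolev_norm p \<Omega> (\<lambda>x. comb b x - comb a x)
          = (\<Sum>i<k. \<bar>b i - a i\<bar> powr p * (mass i + energy i)) powr (1 / p)"
        unfolding comb_diff by (rule comb_sobolev_norm)
      also have "\<dots> < (e powr p) powr (1 / p)"
        using b p_pos nn by (intro powr_less_mono2) (auto simp: W_def intro!: sum_nonneg)
      also have "\<dots> = e" using e(1) p_pos by (simp add: powr_powr)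
      finally show "b \<in> {a. comb a \<in> U}" using e(2)[OF comb_in_sobolev] by simp
    qed
    ultimately show "\<exists>W. open W \<and> a \<in> W \<and> W \<subseteq> {a. comb a \<in> U}" by blast
  qed
  then show "openin euclidean {a \<in> topspace euclidean. comb a \<in> U}" by simp
qed

definition coeffs :: "(nat \<Rightarrow> real) set" where
  "coeffs = {a. (\<forall>i\<ge>k. a i = 0) \<and> (\<exists>i<k. a i \<noteq> 0)}"

lemma boundary_mass_pos: "i < k \<Longrightarrow> 0 < boundary_mass i"
  unfolding boundary_mass_def by (rule boundary_pos)

lemma boundary_mass_nonneg: "0 \<le> boundary_mass i"
  unfolding boundary_mass_def by (rule integral_nonneg_AE) auto

lemma comb_boundary_mass_pos:
  assumes "a \<in> coeffs" shows "0 < (\<Sum>i<k. \<bar>a i\<bar> powr p * boundary_mass i)"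
proof -
  obtain i where i: "i < k" "a i \<noteq> 0" using assms by (auto simp: coeffs_def)
  then have "0 < \<bar>a i\<bar> powr p * boundary_mass i" using boundary_mass_pos by simp
  also have "\<dots> \<le> (\<Sum>i<k. \<bar>a i\<bar> powr p * boundary_mass i)"
    using i boundary_mass_nonneg by (intro member_le_sum) auto
  finally show ?thesis .
qed

text \<open>
  A continuous function that vanishes almost everywhere on \<open>\<Omega>\<close> also vanishes on the boundary, which
  contradicts positive boundary mass.
\<close>

lemma comb_not_AE_zero:
  assumes a: "a \<in> coeffs" shows "\<not> (AE x in lebesgue_on \<Omega>. comb a x = 0)"
proof
  assume ae: "AE x in lebesgue_on \<Omega>. comb a x = 0"
  have c: "continuous_on S (comb a)" for S
    using C1_imp_continuous[OF comb_C1] continuous_on_subset by blast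
  have \<Omega>m: "\<Omega> \<inter> space lebesgue \<in> sets lebesgue" using domain by simp
  let ?S = "\<Omega> \<inter> {x. comb a x \<noteq> 0}"
  have oS: "open ?S" using domain c by (intro open_Int open_Collect_neq continuous_intros) auto
  have "AE x in lebesgue. x \<notin> ?S"
    using ae unfolding AE_restrict_space_iff[OF \<Omega>m] by eventually_elim auto
  then have "?S \<in> null_sets lebesgue"
    using oS by (subst AE_iff_null_sets) auto
  then have "negligible ?S" by (simp add: negligible_iff_null_sets)
  then have "?S = {}" using oS open_not_negligible by blast
  then have "comb a x = 0" if "x \<in> closure \<Omega>" for x
    using continuous_constant_on_closure[OF c, of \<Omega> 0 x] that by blast
  then have "comb a x = 0" if "x \<in> frontier \<Omega>" for x using that by (auto simp: frontier_def)
  then have "(\<integral>x. \<bar>comb a x\<bar> powr p \<partial>boundary_measure \<Omega>) = (\<integral>x. 0 \<partial>boundary_measure \<Omega>)"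
    by (intro Bochner_Integration.integral_cong) auto
  then have "(\<Sum>i<k. \<bar>a i\<bar> powr p * boundary_mass i) = 0"
    using trace_C1[OF domain p comb_C1 comb_in_Lp_boundary] comb_boundary_mass[of a] by simp
  then show False using comb_boundary_mass_pos[OF a] by simp
qed

lemma compact_boundary_sphere:
  "compact {a. (\<forall>i\<ge>k. a i = 0) \<and> (\<Sum>i<k. \<bar>a i\<bar> powr p * boundary_mass i) = 1}" (is "compact ?S")
proof -
  define M where "M i = (if i < k then (1 / boundary_mass i) powr (1 / p) else 0)" for i
  have "?S = (\<Inter>i\<in>{k..}. {a. a i = 0}) \<inter> {a. (\<Sum>i<k. \<bar>a i - 0\<bar> powr p * boundary_mass i) = 1}" by auto
  moreover have "closed {a::nat \<Rightarrow> real. a i = 0}" for i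
    by (intro closed_Collect_eq continuous_intros continuous_on_product_coordinates)
  moreover have "closed {a. (\<Sum>i<k. \<bar>a i - 0\<bar> powr p * boundary_mass i) = 1}"
    by (intro closed_Collect_eq continuous_sum_powr continuous_on_const)
  ultimately have cl: "closed ?S" by (metis (lifting) closed_INT closed_Int)
  have "?S \<subseteq> PiE UNIV (\<lambda>i. {- M i..M i})"
  proof
    fix a assume a: "a \<in> ?S"
    have "\<bar>a i\<bar> \<le> M i" for i
    proof (cases "i < k")
      case True
      have "\<bar>a i\<bar> powr p * boundary_mass i \<le> (\<Sum>i<k. \<bar>a i\<bar> powr p * boundary_mass i)"
        using True boundary_mass_nonneg by (intro member_le_sum) auto
      then have "\<bar>a i\<bar> powr p \<le> 1 / boundary_mass i"
        using a boundary_mass_pos[OF True] by (simp add: le_divide_eq)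
      then have "(\<bar>a i\<bar> powr p) powr (1 / p) \<le> (1 / boundary_mass i) powr (1 / p)"
        using p_pos by (intro powr_mono2) auto
      then show ?thesis using p_pos True by (simp add: powr_powr M_def)
    next
      case False
      then show ?thesis using a by (simp add: M_def)
    qed
    then show "a \<in> PiE UNIV (\<lambda>i. {- M i..M i})" by (auto simp: abs_le_iff minus_le_iff)
  qed
  then show ?thesis
    using compact_Int_closed[OF compact_PiE_Icc cl, of "\<lambda>i. - M i" M] by (simp only: Int_absorb1)
qed

lemma cross_sphere_subset_coeffs: "cross_sphere (k - 1) \<subseteq> coeffs"
proof
  fix a assume a: "a \<in> cross_sphere (k - 1)"
  have "\<exists>i<k. a i \<noteq> 0"
  proof (rule ccontr)
    assume "\<not> ?thesis"
    then have "(\<Sum>i\<le>k - 1. \<bar>a i\<bar>) = 0" using k by (intro sum.neutral) auto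
    then show False using a by (simp add: cross_sphere_def)
  qed
  then show "a \<in> coeffs" using a k by (auto simp: coeffs_def cross_sphere_def)
qed

text \<open>
  For \<open>l < k\<close>, an odd map to \<open>\<real>\<^sup>l - {0}\<close> composed with \<open>comb\<close> would be an odd map without zeros on a
  sphere of dimension \<open>k - 1\<close>.
\<close>

lemma genus_ge: "enat k \<le> krasnoselskii_genus p \<Omega> (comb ` coeffs)"
  unfolding krasnoselskii_genus_def
proof (rule Inf_greatest)
  let ?F = "comb ` coeffs"
  fix e assume "e \<in> enat ` {l. l \<ge> 1 \<and> (\<exists>f. continuous_map (subtopology (sobolev_topology p \<Omega>) ?F)
            (subtopology (Euclidean_space l) (- {\<lambda>i. 0})) f \<and> (\<forall>u\<in>?F. f (\<lambda>x. - u x) = (\<lambda>i. - f u i)))}"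
  then obtain l f where e: "e = enat l" and
    f: "continuous_map (subtopology (sobolev_topology p \<Omega>) ?F) (subtopology (Euclidean_space l) (- {\<lambda>i. 0})) f"
    and odd: "\<And>u. u \<in> ?F \<Longrightarrow> f (\<lambda>x. - u x) = (\<lambda>i. - f u i)" by blast
  have "k \<le> l"
  proof (rule ccontr)
    assume "\<not> k \<le> l"
    then have l: "l \<le> k - 1" by simp
    let ?S = "cross_sphere (k - 1)"
    define g where "g a = f (comb a)" for a
    have "continuous_map (top_of_set ?S) (subtopology (sobolev_topology p \<Omega>) ?F) comb"
      using cross_sphere_subset_coeffs comb_continuous
      by (auto simp: continuous_map_in_subtopology intro: continuous_map_from_subtopology)
    from continuous_map_compose[OF this f]
    have g: "continuous_map (top_of_set ?S) (subtopology (Euclidean_space l) (- {\<lambda>i. 0})) g"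
      by (simp add: g_def[abs_def] comp_def)
    have "continuous_map (top_of_set ?S) (Euclidean_space l) g" using g by (simp add: continuous_map_in_subtopology)
    then have "continuous_map (top_of_set ?S) (powertop_real UNIV) g"
      unfolding Euclidean_space_def by (simp add: continuous_map_in_subtopology)
    then have cont: "continuous_on ?S (\<lambda>a. g a i)" for i
      by (simp add: continuous_map_componentwise_UNIV)
    have "\<exists>a\<in>?S. \<forall>i<l. g a i = 0"
    proof (rule Borsuk_Ulam[OF cont _ l])
      fix a i assume a: "a \<in> ?S"
      have "comb (antipode a) = (\<lambda>x. - comb a x)" by (simp add: comb_def antipode_def fun_eq_iff sum_negf)
      then have "g (antipode a) = (\<lambda>i. - g a i)"
        using odd[of "comb a"] a cross_sphere_subset_coeffs by (auto simp: g_def)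
      then show "g (antipode a) i = - g a i" by simp
    qed
    then obtain a where a: "a \<in> ?S" "\<And>i. i < l \<Longrightarrow> g a i = 0" by blast
    have "g a \<in> topspace (subtopology (Euclidean_space l) (- {\<lambda>i. 0}))"
      using g a(1) by (auto simp: continuous_map_def)
    then have "g a \<noteq> (\<lambda>i. 0)" "\<And>i. i \<ge> l \<Longrightarrow> g a i = 0" by (auto simp: topspace_Euclidean_space)
    then show False using a(2) by (metis not_le ext)
  qed
  then show "enat k \<le> e" by (simp add: e)
qed

lemma comb_admissible: "comb ` coeffs \<in> steklov_admissible p \<Omega> k"
  unfolding steklov_admissible_def
proof (intro CollectI conjI ballI)
  let ?F = "comb ` coeffs"
  have ne: "coeffs \<noteq> {}" using k by (auto simp: coeffs_def intro!: exI[of _ "\<lambda>i. of_bool (i = 0)"] exI[of _ 0])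
  then show "?F \<noteq> {}" by simp
  show "?F \<subseteq> sobolev p \<Omega>" using comb_in_sobolev by auto
  show "\<not> (AE x in lebesgue_on \<Omega>. v x = 0)" if "v \<in> ?F" for v using that comb_not_AE_zero by auto
  show "(\<lambda>x. - v x) \<in> ?F" if v: "v \<in> ?F" for v
  proof -
    obtain a where a: "a \<in> coeffs" "v = comb a" using v by blast
    have "(\<lambda>x. - v x) = comb (\<lambda>i. - a i)" by (simp add: a comb_def fun_eq_iff sum_negf)
    moreover have "(\<lambda>i. - a i) \<in> coeffs" using a(1) by (auto simp: coeffs_def)
    ultimately show ?thesis by blast
  qed
  show "compactin (sobolev_topology p \<Omega>) {v \<in> ?F. Lp_norm p (boundary_measure \<Omega>) (trace_on_boundary p \<Omega> v) = 1}"
  proof -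
    let ?S = "{a. (\<forall>i\<ge>k. a i = 0) \<and> (\<Sum>i<k. \<bar>a i\<bar> powr p * boundary_mass i) = 1}"
    have norm1: "Lp_norm p (boundary_measure \<Omega>) (trace_on_boundary p \<Omega> (comb a)) = 1 \<longleftrightarrow>
        (\<Sum>i<k. \<bar>a i\<bar> powr p * boundary_mass i) = 1" if "a \<in> coeffs" for a
      using comb_boundary_mass_pos[OF that] p_pos comb_boundary_mass[of a]
      by (cases "(\<Sum>i<k. \<bar>a i\<bar> powr p * boundary_mass i) = 1") (simp_all add: Lp_norm_def)
    have sub: "?S \<subseteq> coeffs"
    proof
      fix a assume a: "a \<in> ?S"
      then have "\<exists>i<k. a i \<noteq> 0" by (intro ccontr[of "\<exists>i<k. a i \<noteq> 0"]) auto
      then show "a \<in> coeffs" using a by (auto simp: coeffs_def)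
    qed
    have "{v \<in> ?F. Lp_norm p (boundary_measure \<Omega>) (trace_on_boundary p \<Omega> v) = 1} = comb ` ?S"
    proof (intro equalityI subsetI)
      fix v assume "v \<in> {v \<in> ?F. Lp_norm p (boundary_measure \<Omega>) (trace_on_boundary p \<Omega> v) = 1}"
      then obtain a where a: "a \<in> coeffs" "v = comb a" "Lp_norm p (boundary_measure \<Omega>) (trace_on_boundary p \<Omega> (comb a)) = 1"
        by blast
      then have "a \<in> ?S" using norm1[OF a(1)] by (simp add: coeffs_def)
      then show "v \<in> comb ` ?S" using a(2) by blast
    next
      fix v assume "v \<in> comb ` ?S"
      then obtain a where a: "a \<in> ?S" "v = comb a" by blast
      then have "a \<in> coeffs" using sub by blast
      then show "v \<in> {v \<in> ?F. Lp_norm p (boundary_measure \<Omega>) (trace_on_boundary p \<Omega> v) = 1}"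
        using norm1 a by blast
    qed
    then show ?thesis
      using image_compactin[OF _ comb_continuous, of ?S] compact_boundary_sphere by simp
  qed
  show "enat k \<le> krasnoselskii_genus p \<Omega> ?F" by (rule genus_ge)
qed

theorem steklov_eigenvalue_le:
  assumes \<Lambda>: "\<And>i. i < k \<Longrightarrow> energy i \<le> \<Lambda> * boundary_mass i"
  shows "steklov_eigenvalue p \<Omega> k \<le> ennreal \<Lambda>"
proof -
  have "steklov_quotient p \<Omega> (comb a) \<le> ennreal \<Lambda>" if a: "a \<in> coeffs" for a
  proof -
    let ?den = "\<Sum>i<k. \<bar>a i\<bar> powr p * boundary_mass i"
    have den: "0 < ?den" by (rule comb_boundary_mass_pos[OF a])
    have "(\<Sum>i<k. \<bar>a i\<bar> powr p * energy i) \<le> (\<Sum>i<k. \<bar>a i\<bar> powr p * (\<Lambda> * boundary_mass i))"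
      by (intro sum_mono mult_left_mono \<Lambda>) auto
    also have "\<dots> = \<Lambda> * ?den" by (simp add: sum_distrib_left algebra_simps)
    finally have "(\<Sum>i<k. \<bar>a i\<bar> powr p * energy i) / ?den \<le> \<Lambda>" using den by (simp add: divide_le_eq)
    then show ?thesis
      using den unfolding steklov_quotient_def Let_def comb_boundary_mass weak_gradient_C1_integral[OF comb_C1 domain(1)] comb_energy
      by (simp add: ennreal_leI)
  qed
  then have "(SUP v \<in> comb ` coeffs. steklov_quotient p \<Omega> v) \<le> ennreal \<Lambda>"
    by (intro SUP_least) auto
  then show ?thesis
    unfolding steklov_eigenvalue_def using comb_admissible by (rule INF_lower2[rotated])
qed

end

section \<open>Bumps at boundary points\<close>

lemma bump_ge: "dist x a < r \<Longrightarrow> 9 * r ^ 4 \<le> bump a (2 * r) x"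
proof -
  assume d: "dist x a < r"
  then have r: "0 < r" using zero_le_dist[of x a] by linarith
  have "(dist x a)^2 \<le> r^2" using d by (intro power_mono) auto
  then have "3 * r^2 \<le> max 0 ((2 * r)^2 - (dist x a)^2)" by (simp add: power_mult_distrib)
  then have "(3 * r^2)^2 \<le> bump a (2 * r) x"
    unfolding bump_def using r by (intro power_mono) auto
  then show ?thesis by (simp add: power_mult_distrib flip: power_mult)
qed

lemma norm_bump_gradient_le:
  assumes r: "0 < r" shows "norm (bump_gradient a (2 * r) x) \<le> 32 * r ^ 3"
proof (cases "x \<in> ball a (2 * r)")
  case True
  have "norm (bump_gradient a (2 * r) x) = (2 * max 0 ((2 * r)^2 - (dist x a)^2)) * (2 * dist x a)"
    by (simp add: bump_gradient_def dist_norm)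
  also have "\<dots> \<le> (2 * (2 * r)^2) * (2 * (2 * r))"
    using True r by (intro mult_mono) (auto simp: dist_commute)
  also have "\<dots> = 32 * r ^ 3" by (simp add: power2_eq_square power3_eq_cube)
  finally show ?thesis .
next
  case False
  then show ?thesis using bump_gradient_zero[of "2 * r" x a] r by simp
qed

lemma emeasure_hausdorff_frontier:
  "emeasure (hausdorff_measure s) (frontier \<Omega> \<inter> ball x r) = hausdorff_outer_measure s (frontier \<Omega> \<inter> ball x r)"
  by (intro emeasure_hausdorff_measure sets.Int) auto

lemma emeasure_boundary_ball:
  fixes \<Omega> :: "'a::euclidean_space set"
  shows "emeasure (boundary_measure \<Omega>) (frontier \<Omega> \<inter> ball x r)
    = hausdorff_outer_measure (DIM('a) - 1) (frontier \<Omega> \<inter> ball x r)"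
  unfolding boundary_measure_def
  by (subst emeasure_restrict_space) (auto simp: emeasure_hausdorff_frontier)

lemma volume_ball_le_frontier_ball:
  fixes \<Omega> :: "'a::euclidean_space set"
  assumes n: "DIM('a) \<ge> 2" and \<Omega>: "open \<Omega>" "convex \<Omega>" and x: "x \<in> frontier \<Omega>" and r: "0 < r"
  shows "emeasure lborel (\<Omega> \<inter> ball x (2 * r))
    \<le> ennreal (4 ^ DIM('a) * r / cylinder_ratio DIM('a)) * hausdorff_outer_measure (DIM('a) - 1) (frontier \<Omega> \<inter> ball x r)"
proof -
  let ?n = "DIM('a)"
  let ?k = "cylinder_ratio ?n" and ?V = "emeasure lborel (\<Omega> \<inter> ball x (r / 2))"
  let ?H = "hausdorff_outer_measure (?n - 1) (frontier \<Omega> \<inter> ball x r)"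
  have k: "?k > 0" by (rule cylinder_ratio_pos)
  have low: "ennreal (?k / r) * ?V \<le> ?H"
    by (rule volume_le_hausdorff_frontier[OF n \<Omega> x r])
  have "?V = ennreal (r / ?k) * (ennreal (?k / r) * ?V)"
  proof -
    have "ennreal (r / ?k) * ennreal (?k / r) = ennreal ((r / ?k) * (?k / r))"
      using k r by (intro ennreal_mult[symmetric]) auto
    also have "(r / ?k) * (?k / r) = 1" using k r by simp
    finally show ?thesis by (simp add: mult.assoc[symmetric])
  qed
  also have "\<dots> \<le> ennreal (r / ?k) * ?H" by (intro mult_left_mono low) auto
  finally have "?V \<le> ennreal (r / ?k) * ?H" .
  then have "ennreal (4 ^ ?n) * ?V \<le> ennreal (4 ^ ?n) * (ennreal (r / ?k) * ?H)" by (intro mult_left_mono) auto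
  also have "\<dots> = ennreal (4 ^ ?n * r / ?k) * ?H"
    using k r by (simp add: mult.assoc[symmetric] ennreal_mult[symmetric])
  finally show ?thesis
    using emeasure_convex_ball_doubling[OF \<Omega>, of x r] x by (auto simp: frontier_def)
qed

lemma frontier_ball_pos:
  fixes \<Omega> :: "'a::euclidean_space set"
  assumes n: "DIM('a) \<ge> 2" and \<Omega>: "open \<Omega>" "convex \<Omega>" and x: "x \<in> frontier \<Omega>" and r: "0 < r"
  shows "0 < hausdorff_outer_measure (DIM('a) - 1) (frontier \<Omega> \<inter> ball x r)"
proof -
  have "x \<in> closure \<Omega>" using x by (simp add: frontier_def)
  then obtain y where "y \<in> \<Omega>" "dist y x < 2 * r"
    using r unfolding closure_approachable by (metis mult_pos_pos zero_less_numeral)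
  then have "\<Omega> \<inter> ball x (2 * r) \<noteq> {}" by (auto simp: dist_commute)
  then have "0 < emeasure lborel (\<Omega> \<inter> ball x (2 * r))"
    using \<Omega> by (intro open_emeasure_pos) auto
  then show ?thesis
    using volume_ball_le_frontier_ball[OF assms] by (auto simp: zero_less_iff_neq_zero)
qed

text \<open>
  The points are chosen one after another: the balls of radius \<open>r\<close> about fewer than \<open>k\<close> points do not
  exhaust the boundary area.
\<close>

lemma separated_boundary_points:
  fixes \<Omega> :: "'a::euclidean_space set"
  assumes n: "DIM('a) \<ge> 2" and \<Omega>: "open \<Omega>" "convex \<Omega>" "\<Omega> \<noteq> {}" and r: "0 < r"
    and k: "\<And>m. m < k \<Longrightarrow> ennreal (real m * (frontier_density DIM('a) * r ^ (DIM('a) - 1))) < hausdorff_outer_measure (DIM('a) - 1) (frontier \<Omega>)"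
  shows "\<exists>x. (\<forall>i<k. x i \<in> frontier \<Omega>) \<and> (\<forall>i<k. \<forall>j<k. i \<noteq> j \<longrightarrow> r \<le> dist (x i) (x j))"
proof -
  let ?H = "hausdorff_outer_measure (DIM('a) - 1) :: 'a set \<Rightarrow> ennreal"
  let ?c = "frontier_density DIM('a) * r ^ (DIM('a) - 1)"
  have c: "0 < ?c" using r n by (auto intro!: mult_pos_pos frontier_density_pos)
  have "\<exists>x. (\<forall>i<m. x i \<in> frontier \<Omega>) \<and> (\<forall>i<m. \<forall>j<m. i \<noteq> j \<longrightarrow> r \<le> dist (x i) (x j))" if "m \<le> k" for m
    using that
  proof (induction m)
    case 0
    then show ?case by simp
  next
    case (Suc m)
    then obtain x where x: "\<And>i. i < m \<Longrightarrow> x i \<in> frontier \<Omega>" "\<And>i j. i < m \<Longrightarrow> j < m \<Longrightarrow> i \<noteq> j \<Longrightarrow> r \<le> dist (x i) (x j)"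
      by auto
    have "\<exists>y\<in>frontier \<Omega>. \<forall>i<m. r \<le> dist (x i) y"
    proof (rule ccontr)
      assume "\<not> ?thesis"
      then have "frontier \<Omega> \<subseteq> (\<Union>i. if i < m then frontier \<Omega> \<inter> ball (x i) r else {})"
        by (auto simp: not_le)
      then have "?H (frontier \<Omega>) \<le> ?H (\<Union>i. if i < m then frontier \<Omega> \<inter> ball (x i) r else {})"
        by (rule hausdorff.mono)
      also have "\<dots> \<le> (\<Sum>i. ?H (if i < m then frontier \<Omega> \<inter> ball (x i) r else {}))"
        by (rule hausdorff.countable_subadditive)
      also have "\<dots> = (\<Sum>i<m. ?H (if i < m then frontier \<Omega> \<inter> ball (x i) r else {}))"
        by (intro suminf_finite) (auto simp: hausdorff.empty)
      also have "\<dots> \<le> (\<Sum>i<m. ennreal ?c)"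
        using hausdorff_frontier_ball_le[OF \<Omega> r n] by (intro sum_mono) auto
      also have "\<dots> = ennreal (real m * ?c)"
        using c by (simp add: ennreal_of_nat_eq_real_of_nat ennreal_mult[symmetric] del: ennreal_mult)
      finally show False using k[of m] Suc.prems by simp
    qed
    then obtain y where y: "y \<in> frontier \<Omega>" "\<And>i. i < m \<Longrightarrow> r \<le> dist (x i) y" by blast
    show ?case
      using x y by (intro exI[of _ "x(m := y)"]) (auto simp: less_Suc_eq dist_commute)
  qed
  then show ?thesis by blast
qed

lemma finite_boundary_measure:
  fixes \<Omega> :: "'a::euclidean_space set"
  assumes n: "DIM('a) \<ge> 2" and \<Omega>: "open \<Omega>" "convex \<Omega>" "\<Omega> \<noteq> {}" "bounded \<Omega>"
  shows "hausdorff_outer_measure (DIM('a) - 1) (frontier \<Omega>) < \<infinity>"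
    and "finite_measure (boundary_measure \<Omega>)"
proof -
  obtain R where R: "0 < R" "frontier \<Omega> \<subseteq> ball 0 R"
    using bounded_subset_ballD[OF compact_imp_bounded[OF compact_frontier_bounded[OF \<Omega>(4)]]] by blast
  then have eq: "frontier \<Omega> \<inter> ball 0 R = frontier \<Omega>" by blast
  show fin: "hausdorff_outer_measure (DIM('a) - 1) (frontier \<Omega>) < \<infinity>"
    using hausdorff_frontier_ball_le[OF \<Omega>(1-3) R(1) n, of 0] unfolding eq by (simp add: order_le_less_trans)
  have "emeasure (boundary_measure \<Omega>) (frontier \<Omega>) < \<infinity>"
    using fin emeasure_boundary_ball[of \<Omega> 0 R] unfolding eq by simp
  then show "finite_measure (boundary_measure \<Omega>)"
    by (intro finite_measureI) auto
qed

text \<open>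
  The bump is at least \<open>9 r^4\<close> on the ball of radius \<open>r\<close>, and its gradient is at most \<open>32 r^3\<close> on the
  ball of radius \<open>2 r\<close>. The \<open>p\<close>-th power of their ratio, times the ratio of volume to boundary area, is \<open>L\<close>.
\<close>

lemma bump_energy_le:
  fixes \<Omega> :: "'a::euclidean_space set"
  assumes n: "DIM('a) \<ge> 2" and \<Omega>: "open \<Omega>" "convex \<Omega>" "\<Omega> \<noteq> {}" "bounded \<Omega>" and x: "x \<in> frontier \<Omega>" and r: "0 < r" and p: "0 < p"
  defines "L \<equiv> (32 / 9) powr p * 4 ^ DIM('a) / cylinder_ratio DIM('a) * r powr (1 - p)"
  shows "0 < (\<integral>y. \<bar>bump x (2 * r) y\<bar> powr p \<partial>boundary_measure \<Omega>)"
    and "(\<integral>y. norm (bump_gradient x (2 * r) y) powr p \<partial>lebesgue_on \<Omega>) \<le> L * (\<integral>y. \<bar>bump x (2 * r) y\<bar> powr p \<partial>boundary_measure \<Omega>)"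
proof -
  let ?n = "DIM('a)"
  let ?E = "\<integral>y. norm (bump_gradient x (2 * r) y) powr p \<partial>lebesgue_on \<Omega>"
  let ?M = "\<integral>y. \<bar>bump x (2 * r) y\<bar> powr p \<partial>boundary_measure \<Omega>"
  let ?S = "frontier \<Omega> \<inter> ball x r"
  let ?H = "hausdorff_outer_measure (?n - 1) ?S"
  define g where "g = (32 * r ^ 3) powr p"
  define b where "b = (9 * r ^ 4) powr p"
  have k: "cylinder_ratio ?n > 0" by (rule cylinder_ratio_pos)
  have L0: "0 \<le> L" using k by (simp add: L_def)
  have b: "b > 0" using r by (simp add: b_def)
  have bc: "continuous_on UNIV (\<lambda>y. \<bar>bump x (2 * r) y\<bar> powr p)"
    using continuous_norm_powr[OF C1_imp_continuous[OF C1_bump] p] by simp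
  have "ennreal b * ?H = (\<integral>\<^sup>+y. ennreal b * indicator ?S y \<partial>boundary_measure \<Omega>)"
  proof -
    have "?S \<in> sets (boundary_measure \<Omega>)"
      by (auto simp: boundary_measure_def sets_restrict_space_iff)
    then show ?thesis by (simp add: nn_integral_cmult_indicator emeasure_boundary_ball)
  qed
  also have "\<dots> \<le> (\<integral>\<^sup>+y. ennreal (\<bar>bump x (2 * r) y\<bar> powr p) \<partial>boundary_measure \<Omega>)"
  proof (rule nn_integral_mono)
    fix y
    show "ennreal b * indicator ?S y \<le> ennreal (\<bar>bump x (2 * r) y\<bar> powr p)"
    proof (cases "y \<in> ?S")
      case True
      then have "9 * r ^ 4 \<le> bump x (2 * r) y" by (intro bump_ge) (auto simp: dist_commute)
      then have "b \<le> \<bar>bump x (2 * r) y\<bar> powr p" unfolding b_def using r p by (intro powr_mono2) auto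
      then show ?thesis using True by (simp add: ennreal_leI)
    qed simp
  qed
  also have "\<dots> = ennreal ?M"
    using integrable_boundary_continuous[OF finite_boundary_measure(2)[OF n \<Omega>] \<Omega>(4) bc]
    by (intro nn_integral_eq_integral) auto
  finally have M: "ennreal b * ?H \<le> ennreal ?M" .
  have "0 < ennreal b * ?H"
    using b frontier_ball_pos[OF n \<Omega>(1,2) x r] by (simp add: ennreal_zero_less_mult_iff)
  then show Mpos: "0 < ?M" using M by (metis ennreal_less_zero_iff less_le_trans)
  have "ennreal ?E = (\<integral>\<^sup>+y. ennreal (norm (bump_gradient x (2 * r) y) powr p) * indicator \<Omega> y \<partial>lborel)"
    by (intro bounded_continuous_integrable_on(2) \<Omega> continuous_norm_powr C1_grad_continuous[OF C1_bump] p) auto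
  also have "\<dots> \<le> (\<integral>\<^sup>+y. ennreal g * indicator (\<Omega> \<inter> ball x (2 * r)) y \<partial>lborel)"
  proof (rule nn_integral_mono)
    fix y
    show "ennreal (norm (bump_gradient x (2 * r) y) powr p) * indicator \<Omega> y \<le> ennreal g * indicator (\<Omega> \<inter> ball x (2 * r)) y"
    proof (cases "y \<in> ball x (2 * r)")
      case True
      have "norm (bump_gradient x (2 * r) y) powr p \<le> g"
        unfolding g_def using p by (intro powr_mono2 norm_bump_gradient_le r) auto
      then show ?thesis using True by (auto simp: indicator_def ennreal_leI)
    next
      case False
      then show ?thesis using bump_gradient_zero[of "2 * r" y x] r by simp
    qed
  qed
  also have "\<dots> = ennreal g * emeasure lborel (\<Omega> \<inter> ball x (2 * r))"
    using \<Omega> by (intro nn_integral_cmult_indicator) auto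
  also have "\<dots> \<le> ennreal g * (ennreal (4 ^ ?n * r / cylinder_ratio ?n) * ?H)"
    by (intro mult_left_mono volume_ball_le_frontier_ball[OF n \<Omega>(1,2) x r]) auto
  also have "\<dots> = ennreal (g * (4 ^ ?n * r / cylinder_ratio ?n)) * ?H"
    using r k by (subst ennreal_mult) (auto simp: g_def mult.assoc)
  also have "g * (4 ^ ?n * r / cylinder_ratio ?n) = L * b"
  proof -
    have "32 * r ^ 3 = (32 / 9) * (9 * r ^ 4) * (1 / r)"
      using r by (simp add: power_numeral_reduce)
    then have "g = (32 / 9) powr p * b * (1 / r) powr p"
      unfolding g_def b_def using r by (simp only: powr_mult)
    moreover have "(1 / r) powr p * r = r powr (1 - p)"
      using r by (simp add: powr_divide powr_diff)
    ultimately show ?thesis unfolding L_def by (simp add: mult.assoc mult.left_commute)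
  qed
  also have "ennreal (L * b) * ?H = ennreal L * (ennreal b * ?H)"
    using L0 b by (simp add: ennreal_mult mult.assoc)
  also have "\<dots> \<le> ennreal L * ennreal ?M" by (intro mult_left_mono M) auto
  also have "\<dots> = ennreal (L * ?M)" using L0 Mpos by (simp add: ennreal_mult)
  finally show "?E \<le> L * ?M" using L0 Mpos by (subst (asm) ennreal_le_iff) auto
qed

text \<open>
  The radius \<open>r\<close> solves \<open>frontier_density n * (4 r) ^ (n - 1) = |\<partial>\<Omega>| / k\<close>, which is exactly the condition for
  finding \<open>k\<close> boundary points at mutual distance \<open>4 r\<close>, so that the bumps of radius \<open>2 r\<close> are disjoint.
\<close>

theorem steklov_eigenvalue_convex_bound:
  fixes p :: real
  assumes n: "DIM('a::euclidean_space) \<ge> 2" and p: "p > real DIM('a)"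
  shows "\<exists>C>0. \<forall>(\<Omega> :: 'a set) k::nat. open \<Omega> \<and> convex \<Omega> \<and> \<Omega> \<noteq> {} \<and> bounded \<Omega> \<and> k \<ge> 1 \<longrightarrow>
      steklov_eigenvalue p \<Omega> k \<le>
        ennreal (C * (real k / measure (hausdorff_measure (DIM('a) - 1)) (frontier \<Omega>)) powr ((p - 1) / (real DIM('a) - 1)))"
proof -
  let ?n = "DIM('a)" and ?s = "DIM('a) - 1"
  define c where "c = frontier_density ?n"
  have c: "c > 0" using n by (auto simp: c_def intro: frontier_density_pos)
  define q where "q = (p - 1) / (real ?n - 1)"
  have s: "real ?s = real ?n - 1" "0 < real ?s" using n by auto
  have p0: "p > 0" using p by (metis le_less_trans of_nat_0_le_iff)
  define L0 where "L0 = (32 / 9) powr p * 4 ^ ?n / cylinder_ratio ?n"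
  have L0: "L0 > 0" using cylinder_ratio_pos by (simp add: L0_def)
  define C where "C = L0 * 4 powr (p - 1) * c powr q"
  have "C > 0" using L0 c by (simp add: C_def)
  moreover have "steklov_eigenvalue p \<Omega> k \<le> ennreal (C * (real k / measure (hausdorff_measure ?s) (frontier \<Omega>)) powr q)"
    if \<Omega>: "open \<Omega>" "convex \<Omega>" "\<Omega> \<noteq> {}" "bounded \<Omega>" and k: "k \<ge> 1" for \<Omega> :: "'a set" and k :: nat
  proof -
    define A where "A = measure (hausdorff_measure ?s) (frontier \<Omega>)"
    have He: "emeasure (hausdorff_measure ?s) (frontier \<Omega>) = hausdorff_outer_measure ?s (frontier \<Omega>)"
      by (rule emeasure_hausdorff_measure) auto
    have H: "hausdorff_outer_measure ?s (frontier \<Omega>) = ennreal A"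
      using finite_boundary_measure(1)[OF n \<Omega>] unfolding A_def He[symmetric]
      by (intro emeasure_eq_ennreal_measure) auto
    have "frontier \<Omega> \<noteq> {}"
      using \<Omega> by (metis frontier_eq_empty not_bounded_UNIV)
    then obtain x0 where x0: "x0 \<in> frontier \<Omega>" by blast
    have "0 < hausdorff_outer_measure ?s (frontier \<Omega> \<inter> ball x0 1)"
      using frontier_ball_pos[OF n \<Omega>(1,2) x0, of 1] by simp
    also have "\<dots> \<le> hausdorff_outer_measure ?s (frontier \<Omega>)" by (intro hausdorff.mono) auto
    finally have A: "A > 0" unfolding H by simp
    define X where "X = A / (c * real k)"
    have X: "X > 0" using A c k by (simp add: X_def)
    define r where "r = X powr (1 / real ?s) / 4"
    have r: "r > 0" using X by (simp add: r_def)
    have r4: "(4 * r) ^ ?s = X"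
    proof -
      have "(4 * r) ^ ?s = (X powr (1 / real ?s)) powr real ?s"
        using X by (simp add: r_def powr_realpow del: of_nat_diff)
      also have "\<dots> = X" using X s by (simp add: powr_powr del: of_nat_diff)
      finally show ?thesis .
    qed
    have "\<exists>x. (\<forall>i<k. x i \<in> frontier \<Omega>) \<and> (\<forall>i<k. \<forall>j<k. i \<noteq> j \<longrightarrow> 4 * r \<le> dist (x i) (x j))"
    proof (rule separated_boundary_points[OF n \<Omega>(1-3)])
      fix m assume m: "m < k"
      have "real m * (c * X) = real m / real k * A" using c by (simp add: X_def)
      also have "\<dots> < 1 * A" using m A by (intro mult_strict_right_mono) auto
      finally show "ennreal (real m * (frontier_density ?n * (4 * r) ^ ?s)) < hausdorff_outer_measure ?s (frontier \<Omega>)"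
        unfolding r4 H using c X by (simp add: c_def[symmetric] ennreal_less_iff)
    qed (use r in auto)
    then obtain x where x: "\<And>i. i < k \<Longrightarrow> x i \<in> frontier \<Omega>"
        "\<And>i j. i < k \<Longrightarrow> j < k \<Longrightarrow> i \<noteq> j \<Longrightarrow> 4 * r \<le> dist (x i) (x j)" by blast
    interpret disjoint_test_functions p \<Omega> k "\<lambda>i. bump (x i) (2 * r)" "\<lambda>i. bump_gradient (x i) (2 * r)"
    proof (rule disjoint_test_functions.intro)
      fix i j y assume ij: "i < k" "j < k" "i \<noteq> j"
      have "y \<notin> ball (x i) (2 * r) \<or> y \<notin> ball (x j) (2 * r)"
      proof (rule ccontr)
        assume "\<not> ?thesis"
        then have "dist (x i) y < 2 * r" "dist y (x j) < 2 * r" by (auto simp: dist_commute)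
        then show False using x(2)[OF ij] dist_triangle[of "x i" "x j" y] by linarith
      qed
      then show "(bump (x i) (2 * r) y = 0 \<and> bump_gradient (x i) (2 * r) y = 0) \<or> (bump (x j) (2 * r) y = 0 \<and> bump_gradient (x j) (2 * r) y = 0)"
        using bump_zero[of "2 * r" y] bump_gradient_zero[of "2 * r" y] r by auto
    next
      show "0 < (\<integral>y. \<bar>bump (x i) (2 * r) y\<bar> powr p \<partial>boundary_measure \<Omega>)" if "i < k" for i
        by (rule bump_energy_le(1)[OF n \<Omega> x(1)[OF that] r p0])
    qed (simp_all add: \<Omega> p k[simplified] C1_bump finite_boundary_measure(2)[OF n \<Omega>])
    have "steklov_eigenvalue p \<Omega> k \<le> ennreal (L0 * r powr (1 - p))"
    proof (rule steklov_eigenvalue_le)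
      show "energy i \<le> L0 * r powr (1 - p) * boundary_mass i" if "i < k" for i
        unfolding energy_def boundary_mass_def L0_def
        by (rule bump_energy_le(2)[OF n \<Omega> x(1)[OF that] r p0])
    qed
    also have "L0 * r powr (1 - p) = C * (real k / A) powr q"
    proof -
      have "r powr (1 - p) = X powr ((1 - p) / real ?s) * 4 powr (p - 1)"
      proof -
        have "r powr (1 - p) = (X powr (1 / real ?s)) powr (1 - p) / 4 powr (1 - p)"
          using X by (simp add: r_def powr_divide)
        also have "\<dots> = X powr ((1 - p) / real ?s) * 4 powr (p - 1)"
          using powr_minus_divide[of 4 "1 - p"] by (simp add: powr_powr divide_inverse mult.commute)
        finally show ?thesis .
      qed
      also have "X powr ((1 - p) / real ?s) = (1 / X) powr q"
      proof -
        have "(1 - p) / real ?s = - q" unfolding q_def s(1) by (simp add: minus_divide_left)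
        then show ?thesis using X by (simp add: powr_minus_divide powr_divide)
      qed
      also have "1 / X = c * (real k / A)" by (simp add: X_def)
      also have "(c * (real k / A)) powr q = c powr q * (real k / A) powr q"
        using c A by (intro powr_mult)
      finally show ?thesis by (simp add: C_def)
    qed
    finally show ?thesis unfolding A_def .
  qed
  ultimately show ?thesis unfolding q_def by blast
qed

theorem corollary3p1:
  fixes p :: real
  assumes "CARD('n::finite) \<ge> 2" and "p > real CARD('n)"
  shows "\<exists>C>0. \<forall>(\<Omega> :: (real ^ 'n) set) k::nat.
    open \<Omega> \<and> connected \<Omega> \<and> \<Omega> \<noteq> {} \<and> bounded \<Omega> \<and> convex \<Omega> \<and> k \<ge> 1 \<longrightarrow>
      steklov_eigenvalue p \<Omega> k \<le>
        ennreal (C * (real k / measure (hausdorff_measure (CARD('n) - 1)) (frontier \<Omega>))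
                       powr ((p - 1) / (real CARD('n) - 1)))"
proof -
  have dim: "DIM(real ^ 'n) = CARD('n)" by simp
  show ?thesis
    using steklov_eigenvalue_convex_bound[where 'a = "real ^ 'n" and p = p] assms unfolding dim by blast
qed

end
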